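(* Let $(T_n)_{n\in\mathbb{N}}$ be a BST sequence and let $Z_n:=(Y^\circ(T_n),\eta^\circ(T_n))$, regarded as a random element of the separable Banach space $(S,\|\cdot\|)$. Then $Z_n\to_{\mathcal{D}}Z_\infty$ as $n\to\infty$ for some random element $Z_\infty$ of $S$, where the distribution of $Z_\infty$ is the unique fixed point of the operator $\Psi:\mathcal{M}\to\mathcal{M}$.
   Context: $\to_{\mathcal{D}}$ denotes convergence in distribution (with respect to the norm topology on $S$). Nodes are the finite words over $\{0,1\}$, i.e. elements of $\mathcal{N}:=\bigcup_{k\ge 0}\{0,1\}^k$, including the empty word (the root). A binary tree is a finite, prefix-stable set $T\subset\mathcal{N}$: if $(u_1,\ldots,u_k)\in T$ with $k\ge1$, then $(u_1,\ldots,u_{k-1})\in T$. $\#T$ is the number of nodes of $T$. BST sequence: let $(\xi_n)_{n\in\mathbb{N}}$ be independent random variables, uniformly distributed on the unit interval. $T_1$ consists only of the root, with label $\xi_1$. Given $T_n$ with its labels, $T_{n+1}$ is obtained as follows: start at the root; at a node $u\in T_n$ move to $(u,0)$ (left) if $\xi_{n+1}$ is smaller than the label of $u$ and to $(u,1)$ (right) if it is greater; the first node reached that is not in $T_n$ is added to the tree and receives the label $\xi_{n+1}$. The sequence $(T_n)_{n\in\mathbb{N}}$ of random binary trees (with labels ignored) is called a BST sequence. Silhouette: each $s\in[0,1]$ has a binary expansion $s=\sum_{k\ge1}u_k2^{-k}$, $u_k\in\{0,1\}$, made unique by requiring that for binary rationals $s<1$ one has $u_k=0$ for all sufficiently large $k$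 (for $s=1$ all $u_k=1$). For a binary tree $T$ put $X_s(T):=\min\{k\in\mathbb{N}_0:(u_1,\ldots,u_k)\notin T\}$. Integrated silhouette: $Y_t(T):=\int_0^tX_s(T)\,ds$ and $Y^\circ_t(T):=Y_t(T)-tY_1(T)$ for $t\in[0,1]$, $Y^\circ(T)=(Y^\circ_t(T))_{0\le t\le1}$. Further $\eta(T):=Y_1(T)=\int_0^1X_s(T)\,ds$ and $\eta^\circ(T):=\eta(T)-H(\#T)$, with $H(n)=\sum_{i=1}^n1/i$, $H(0)=0$. Space: $S:=C_{00}[0,1]\times\mathbb{R}$, where $C_{00}[0,1]$ is the set of continuous $f:[0,1]\to\mathbb{R}$ with $f(0)=f(1)=0$, with norm $\|(f,a)\|:=\|f\|_\infty+|a|$. $\mathcal{M}$ is the set of probability measures $\mu$ on the Borel subsets of $S$ with $\int(\|f\|_\infty^2+x^2)\,\mu(df,dx)<\infty$ and $\int x\,\mu(df,dx)=0$. Linear operators $A,B:C_{00}[0,1]\to C[0,1]$: $Af(t):=\frac12f(2t\wedge1)$, $Bf(t):=\frac12f((2t-1)^+)$ (both in fact take values in $C_{00}[0,1]$); $\phi(t):=\frac12(t\wedge(1-t))$ for $0\le t\le1$. Operator $\Psi$: for $\mu\in\mathcal{M}$, $\Psi(\mu)\in\mathcal{M}$ is the joint distribution of the random function $AY+BY'+(\eta-\eta')\phi+(\log\xi-\log(1-\xi))\phi$ and the real random variable $1+\frac12(\eta+\eta')+\frac12(\log\xi+\log(1-\xi))$, where $(Y,\eta)$, $(Y',\eta')$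 and $\xi$ are independent, $(Y,\eta)\sim\mu$, $(Y',\eta')\sim\mu$, and $\xi$ is uniformly distributed on $(0,1)$. *)

theory Defs
  imports "HOL-Probability.Probability"
begin

section \<open>The space of continuous functions on the unit interval vanishing at both ends\<close>

text \<open>
  A function on the closed unit interval is represented by its extension by zero to the real line,
  so that equality of elements is equality of functions on the unit interval.
\<close>

typedef c00 = "{f :: real \<Rightarrow> real. continuous_on {0..1} f \<and> f 0 = 0 \<and> f 1 = 0 \<and>
    (\<forall>t. t \<notin> {0..1} \<longrightarrow> f t = 0)}"
  morphisms c00_apply Abs_c00
  by (rule exI[of _ "\<lambda>_. 0"]) auto

text \<open>Only meaningful if \<open>f\<close> is continuous on the unit interval and vanishes at both ends.\<close>

definition to_c00 :: "(real \<Rightarrow> real) \<Rightarrow> c00" where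
  "to_c00 f = Abs_c00 (\<lambda>t. if t \<in> {0..1} then f t else 0)"

lemma c00_continuous: "continuous_on {0..1} (c00_apply f)"
  and c00_apply_0 [simp]: "c00_apply f 0 = 0"
  and c00_apply_1 [simp]: "c00_apply f 1 = 0"
  and c00_apply_outside: "t \<notin> {0..1} \<Longrightarrow> c00_apply f t = 0"
  using c00_apply[of f] by auto

lemma c00_eqI:
  assumes "\<And>t. t \<in> {0..1} \<Longrightarrow> c00_apply f t = c00_apply g t"
  shows "f = g"
proof -
  have "c00_apply f t = c00_apply g t" for t
    using assms c00_apply_outside[of t f] c00_apply_outside[of t g] by (cases "t \<in> {0..1}") auto
  then show ?thesis by (metis c00_apply_inject ext)
qed

lemma c00_apply_to_c00:
  assumes "continuous_on {0..1} f" "f 0 = 0" "f 1 = 0"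
  shows "c00_apply (to_c00 f) t = (if t \<in> {0..1} then f t else 0)"
proof -
  have "continuous_on {0..1} (\<lambda>t. if t \<in> {0..1} then f t else 0)"
    using assms(1) by (rule continuous_on_eq) auto
  then show ?thesis
    unfolding to_c00_def using assms by (subst Abs_c00_inverse) auto
qed

lemma c00_bdd_above: "bdd_above ((\<lambda>t. \<bar>c00_apply f t\<bar>) ` {0..1})"
proof -
  have "compact ((\<lambda>t. \<bar>c00_apply f t\<bar>) ` {0..1})"
    by (intro compact_continuous_image continuous_intros c00_continuous) auto
  then show ?thesis by (simp add: bounded_imp_bdd_above compact_imp_bounded)
qed

instantiation c00 :: real_normed_vector
begin

definition zero_c00 :: c00 where "0 = to_c00 (\<lambda>t. 0)"
definition plus_c00 :: "c00 \<Rightarrow> c00 \<Rightarrow> c00" where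
  "f + g = to_c00 (\<lambda>t. c00_apply f t + c00_apply g t)"
definition minus_c00 :: "c00 \<Rightarrow> c00 \<Rightarrow> c00" where
  "f - g = to_c00 (\<lambda>t. c00_apply f t - c00_apply g t)"
definition uminus_c00 :: "c00 \<Rightarrow> c00" where
  "- f = to_c00 (\<lambda>t. - c00_apply f t)"
definition scaleR_c00 :: "real \<Rightarrow> c00 \<Rightarrow> c00" where
  "c *\<^sub>R f = to_c00 (\<lambda>t. c * c00_apply f t)"
definition norm_c00 :: "c00 \<Rightarrow> real" where
  "norm f = (SUP t\<in>{0..1}. \<bar>c00_apply f t\<bar>)"
definition dist_c00 :: "c00 \<Rightarrow> c00 \<Rightarrow> real" where "dist f g = norm (f - g)" for f g :: c00
definition sgn_c00 :: "c00 \<Rightarrow> c00" where "sgn f = inverse (norm f) *\<^sub>R f" for f :: c00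
definition uniformity_c00 :: "(c00 \<times> c00) filter" where
  "uniformity = (INF e\<in>{0<..}. principal {(f, g :: c00). dist f g < e})"
definition open_c00 :: "c00 set \<Rightarrow> bool" where
  "open U = (\<forall>x\<in>U. \<forall>\<^sub>F (x', y) in uniformity. x' = x \<longrightarrow> y \<in> U)" for U :: "c00 set"

lemma c00_zero: "c00_apply 0 t = 0"
  unfolding zero_c00_def by (subst c00_apply_to_c00) auto
lemma c00_plus: "c00_apply (f + g) t = c00_apply f t + c00_apply g t"
  unfolding plus_c00_def
  by (subst c00_apply_to_c00) (auto intro!: continuous_intros c00_continuous simp: c00_apply_outside)
lemma c00_minus: "c00_apply (f - g) t = c00_apply f t - c00_apply g t"
  unfolding minus_c00_def
  by (subst c00_apply_to_c00) (auto intro!: continuous_intros c00_continuous simp: c00_apply_outside)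
lemma c00_uminus: "c00_apply (- f) t = - c00_apply f t"
  unfolding uminus_c00_def
  by (subst c00_apply_to_c00) (auto intro!: continuous_intros c00_continuous simp: c00_apply_outside)
lemma c00_scaleR: "c00_apply (c *\<^sub>R f) t = c * c00_apply f t"
  unfolding scaleR_c00_def
  by (subst c00_apply_to_c00) (auto intro!: continuous_intros c00_continuous simp: c00_apply_outside)

lemmas c00_ops = c00_zero c00_plus c00_minus c00_uminus c00_scaleR

lemma c00_abs_le_norm: "\<bar>c00_apply f t\<bar> \<le> norm f"
proof (cases "t \<in> {0..1}")
  case True
  then show ?thesis unfolding norm_c00_def by (intro cSUP_upper c00_bdd_above)
next
  case False
  have "\<bar>c00_apply f 0\<bar> \<le> norm f" unfolding norm_c00_def by (intro cSUP_upper c00_bdd_above) auto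
  then show ?thesis using False by (simp add: c00_apply_outside)
qed

lemma c00_norm_le:
  assumes "\<And>t. t \<in> {0..1} \<Longrightarrow> \<bar>c00_apply f t\<bar> \<le> b"
  shows "norm f \<le> b"
  unfolding norm_c00_def using assms by (intro cSUP_least) auto

instance
proof
  fix f g h :: c00 and a b :: real
  show "f + g + h = f + (g + h)" "f + g = g + f" "0 + f = f" "- f + f = 0" "f - g = f + - g"
    "a *\<^sub>R (f + g) = a *\<^sub>R f + a *\<^sub>R g" "(a + b) *\<^sub>R f = a *\<^sub>R f + b *\<^sub>R f"
    "a *\<^sub>R b *\<^sub>R f = (a * b) *\<^sub>R f" "1 *\<^sub>R f = f"
    by (auto intro!: c00_eqI simp: c00_ops algebra_simps)
  show "dist f g = norm (f - g)" by (rule dist_c00_def)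
  show "sgn f = inverse (norm f) *\<^sub>R f" by (rule sgn_c00_def)
  show "uniformity = (INF e\<in>{0<..}. principal {(f, g :: c00). dist f g < e})"
    by (rule uniformity_c00_def)
  show "open U = (\<forall>x\<in>U. \<forall>\<^sub>F (x', y) in uniformity. x' = x \<longrightarrow> y \<in> U)" for U :: "c00 set"
    by (rule open_c00_def)
  show "norm f = 0 \<longleftrightarrow> f = 0"
  proof
    assume "norm f = 0"
    then show "f = 0" using c00_abs_le_norm[of f] by (intro c00_eqI) (auto simp: c00_zero)
  next
    assume "f = 0"
    then show "norm f = 0" by (simp add: norm_c00_def c00_zero)
  qed
  show "norm (f + g) \<le> norm f + norm g"
  proof (rule c00_norm_le)
    fix t
    show "\<bar>c00_apply (f + g) t\<bar> \<le> norm f + norm g"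
      using c00_abs_le_norm[of f t] c00_abs_le_norm[of g t] by (simp add: c00_plus)
  qed
  have le: "norm (c *\<^sub>R k) \<le> \<bar>c\<bar> * norm k" for c and k :: c00
    by (rule c00_norm_le) (auto simp: c00_scaleR abs_mult intro!: mult_left_mono c00_abs_le_norm)
  show "norm (a *\<^sub>R f) = \<bar>a\<bar> * norm f"
  proof (cases "a = 0")
    case True
    then show ?thesis by (simp add: norm_c00_def c00_scaleR)
  next
    case False
    then have "f = inverse a *\<^sub>R (a *\<^sub>R f)" by (intro c00_eqI) (simp add: c00_scaleR)
    then have "norm f \<le> \<bar>inverse a\<bar> * norm (a *\<^sub>R f)" using le by metis
    then have "\<bar>a\<bar> * norm f \<le> norm (a *\<^sub>R f)"
      using False by (simp add: abs_inverse field_simps)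
    then show ?thesis using le[of a f] by linarith
  qed
qed

end

instance c00 :: banach
proof
  fix X :: "nat \<Rightarrow> c00"
  assume "Cauchy X"
  have "uniformly_Cauchy_on UNIV (\<lambda>n. c00_apply (X n))"
  proof (rule uniformly_Cauchy_onI)
    fix e :: real assume "e > 0"
    then obtain N where N: "\<And>m n. m \<ge> N \<Longrightarrow> n \<ge> N \<Longrightarrow> dist (X m) (X n) < e"
      using \<open>Cauchy X\<close> unfolding Cauchy_def by blast
    show "\<exists>N. \<forall>t\<in>UNIV. \<forall>m\<ge>N. \<forall>n\<ge>N. dist (c00_apply (X m) t) (c00_apply (X n) t) < e"
    proof (intro exI[of _ N] ballI allI impI)
      fix t m n assume "m \<ge> N" "n \<ge> N"
      then show "dist (c00_apply (X m) t) (c00_apply (X n) t) < e"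
        using N[of m n] c00_abs_le_norm[of "X m - X n" t] by (simp add: dist_norm c00_minus)
    qed
  qed
  then obtain g where g: "uniform_limit UNIV (\<lambda>n. c00_apply (X n)) g sequentially"
    using Cauchy_uniformly_convergent uniformly_convergent_on_def by metis
  have lim: "(\<lambda>n. c00_apply (X n) t) \<longlonglongrightarrow> g t" for t
    using tendsto_uniform_limitI[OF g] by auto
  have "continuous_on {0..1} g"
    by (rule uniform_limit_theorem[OF _ uniform_limit_on_subset[OF g]])
       (auto intro: always_eventually c00_continuous)
  moreover have "g t = 0" if "t \<notin> {0..1} \<or> t = 0 \<or> t = 1" for t
  proof -
    have "(\<lambda>n. c00_apply (X n) t) = (\<lambda>n. 0)" using that by (auto simp: c00_apply_outside)
    then show ?thesis using lim[of t] by (simp add: LIMSEQ_const_iff)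
  qed
  ultimately obtain f where f: "c00_apply f = g"
    using Abs_c00_inverse[of g] by auto
  have "X \<longlonglongrightarrow> f"
  proof (rule metric_LIMSEQ_I)
    fix e :: real assume "e > 0"
    then obtain N where N: "\<And>n t. n \<ge> N \<Longrightarrow> dist (c00_apply (X n) t) (g t) < e / 2"
      using g unfolding uniform_limit_sequentially_iff by (metis UNIV_I half_gt_zero)
    have "norm (X n - f) \<le> e / 2" if "n \<ge> N" for n
      using N[OF that] by (intro c00_norm_le) (auto simp: c00_minus f dist_norm intro: less_imp_le)
    then show "\<exists>N. \<forall>n\<ge>N. dist (X n) f < e"
      using \<open>e > 0\<close> unfolding dist_norm by (intro exI[of _ N]) (force)
  qed
  then show "convergent X" by (auto simp: convergent_def)
qed

instance c00 :: second_countable_topology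
proof
  define P where "P n q = to_c00 (\<lambda>t. \<Sum>k\<le>n. (if k = 0 \<or> k = n then 0 else q ! k) * Bernstein n k t)"
    for n and q :: "real list"
  have P: "c00_apply (P n q) t =
      (\<Sum>k\<le>n. (if k = 0 \<or> k = n then 0 else q ! k) * Bernstein n k t)" if "t \<in> {0..1}" for n q t
    unfolding P_def using that
    by (subst c00_apply_to_c00)
       (auto simp: Bernstein_def intro!: continuous_intros sum.neutral)
  define D where "D = (\<lambda>(n, q). P n q) ` (UNIV \<times> lists \<rat>)"
  have "countable D" unfolding D_def by (intro countable_image countable_SIGMA countable_lists countable_rat) auto
  have dense: "\<exists>d\<in>D. dist d f < e" if "e > 0" for f e
  proof -
    have "\<exists>N. \<forall>n t. N \<le> n \<and> t \<in> {0..1} \<longrightarrow>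
        \<bar>c00_apply f t - (\<Sum>k\<le>n. c00_apply f (k/n) * Bernstein n k t)\<bar> < e / 3"
      using that by (intro Bernstein_Weierstrass c00_continuous) auto
    then obtain N where N: "\<And>n t. N \<le> n \<Longrightarrow> t \<in> {0..1} \<Longrightarrow>
        \<bar>c00_apply f t - (\<Sum>k\<le>n. c00_apply f (k/n) * Bernstein n k t)\<bar> < e / 3"
      by blast
    define n where "n = Suc N"
    have "\<exists>r\<in>\<rat>. \<bar>r - c00_apply f (real k / real n)\<bar> < e / 3" for k
    proof -
      obtain r where "r \<in> \<rat>" "c00_apply f (real k / real n) < r" "r < c00_apply f (real k / real n) + e / 3"
        using Rats_dense_in_real[of "c00_apply f (real k / real n)" "c00_apply f (real k / real n) + e / 3"] \<open>e > 0\<close> by auto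
      then show ?thesis by (intro bexI[of _ r]) auto
    qed
    then obtain r where r: "\<And>k. r k \<in> \<rat>" "\<And>k. \<bar>r k - c00_apply f (real k / real n)\<bar> < e / 3" by metis
    define q where "q = map r [0..<Suc n]"
    have qk: "q ! k = r k" if "k \<le> n" for k
      unfolding q_def using that by (subst nth_map) (auto simp del: upt_Suc)
    have "norm (P n q - f) \<le> 2 * e / 3"
    proof (rule c00_norm_le)
      fix t :: real assume t: "t \<in> {0..1}"
      let ?c = "\<lambda>k. if k = 0 \<or> k = n then 0 else q ! k"
      have c: "\<bar>?c k - c00_apply f (k/n)\<bar> \<le> e / 3" if "k \<le> n" for k
        using r(2)[of k] qk[OF that] \<open>e > 0\<close> by (auto simp: n_def)
      have "\<bar>(\<Sum>k\<le>n. ?c k * Bernstein n k t) - (\<Sum>k\<le>n. c00_apply f (k/n) * Bernstein n k t)\<bar>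
          = \<bar>\<Sum>k\<le>n. (?c k - c00_apply f (k/n)) * Bernstein n k t\<bar>"
        by (simp add: sum_subtractf left_diff_distrib)
      also have "\<dots> \<le> (\<Sum>k\<le>n. \<bar>?c k - c00_apply f (k/n)\<bar> * Bernstein n k t)"
        using t by (intro order.trans[OF sum_abs] sum_mono) (auto simp: abs_mult Bernstein_nonneg)
      also have "\<dots> \<le> (\<Sum>k\<le>n. (e / 3) * Bernstein n k t)"
        using t c by (intro sum_mono mult_right_mono) (auto simp: Bernstein_nonneg)
      also have "\<dots> = e / 3" by (simp only: flip: sum_distrib_left) simp
      finally show "\<bar>c00_apply (P n q - f) t\<bar> \<le> 2 * e / 3"
        using N[of n t] t unfolding c00_minus P[OF t] by (auto simp: n_def abs_if split: if_splits)
    qed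
    moreover have "P n q \<in> D" unfolding D_def q_def using r(1) by (force simp: in_lists_conv_set)
    ultimately show ?thesis using \<open>e > 0\<close> by (intro bexI[of _ "P n q"]) (auto simp: dist_norm)
  qed
  define B where "B = (\<lambda>(d, s). ball d s) ` (D \<times> (\<rat> \<inter> {0<..}))"
  have "countable B" unfolding B_def using \<open>countable D\<close>
    by (intro countable_image countable_SIGMA countable_Int1 countable_rat) auto
  moreover have "topological_basis B"
  proof (rule topological_basisI)
    show "\<And>U. U \<in> B \<Longrightarrow> open U" by (auto simp: B_def)
    fix U :: "c00 set" and x assume "open U" "x \<in> U"
    then obtain e where e: "e > 0" "ball x e \<subseteq> U" by (auto simp: open_contains_ball)
    obtain s where s: "s \<in> \<rat>" "0 < s" "s < e / 2" using Rats_dense_in_real[of 0 "e / 2"] e by auto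
    obtain d where d: "d \<in> D" "dist d x < s" using dense[of s x] s by auto
    have "ball d s \<subseteq> ball x e"
    proof
      fix y assume "y \<in> ball d s"
      then show "y \<in> ball x e" using d(2) s dist_triangle[of x y d] by (auto simp: dist_commute)
    qed
    then show "\<exists>V\<in>B. x \<in> V \<and> V \<subseteq> U"
      using d s e(2) by (intro bexI[of _ "ball d s"]) (auto simp: B_def)
  qed
  ultimately show "\<exists>B :: c00 set set. countable B \<and> open = generate_topology B"
    using topological_basis_imp_subbasis by blast
qed

text \<open>
  The product type \<open>c00 \<times> real\<close> carries the library's Euclidean product norm. Only the topology
  (and its Borel sets) matters below, and it is the one induced by the sum norm.
\<close>

lemma open_c00_real_iff_sum_norm:
  fixes U :: "(c00 \<times> real) set"
  shows "open U \<longleftrightarrow>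
    (\<forall>z\<in>U. \<exists>e>0. \<forall>w. norm (fst w - fst z) + \<bar>snd w - snd z\<bar> < e \<longrightarrow> w \<in> U)"
proof -
  have le: "dist w z \<le> norm (fst w - fst z) + \<bar>snd w - snd z\<bar>" for w z :: "c00 \<times> real"
    unfolding dist_prod_def dist_norm by (metis real_norm_def sqrt_sum_squares_le_sum norm_ge_zero)
  have ge: "norm (fst w - fst z) + \<bar>snd w - snd z\<bar> \<le> 2 * dist w z" for w z :: "c00 \<times> real"
    using dist_fst_le[of w z] dist_snd_le[of w z] by (simp add: dist_norm)
  show ?thesis unfolding open_dist
  proof (intro ball_cong refl iffI; elim exE conjE)
    fix z e assume "e > 0" "\<forall>w. dist w z < e \<longrightarrow> w \<in> U"
    then show "\<exists>e>0. \<forall>w. norm (fst w - fst z) + \<bar>snd w - snd z\<bar> < e \<longrightarrow> w \<in> U"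
      using le by (meson le_less_trans)
  next
    fix z e assume e: "e > 0" "\<forall>w. norm (fst w - fst z) + \<bar>snd w - snd z\<bar> < e \<longrightarrow> w \<in> U"
    have "w \<in> U" if "dist w z < e / 2" for w
    proof -
      have "norm (fst w - fst z) + \<bar>snd w - snd z\<bar> < e" using ge[of w z] that by linarith
      then show ?thesis using e(2) by blast
    qed
    then show "\<exists>e>0. \<forall>w. dist w z < e \<longrightarrow> w \<in> U" using e(1) by (meson half_gt_zero)
  qed
qed


section \<open>Binary trees and the silhouette\<close>

text \<open>Nodes are words over \<open>bool\<close>; \<open>False\<close> stands for 0 (left), \<open>True\<close> for 1 (right).\<close>

type_synonym node = "bool list"

definition binary_tree :: "node set \<Rightarrow> bool" where
  "binary_tree T \<longleftrightarrow> finite T \<and> (\<forall>u b. u @ [b] \<in> T \<longrightarrow> u \<in> T)"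

text \<open>The digit with weight \<open>2 ^ - (k + 1)\<close> has index \<open>k\<close>, i.e. digits are counted from 0.\<close>

definition is_bin_expansion :: "real \<Rightarrow> (nat \<Rightarrow> bool) \<Rightarrow> bool" where
  "is_bin_expansion s u \<longleftrightarrow>
    (\<lambda>k. of_bool (u k) / 2 ^ Suc k) sums s \<and>
    (s < 1 \<and> (\<exists>(m :: int) (j :: nat). s = of_int m / 2 ^ j) \<longrightarrow> (\<forall>\<^sub>F k in sequentially. \<not> u k))"

definition bin_digits :: "real \<Rightarrow> nat \<Rightarrow> bool" where
  "bin_digits s = (THE u. is_bin_expansion s u)"

definition silhouette :: "node set \<Rightarrow> real \<Rightarrow> nat" where
  "silhouette T s = (LEAST k. map (bin_digits s) [0..<k] \<notin> T)"

definition int_silhouette :: "node set \<Rightarrow> real \<Rightarrow> real" where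
  "int_silhouette T t = integral {0..t} (\<lambda>s. real (silhouette T s))"

definition centered_int_silhouette :: "node set \<Rightarrow> c00" where
  "centered_int_silhouette T = to_c00 (\<lambda>t. int_silhouette T t - t * int_silhouette T 1)"

definition eta :: "node set \<Rightarrow> real" where
  "eta T = int_silhouette T 1"

definition centered_eta :: "node set \<Rightarrow> real" where
  "centered_eta T = eta T - harm (card T)"

lemma geo_tail: "(\<lambda>k. 1 / 2 ^ Suc (k + n) :: real) sums (1 / 2 ^ n)"
proof -
  have "(\<lambda>k. (1 / 2) ^ Suc k * (1 / 2 ^ n) :: real) sums (1 * (1 / 2 ^ n))"
    by (intro sums_mult2 power_half_series)
  then show ?thesis by (simp add: power_add power_divide field_simps)
qed

lemma is_bin_expansion_1: "is_bin_expansion 1 u \<longleftrightarrow> (\<forall>k. u k)"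
proof
  assume "is_bin_expansion 1 u"
  then have "(\<lambda>k. of_bool (u k) / 2 ^ Suc k) sums (1 :: real)" by (simp add: is_bin_expansion_def)
  then have sm: "(\<lambda>k. 1 / 2 ^ Suc k - of_bool (u k) / 2 ^ Suc k :: real) sums (1 - 1)"
    using geo_tail[of 0] by (intro sums_diff) auto
  show "\<forall>k. u k"
  proof (rule ccontr)
    assume "\<not> (\<forall>k. u k)"
    then obtain k where "\<not> u k" by blast
    then have "0 < (\<Sum>k. 1 / 2 ^ Suc k - of_bool (u k) / 2 ^ Suc k :: real)"
      using sm by (intro suminf_pos2[where i = k]) (auto simp: sums_iff)
    then show False using sm by (simp add: sums_iff)
  qed
next
  assume "\<forall>k. u k"
  then show "is_bin_expansion 1 u" using geo_tail[of 0] by (simp add: is_bin_expansion_def)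
qed

lemma is_bin_expansion_less_1:
  assumes "0 \<le> s" "s < 1"
  shows "is_bin_expansion s u \<longleftrightarrow> (\<forall>k. u k = odd \<lfloor>2 ^ Suc k * s\<rfloor>)"
proof
  assume u: "is_bin_expansion s u"
  define a where "a k = of_bool (u k) / (2 ^ Suc k :: real)" for k
  have a: "a sums s" using u unfolding is_bin_expansion_def a_def by blast
  define N :: "nat \<Rightarrow> int" where "N = rec_nat 0 (\<lambda>n x. 2 * x + of_bool (u n))"
  have N_Suc: "N (Suc n) = 2 * N n + of_bool (u n)" and N0: "N 0 = 0" for n by (simp_all add: N_def)
  have part: "(\<Sum>k<n. a k) = N n / 2 ^ n" for n
    by (induction n) (auto simp: N0 N_Suc a_def field_simps)
  have "\<lfloor>2 ^ n * s\<rfloor> = N n" for n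
  proof -
    define r where "r = s - N n / 2 ^ n"
    have ra: "(\<lambda>k. a (k + n)) sums r"
      using sums_split_initial_segment[OF a, of n] by (simp add: part r_def)
    then have r0: "0 \<le> r" using ra by (intro sums_le[OF _ sums_zero ra]) (auto simp: a_def)
    have d: "(\<lambda>k. 1 / 2 ^ Suc (k + n) - a (k + n)) sums (1 / 2 ^ n - r)"
      by (intro sums_diff geo_tail ra)
    have dnn: "0 \<le> 1 / 2 ^ Suc (k + n) - a (k + n)" for k by (auto simp: a_def)
    have r1: "r \<le> 1 / 2 ^ n" using sums_le[OF dnn sums_zero d] by simp
    have "r \<noteq> 1 / 2 ^ n"
    proof
      assume eq: "r = 1 / 2 ^ n"
      then have "s = of_int (N n + 1) / 2 ^ n" by (simp add: r_def field_simps)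
      then have "\<forall>\<^sub>F k in sequentially. \<not> u k"
        using u assms(2) unfolding is_bin_expansion_def by blast
      then obtain m where m: "\<And>k. k \<ge> m \<Longrightarrow> \<not> u k" by (auto simp: eventually_sequentially)
      have "0 < (\<Sum>k. 1 / 2 ^ Suc (k + n) - a (k + n))"
        using d dnn m[of "m + n"] by (intro suminf_pos2[where i = m]) (auto simp: sums_iff a_def)
      then show False using d eq by (simp add: sums_iff)
    qed
    with r1 have r1: "r < 1 / 2 ^ n" by simp
    have "2 ^ n * r = 2 ^ n * s - N n" by (simp add: r_def field_simps)
    moreover have "0 \<le> 2 ^ n * r" "2 ^ n * r < 1" using r0 r1 by (simp_all add: field_simps)
    ultimately show ?thesis by (intro floor_unique) linarith+
  qed
  then show "\<forall>k. u k = odd \<lfloor>2 ^ Suc k * s\<rfloor>" by (auto simp: N_Suc simp del: power_Suc)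
next
  assume u: "\<forall>k. u k = odd \<lfloor>2 ^ Suc k * s\<rfloor>"
  have fl: "\<lfloor>2 * x\<rfloor> = 2 * \<lfloor>x\<rfloor> + of_bool (odd \<lfloor>2 * x\<rfloor>)" for x :: real
  proof -
    have "\<lfloor>2 * x\<rfloor> = 2 * \<lfloor>x\<rfloor> \<or> \<lfloor>2 * x\<rfloor> = 2 * \<lfloor>x\<rfloor> + 1" by linarith
    then show ?thesis by auto
  qed
  have part: "(\<Sum>k<n. of_bool (u k) / 2 ^ Suc k) = \<lfloor>2 ^ n * s\<rfloor> / 2 ^ n" for n
  proof (induction n)
    case 0
    have "\<lfloor>s\<rfloor> = 0" using assms by linarith
    then show ?case by simp
  next
    case (Suc n)
    have "\<lfloor>2 ^ Suc n * s\<rfloor> = 2 * \<lfloor>2 ^ n * s\<rfloor> + of_bool (u n)"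
      using fl[of "2 ^ n * s"] u by (simp add: mult.assoc)
    then show ?case using Suc by (simp add: field_simps)
  qed
  have "(\<lambda>n. \<lfloor>2 ^ n * s\<rfloor> / 2 ^ n :: real) \<longlonglongrightarrow> s"
  proof (rule tendsto_sandwich[of "\<lambda>n. s - (1 / 2) ^ n" _ _ "\<lambda>n. s"])
    show "\<forall>\<^sub>F n in sequentially. s - (1 / 2) ^ n \<le> \<lfloor>2 ^ n * s\<rfloor> / 2 ^ n"
    proof (intro always_eventually allI)
      fix n
      have "s - (1 / 2) ^ n = (2 ^ n * s - 1) / 2 ^ n" by (simp add: field_simps power_divide)
      also have "\<dots> \<le> \<lfloor>2 ^ n * s\<rfloor> / 2 ^ n" by (intro divide_right_mono) (linarith, simp)
      finally show "s - (1 / 2) ^ n \<le> \<lfloor>2 ^ n * s\<rfloor> / 2 ^ n" .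
    qed
    show "\<forall>\<^sub>F n in sequentially. \<lfloor>2 ^ n * s\<rfloor> / 2 ^ n \<le> s"
      by (intro always_eventually allI) (simp add: field_simps)
    have "(\<lambda>n. s - (1 / 2) ^ n) \<longlonglongrightarrow> s - 0" by (intro tendsto_diff tendsto_const LIMSEQ_power_zero) auto
    then show "(\<lambda>n. s - (1 / 2) ^ n) \<longlonglongrightarrow> s" by simp
  qed auto
  moreover have "\<forall>\<^sub>F k in sequentially. \<not> u k" if "s = of_int m / 2 ^ j" for m :: int and j
    unfolding eventually_sequentially
  proof (intro exI[of _ j] allI impI)
    fix k assume "k \<ge> j"
    then obtain i where i: "k = j + i" by (auto simp: le_iff_add)
    then have "2 ^ Suc k * s = of_int (2 * 2 ^ (k - j) * m)"
      by (simp add: that power_add field_simps)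
    then have "\<lfloor>2 ^ Suc k * s\<rfloor> = 2 * 2 ^ (k - j) * m" by (metis floor_of_int)
    then show "\<not> u k" using u by simp
  qed
  ultimately show "is_bin_expansion s u" unfolding is_bin_expansion_def sums_def part by blast
qed

lemma ex1_bin_expansion:
  assumes "0 \<le> s" "s \<le> 1"
  shows "\<exists>!u. is_bin_expansion s u"
proof (cases "s = 1")
  case True
  then show ?thesis by (intro ex1I[of _ "\<lambda>_. True"]) (auto simp: is_bin_expansion_1)
next
  case False
  then show ?thesis using assms
    by (intro ex1I[of _ "\<lambda>k. odd \<lfloor>2 ^ Suc k * s\<rfloor>"]) (auto simp: is_bin_expansion_less_1)
qed

lemma bin_digits_1: "bin_digits 1 k"
  using theI'[OF ex1_bin_expansion[of 1]] by (simp add: bin_digits_def is_bin_expansion_1)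

lemma bin_digits_less_1:
  assumes "0 \<le> s" "s < 1"
  shows "bin_digits s k = odd \<lfloor>2 ^ Suc k * s\<rfloor>"
  using theI'[OF ex1_bin_expansion[of s]] assms
  by (simp add: bin_digits_def is_bin_expansion_less_1)

lemma finite_imp_silhouette_integrable:
  assumes "finite T" "t \<le> 1"
  shows "(\<lambda>s. real (silhouette T s)) integrable_on {0..t}"
proof -
  define d where "d s k = odd \<lfloor>2 ^ Suc k * s\<rfloor>" for s :: real and k
  define g where "g s = (LEAST k. map (d s) [0..<k] \<notin> T)" for s
  have dm: "(\<lambda>s. d s k) \<in> measurable borel (count_space UNIV)" for k
    unfolding d_def by measurable
  have iff: "map (d s) [0..<k] \<notin> T \<longleftrightarrow> \<not> (\<exists>w\<in>T. length w = k \<and> (\<forall>i<k. d s i = w ! i))" for s k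
  proof -
    have "length w = k \<and> (\<forall>i<k. d s i = w ! i) \<longleftrightarrow> w = map (d s) [0..<k]" for w
      by (auto intro: nth_equalityI)
    then show ?thesis by auto
  qed
  have gm: "g \<in> measurable borel (count_space UNIV)"
    unfolding g_def iff using countable_finite[OF assms(1)] dm by measurable
  obtain m where m: "\<And>w. w \<in> T \<Longrightarrow> length w \<le> m"
    using finite_imageI[OF assms(1), of length] by (meson finite_nat_set_iff_bounded_le imageI)
  have gb: "g s \<le> Suc m" for s
    unfolding g_def using m[of "map (d s) [0..<Suc m]"] by (intro Least_le) auto
  have "set_integrable lborel {0..t} (\<lambda>s. real (g s))"
    unfolding set_integrable_def
    by (rule integrableI_bounded_set_indicator[where B = "real (Suc m)"])
       (use gm gb in \<open>auto simp del: of_nat_Suc simp: emeasure_lborel_Icc_eq intro: measurable_compose\<close>)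
  then have "(\<lambda>s. real (g s)) integrable_on {0..t}" by (rule set_borel_integral_eq_integral)
  then show ?thesis
  proof (rule integrable_spike[where S = "{1}"])
    fix s assume "s \<in> {0..t} - {1}"
    then have "bin_digits s = d s" using assms(2) by (auto simp: d_def bin_digits_less_1)
    then show "real (silhouette T s) = real (g s)" by (simp add: silhouette_def g_def)
  qed auto
qed

lemma c00_apply_centered_int_silhouette:
  assumes "binary_tree T" "t \<in> {0..1}"
  shows "c00_apply (centered_int_silhouette T) t = int_silhouette T t - t * int_silhouette T 1"
proof -
  have "finite T" using assms(1) by (simp add: binary_tree_def)
  then have "continuous_on {0..1} (int_silhouette T)"
    unfolding int_silhouette_def
    by (intro indefinite_integral_continuous_1 finite_imp_silhouette_integrable) auto
  then show ?thesis
    unfolding centered_int_silhouette_def using assms(2)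
    by (subst c00_apply_to_c00) (auto intro!: continuous_intros simp: int_silhouette_def)
qed


section \<open>Binary search trees\<close>

text \<open>
  A labelled tree is a partial map from nodes to labels; its domain is the tree. The position
  after \<open>k\<close> steps of the search for \<open>x\<close> is only relevant as long as all earlier positions belong
  to the tree. A comparison resulting in a tie, an event of probability zero below, goes left.
\<close>

primrec search_path :: "(node \<rightharpoonup> real) \<Rightarrow> real \<Rightarrow> nat \<Rightarrow> node" where
  "search_path L x 0 = []"
| "search_path L x (Suc k) = search_path L x k @ [the (L (search_path L x k)) < x]"

definition exit_node :: "(node \<rightharpoonup> real) \<Rightarrow> real \<Rightarrow> node" where
  "exit_node L x = search_path L x (LEAST k. search_path L x k \<notin> dom L)"

text \<open>\<open>bst_labelling x n\<close> is the labelled tree for \<open>x 1, \<dots>, x n\<close>; \<open>x 0\<close> is not used.\<close>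

primrec bst_labelling :: "(nat \<Rightarrow> real) \<Rightarrow> nat \<Rightarrow> (node \<rightharpoonup> real)" where
  "bst_labelling x 0 = Map.empty"
| "bst_labelling x (Suc n) =
    (bst_labelling x n)(exit_node (bst_labelling x n) (x (Suc n)) \<mapsto> x (Suc n))"

definition bst_sequence :: "'a measure \<Rightarrow> (nat \<Rightarrow> 'a \<Rightarrow> node set) \<Rightarrow> bool" where
  "bst_sequence M T \<longleftrightarrow>
    (\<exists>\<xi> :: nat \<Rightarrow> 'a \<Rightarrow> real.
      prob_space.indep_vars M (\<lambda>_. borel) \<xi> {1..} \<and>
      (\<forall>n\<ge>1. distr M borel (\<xi> n) = uniform_measure lborel {0..1}) \<and>
      (\<forall>n\<ge>1. \<forall>\<omega>\<in>space M. T n \<omega> = dom (bst_labelling (\<lambda>i. \<xi> i \<omega>) n)))"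

lemma bst_1: "bst_labelling x 1 = [[] \<mapsto> x 1]"
  by (simp add: exit_node_def)

lemma exit_node:
  assumes "binary_tree (dom L)"
  shows "exit_node L x \<notin> dom L" "exit_node L x = u @ [b] \<Longrightarrow> u \<in> dom L"
proof -
  have len: "length (search_path L x k) = k" for k by (induction k) auto
  obtain m where m: "\<And>w. w \<in> dom L \<Longrightarrow> length w \<le> m"
    using assms finite_imageI[of "dom L" length] unfolding binary_tree_def
    by (meson finite_nat_set_iff_bounded_le imageI)
  have ex: "search_path L x (Suc m) \<notin> dom L" using m[of "search_path L x (Suc m)"] len by fastforce
  then show "exit_node L x \<notin> dom L" unfolding exit_node_def by (rule LeastI)
  define k where "k = (LEAST k. search_path L x k \<notin> dom L)"
  assume eq: "exit_node L x = u @ [b]"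
  then obtain j where j: "k = Suc j" by (cases k) (auto simp: exit_node_def k_def)
  then have "search_path L x j \<in> dom L" using not_less_Least[of j "\<lambda>k. search_path L x k \<notin> dom L"] by (auto simp flip: k_def)
  moreover have "u = search_path L x j" using eq j by (simp add: exit_node_def flip: k_def)
  ultimately show "u \<in> dom L" by simp
qed

lemma binary_tree_bst: "binary_tree (dom (bst_labelling x n))"
  and card_bst: "card (dom (bst_labelling x n)) = n"
proof (induction n)
  case (Suc n)
  {
    case 1
    have "u \<in> dom (bst_labelling x (Suc n))" if "u @ [b] \<in> dom (bst_labelling x (Suc n))" for u b
      using that exit_node(2)[OF Suc(1), of "x (Suc n)" u b] Suc(1)
      unfolding binary_tree_def by (cases "u @ [b] \<in> dom (bst_labelling x n)") auto
    then show ?case using Suc(1) unfolding binary_tree_def by simp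
  next
    case 2
    show ?case using exit_node(1)[OF Suc(1)] Suc
      by (simp add: binary_tree_def dom_fun_upd del: fun_upd_apply)
  }
qed (auto simp: binary_tree_def)


section \<open>Convergence in distribution\<close>

text \<open>The test functions depend on the topology of the state space only.\<close>

definition converges_in_distribution ::
  "'a measure \<Rightarrow> (nat \<Rightarrow> 'a \<Rightarrow> 's :: topological_space) \<Rightarrow> 'b measure \<Rightarrow> ('b \<Rightarrow> 's) \<Rightarrow> bool" where
  "converges_in_distribution M X N Z \<longleftrightarrow>
    (\<forall>g :: 's \<Rightarrow> real. continuous_on UNIV g \<and> bounded (range g) \<longrightarrow>
      (\<lambda>n. \<integral>\<omega>. g (X n \<omega>) \<partial>M) \<longlonglongrightarrow> (\<integral>\<omega>. g (Z \<omega>) \<partial>N))"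


section \<open>The fixed-point operator\<close>

definition centered_laws :: "(c00 \<times> real) measure set" where
  "centered_laws = {\<mu>. prob_space \<mu> \<and> sets \<mu> = sets borel \<and>
    integrable \<mu> (\<lambda>(f, x). (norm f)\<^sup>2 + x\<^sup>2) \<and> (\<integral>(f, x). x \<partial>\<mu>) = 0}"

definition op_A :: "c00 \<Rightarrow> c00" where
  "op_A f = to_c00 (\<lambda>t. 1 / 2 * c00_apply f (min (2 * t) 1))"

definition op_B :: "c00 \<Rightarrow> c00" where
  "op_B f = to_c00 (\<lambda>t. 1 / 2 * c00_apply f (max (2 * t - 1) 0))"

definition phi :: c00 where
  "phi = to_c00 (\<lambda>t. 1 / 2 * min t (1 - t))"

definition Psi :: "(c00 \<times> real) measure \<Rightarrow> (c00 \<times> real) measure" where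
  "Psi \<mu> = distr (\<mu> \<Otimes>\<^sub>M (\<mu> \<Otimes>\<^sub>M uniform_measure lborel {0<..<1})) borel
    (\<lambda>((Y, \<eta>), ((Y', \<eta>'), \<xi>)).
      (op_A Y + op_B Y' + (\<eta> - \<eta>') *\<^sub>R phi + (ln \<xi> - ln (1 - \<xi>)) *\<^sub>R phi,
       1 + 1 / 2 * (\<eta> + \<eta>') + 1 / 2 * (ln \<xi> + ln (1 - \<xi>))))"

lemma c00_apply_op_A:
  assumes "t \<in> {0..1}"
  shows "c00_apply (op_A f) t = 1 / 2 * c00_apply f (min (2 * t) 1)"
  unfolding op_A_def using assms
  by (subst c00_apply_to_c00)
     (auto intro!: continuous_intros continuous_on_compose2[OF c00_continuous])

lemma c00_apply_op_B:
  assumes "t \<in> {0..1}"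
  shows "c00_apply (op_B f) t = 1 / 2 * c00_apply f (max (2 * t - 1) 0)"
  unfolding op_B_def using assms
  by (subst c00_apply_to_c00)
     (auto intro!: continuous_intros continuous_on_compose2[OF c00_continuous])

lemma c00_apply_phi:
  assumes "t \<in> {0..1}"
  shows "c00_apply phi t = 1 / 2 * min t (1 - t)"
  unfolding phi_def using assms
  by (subst c00_apply_to_c00) (auto intro!: continuous_intros)

end

theory Submission
  imports Defs "HOL-Library.Sublist" "HOL-Real_Asymp.Real_Asymp"
begin

text \<open>
  The standardized trees form a martingale in a Banach space, and this martingale is bounded in mean
  square for a combinatorial reason. Given the tree with \<open>n\<close> nodes, the next node is uniformly
  distributed on the \<open>n + 1\<close> external nodes: a history of growth is equivalent to an order pattern
  of the input, and all patterns are equally likely by exchangeability (\<open>prob_random_history\<close>).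
  Adding the node \<open>u\<close> increases the area under the silhouette by \<open>2 ^ - length u\<close>, and the sum of
  these numbers over the external nodes is always 1. So the area, centered by the harmonic number,
  is a martingale, and the mean square of each increment is at most that of \<open>2 ^ - length u\<close> for
  the node \<open>u\<close> added.

  For the function component, the recursion at the root is iterated. Since the two subtrees
  contribute on different halves of the unit interval, with a factor \<open>1 / 2\<close>, the square of the
  supremum norm is bounded by a weighted sum, over all nodes \<open>w\<close>, of squares of differences between
  the areas of the two subtrees below \<open>w\<close> (\<open>norm_centered_int_silhouette_diff\<close>). Each of these
  differences is again a martingale with explicit increments. As every node is added at most once,
  the mean square distance between two standardized trees is at most a constant times the mean of
  the sum of \<open>(3 / 8) ^ length u\<close> over the nodes \<open>u\<close> added in between, and the sum over all nodes is
  finite because there are \<open>2 ^ j\<close> nodes of length \<open>j\<close> (\<open>mean_standardized_diff_square\<close>). Hence the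
  standardized trees converge in mean square (\<open>ex_mean_limit\<close>), which implies convergence in
  distribution.

  A uniformly growing tree splits at its root like Polya's urn: the size of the left subtree is
  uniformly distributed, and given the sizes the subtrees are independent and of the same kind
  (\<open>mean_join\<close>). Passing to the limit in this recursion shows that the limit law is a fixed point
  (\<open>Psi_limit_law\<close>). Two fixed points agree because a coupling of them can be replaced by one
  whose mean energy is smaller by the factor \<open>3 / 4\<close> (\<open>coupling_step\<close>, \<open>fixed_point_unique\<close>).
\<close>

section \<open>Silhouettes of subtrees\<close>

text \<open>
  The part of \<open>T\<close> at and below the node \<open>w\<close>, as a tree of its own. For a binary tree it is empty
  if \<open>w\<close> is not in \<open>T\<close>.
\<close>

definition subtree :: "node set \<Rightarrow> node \<Rightarrow> node set" where
  "subtree T w = {u. w @ u \<in> T}"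

lemma subtree_subtree: "subtree (subtree T v) w = subtree T (v @ w)"
  and subtree_empty [simp]: "subtree {} w = {}"
  by (auto simp: subtree_def)

lemma finite_subtree: "finite T \<Longrightarrow> finite (subtree T w)"
  using finite_vimageI[of T "(@) w"] by (simp add: subtree_def vimage_def inj_on_def)

lemma binary_tree_subtree: "binary_tree T \<Longrightarrow> binary_tree (subtree T w)"
  using finite_subtree[of T w] unfolding binary_tree_def by (auto simp: subtree_def simp flip: append_assoc)

lemma binary_tree_empty [simp]: "binary_tree {}"
  by (simp add: binary_tree_def)

lemma binary_tree_prefix:
  assumes "binary_tree T" "u @ v \<in> T"
  shows "u \<in> T"
  using assms(2) by (induction v rule: rev_induct) (use assms(1) in \<open>auto simp: binary_tree_def simp flip: append_assoc\<close>)

lemma binary_tree_Nil: "binary_tree T \<Longrightarrow> T \<noteq> {} \<Longrightarrow> [] \<in> T"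
  using binary_tree_prefix[of T "[]"] by auto

lemma silhouette_Suc:
  assumes "finite T" "[] \<in> T" and d: "\<And>k. bin_digits s (Suc k) = bin_digits s' k"
  shows "silhouette T s = Suc (silhouette (subtree T [bin_digits s 0]) s')"
proof -
  have len: "\<exists>k. map d [0..<k] \<notin> V" if "finite V" for V :: "node set" and d
  proof -
    have "\<not> range (\<lambda>k. map d [0..<k]) \<subseteq> V"
      using that finite_subset by (metis (no_types, lifting) finite_imageD infinite_UNIV_nat injI length_map
          length_upt diff_zero)
    then show ?thesis by auto
  qed
  have m: "map (bin_digits s) [0..<Suc k] = bin_digits s 0 # map (bin_digits s') [0..<k]" for k
    using d by (simp add: upt_conv_Cons map_Suc_upt[symmetric] del: upt_Suc)
  obtain k k' where "map (bin_digits s) [0..<k] \<notin> T"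
      "map (bin_digits s') [0..<k'] \<notin> subtree T [bin_digits s 0]"
    using len assms(1) finite_subtree by metis
  then show ?thesis
    unfolding silhouette_def using assms(2) by (rule_tac Least_Suc2) (auto simp: m subtree_def simp del: upt_Suc)
qed

lemma silhouette_left:
  assumes "finite T" "[] \<in> T" "0 \<le> s" "s < 1 / 2"
  shows "silhouette T s = Suc (silhouette (subtree T [False]) (2 * s))"
proof -
  have "\<lfloor>2 * s\<rfloor> = 0" using assms by linarith
  then have "bin_digits s 0 = False" using assms by (simp add: bin_digits_less_1)
  then show ?thesis
    using silhouette_Suc[of T s "2 * s"] assms by (simp add: bin_digits_less_1 ac_simps)
qed

lemma silhouette_right:
  assumes "finite T" "[] \<in> T" "1 / 2 \<le> s" "s < 1"
  shows "silhouette T s = Suc (silhouette (subtree T [True]) (2 * s - 1))"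
proof -
  have "\<lfloor>2 * s\<rfloor> = 1" using assms by linarith
  then have 0: "bin_digits s 0 = True" using assms by (simp add: bin_digits_less_1)
  have "bin_digits s (Suc k) = bin_digits (2 * s - 1) k" for k
  proof -
    have "2 ^ Suc (Suc k) * s = 2 ^ Suc k * (2 * s - 1) + of_int (2 * 2 ^ k)"
      by (simp add: algebra_simps)
    then have "\<lfloor>2 ^ Suc (Suc k) * s\<rfloor> = \<lfloor>2 ^ Suc k * (2 * s - 1)\<rfloor> + 2 * 2 ^ k"
      by (metis floor_add_int)
    then show ?thesis using assms by (simp add: bin_digits_less_1 del: power_Suc)
  qed
  then show ?thesis using silhouette_Suc[of T s "2 * s - 1"] assms 0 by simp
qed

lemma has_integral_silhouette:
  assumes "finite T" "t \<le> 1"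
  shows "((\<lambda>s. real (silhouette T s)) has_integral int_silhouette T t) {0..t}"
  unfolding int_silhouette_def using finite_imp_silhouette_integrable[OF assms] by (rule integrable_integral)

text \<open>
  Over the left half of the unit interval the silhouette is one plus that of the left subtree,
  run at double speed, and similarly over the right half. The truncations combine both cases.
\<close>

lemma int_silhouette_split:
  assumes "finite T" "[] \<in> T" "t \<in> {0..1}"
  shows "int_silhouette T t = t + 1 / 2 * int_silhouette (subtree T [False]) (min (2 * t) 1)
    + 1 / 2 * int_silhouette (subtree T [True]) (max (2 * t - 1) 0)"
proof -
  let ?L = "subtree T [False]" and ?R = "subtree T [True]"
  have left: "((\<lambda>s. real (silhouette T s)) has_integral (t + 1 / 2 * int_silhouette ?L (2 * t))) {0..t}"
    if t: "t \<in> {0..1/2}" for t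
  proof -
    have "((\<lambda>x. real (silhouette ?L (2 *\<^sub>R x + 0))) has_integral (int_silhouette ?L (2 * t) /\<^sub>R 2 ^ DIM(real)))
        (cbox ((0 - 0) /\<^sub>R 2) ((2 * t - 0) /\<^sub>R 2))"
      using t assms(1) by (intro has_integral_affinity') (auto intro!: has_integral_silhouette finite_subtree)
    then have "((\<lambda>x. 1 + real (silhouette ?L (2 * x))) has_integral (t + 1 / 2 * int_silhouette ?L (2 * t))) {0..t}"
      using t has_integral_const_real[of "1::real" 0 t] by (intro has_integral_add) (auto simp: field_simps)
    then show ?thesis
      by (rule has_integral_spike[rotated 2, where S = "{1/2}"])
         (use t assms in \<open>auto simp: silhouette_left\<close>)
  qed
  have right: "((\<lambda>s. real (silhouette T s)) has_integral (t - 1 / 2 + 1 / 2 * int_silhouette ?R (2 * t - 1))) {1/2..t}"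
    if t: "t \<in> {1/2..1}" for t
  proof -
    have "((\<lambda>x. real (silhouette ?R (2 *\<^sub>R x + - 1))) has_integral (int_silhouette ?R (2 * t - 1) /\<^sub>R 2 ^ DIM(real)))
        (cbox ((0 - - 1) /\<^sub>R 2) ((2 * t - 1 - - 1) /\<^sub>R 2))"
      using t assms(1) by (intro has_integral_affinity') (auto intro!: has_integral_silhouette finite_subtree)
    then have "((\<lambda>x. 1 + real (silhouette ?R (2 * x - 1))) has_integral (t - 1 / 2 + 1 / 2 * int_silhouette ?R (2 * t - 1))) {1/2..t}"
      using t has_integral_const_real[of "1::real" "1/2" t] by (intro has_integral_add) (auto simp: field_simps)
    then show ?thesis
      by (rule has_integral_spike[rotated 2, where S = "{1}"])
         (use t assms in \<open>auto simp: silhouette_right\<close>)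
  qed
  have eqI: "int_silhouette T t = c" if "((\<lambda>s. real (silhouette T s)) has_integral c) {0..t}" for c
    using that unfolding int_silhouette_def by (rule integral_unique)
  show ?thesis
  proof (cases "t \<le> 1 / 2")
    case True
    then show ?thesis using assms eqI[OF left] by (simp add: int_silhouette_def)
  next
    case False
    have "((\<lambda>s. real (silhouette T s)) has_integral (1/2 + 1 / 2 * int_silhouette ?L 1)
        + (t - 1 / 2 + 1 / 2 * int_silhouette ?R (2 * t - 1))) {0..t}"
      using False assms left[of "1/2"] right[of t] by (rule_tac has_integral_combine[where c = "1/2"]) simp_all
    then show ?thesis using False assms eqI by (simp add: min_def max_def)
  qed
qed

lemma silhouette_empty: "silhouette {} s = 0"
  by (simp add: silhouette_def)

lemma int_silhouette_empty [simp]: "int_silhouette {} t = 0"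
  by (simp add: int_silhouette_def silhouette_empty)

lemma eta_empty [simp]: "eta {} = 0"
  by (simp add: eta_def)

lemma int_silhouette_0 [simp]: "int_silhouette T 0 = 0"
  by (simp add: int_silhouette_def)

lemma eta_split:
  assumes "finite T" "[] \<in> T"
  shows "eta T = 1 + 1 / 2 * (eta (subtree T [False]) + eta (subtree T [True]))"
  unfolding eta_def using int_silhouette_split[OF assms, of 1] by simp

text \<open>
  Unlike the recursion for \<^const>\<open>eta\<close>, the following one also holds for the empty tree, because
  centering removes the linear contribution of the root.
\<close>

lemma centered_int_silhouette_split:
  assumes "binary_tree T"
  shows "centered_int_silhouette T =
    op_A (centered_int_silhouette (subtree T [False])) + op_B (centered_int_silhouette (subtree T [True]))
    + (eta (subtree T [False]) - eta (subtree T [True])) *\<^sub>R phi"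
proof (rule c00_eqI)
  fix t :: real assume t: "t \<in> {0..1}"
  let ?L = "subtree T [False]" and ?R = "subtree T [True]"
  have bt: "binary_tree ?L" "binary_tree ?R" using assms by (auto intro: binary_tree_subtree)
  have "int_silhouette T t - t * int_silhouette T 1 =
      1 / 2 * int_silhouette ?L (min (2 * t) 1) + 1 / 2 * int_silhouette ?R (max (2 * t - 1) 0)
      - t / 2 * (eta ?L + eta ?R)"
  proof (cases "T = {}")
    case False
    then have "finite T" "[] \<in> T" using assms binary_tree_Nil by (auto simp: binary_tree_def)
    then show ?thesis
      using int_silhouette_split[of T t] int_silhouette_split[of T 1] t
      by (simp add: eta_def algebra_simps)
  qed simp
  then show "c00_apply (centered_int_silhouette T) t = c00_apply
      (op_A (centered_int_silhouette ?L) + op_B (centered_int_silhouette ?R) + (eta ?L - eta ?R) *\<^sub>R phi) t"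
    using t assms bt
    by (cases "t \<le> 1 / 2")
       (auto simp: c00_ops c00_apply_op_A c00_apply_op_B c00_apply_phi c00_apply_centered_int_silhouette
          eta_def min_def max_def field_simps)
qed

lemma binary_tree_induct [consumes 1, case_names empty split]:
  assumes "binary_tree T"
    and "P {}"
    and "\<And>T. binary_tree T \<Longrightarrow> [] \<in> T \<Longrightarrow> P (subtree T [False]) \<Longrightarrow> P (subtree T [True]) \<Longrightarrow> P T"
  shows "P T"
  using assms(1)
proof (induction "card T" arbitrary: T rule: less_induct)
  case less
  show ?case
  proof (cases "T = {}")
    case False
    then have T: "finite T" "[] \<in> T" using less binary_tree_Nil by (auto simp: binary_tree_def)
    have "card (subtree T [b]) < card T" for b
    proof -
      have "card (subtree T [b]) = card ((#) b ` subtree T [b])" by (simp add: card_image)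
      also have "\<dots> < card T" using T by (intro psubset_card_mono) (auto simp: subtree_def)
      finally show ?thesis .
    qed
    then show ?thesis
      using T less.prems less.hyps binary_tree_subtree by (rule_tac assms(3)) blast+
  qed (simp add: assms(2))
qed

lemma eta_eq_sum: "binary_tree T \<Longrightarrow> eta T = (\<Sum>u\<in>T. (1 / 2) ^ length u)"
proof (induction rule: binary_tree_induct)
  case (split T)
  let ?L = "subtree T [False]" and ?R = "subtree T [True]"
  have fin: "finite T" "finite ?L" "finite ?R" using split(1) by (auto simp: binary_tree_def finite_subtree)
  have T: "T = insert [] ((#) False ` ?L \<union> (#) True ` ?R)"
  proof (rule set_eqI)
    show "u \<in> T \<longleftrightarrow> u \<in> insert [] ((#) False ` ?L \<union> (#) True ` ?R)" for u
    proof (cases u)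
      case (Cons b v)
      then show ?thesis by (cases b) (auto simp: subtree_def)
    qed (simp add: split(2))
  qed
  have "(\<Sum>u\<in>T. (1 / 2) ^ length u :: real) =
      1 + ((\<Sum>u\<in>(#) False ` ?L. (1 / 2) ^ length u) + (\<Sum>u\<in>(#) True ` ?R. (1 / 2) ^ length u))"
  proof -
    have "(\<Sum>u\<in>insert [] ((#) False ` ?L \<union> (#) True ` ?R). (1 / 2) ^ length u :: real) =
        1 + (\<Sum>u\<in>(#) False ` ?L \<union> (#) True ` ?R. (1 / 2) ^ length u)"
      using fin by (subst sum.insert) auto
    also have "(\<Sum>u\<in>(#) False ` ?L \<union> (#) True ` ?R. (1 / 2) ^ length u :: real) =
        (\<Sum>u\<in>(#) False ` ?L. (1 / 2) ^ length u) + (\<Sum>u\<in>(#) True ` ?R. (1 / 2) ^ length u)"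
      using fin by (intro sum.union_disjoint) auto
    finally show ?thesis by (simp only: T[symmetric])
  qed
  also have "\<dots> = 1 + 1 / 2 * (eta ?L + eta ?R)"
    unfolding split(3,4) by (simp add: sum.reindex sum_distrib_left distrib_left)
  also have "\<dots> = eta T" by (rule eta_split[OF fin(1) split(2), symmetric])
  finally show ?case by (rule sym)
qed simp

section \<open>A quadratic estimate for the recursion\<close>

lemma norm_phi: "norm phi \<le> 1 / 4"
  by (rule c00_norm_le) (auto simp: c00_apply_phi min_def)

text \<open>The images of the two operators live on different halves of the unit interval.\<close>

lemma norm_op_A_op_B: "norm (op_A f + op_B g) \<le> 1 / 2 * max (norm f) (norm g)"
proof (rule c00_norm_le)
  fix t :: real assume t: "t \<in> {0..1}"
  show "\<bar>c00_apply (op_A f + op_B g) t\<bar> \<le> 1 / 2 * max (norm f) (norm g)"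
    using t c00_abs_le_norm[of f "2 * t"] c00_abs_le_norm[of g "2 * t - 1"]
    by (cases "t \<le> 1 / 2") (auto simp: c00_plus c00_apply_op_A c00_apply_op_B min_def max_def abs_mult)
qed

text \<open>
  The constants come from \<open>(x + y)\<^sup>2 \<le> 3 / 2 * x\<^sup>2 + 3 * y\<^sup>2\<close>. It matters that the sum of the
  two coefficients \<open>3 / 8\<close> is less than 1.
\<close>

lemma norm_split_square:
  "(norm (op_A f + op_B g + c *\<^sub>R phi))\<^sup>2 \<le> 3 / 8 * ((norm f)\<^sup>2 + (norm g)\<^sup>2) + 3 / 16 * c\<^sup>2"
proof -
  define m where "m = max (norm f) (norm g)"
  have m: "m\<^sup>2 \<le> (norm f)\<^sup>2 + (norm g)\<^sup>2" by (auto simp: m_def max_def)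
  have "norm (op_A f + op_B g + c *\<^sub>R phi) \<le> norm (op_A f + op_B g) + \<bar>c\<bar> * norm phi"
    by (rule order_trans[OF norm_triangle_ineq]) simp
  also have "\<dots> \<le> 1 / 2 * m + \<bar>c\<bar> * (1 / 4)"
    unfolding m_def by (intro add_mono norm_op_A_op_B mult_left_mono norm_phi) auto
  finally have "(norm (op_A f + op_B g + c *\<^sub>R phi))\<^sup>2 \<le> (1 / 2 * m + \<bar>c\<bar> * (1 / 4))\<^sup>2"
    by (intro power_mono) auto
  also have "\<dots> \<le> 3 / 8 * m\<^sup>2 + 3 / 16 * c\<^sup>2"
  proof -
    have "3 / 8 * m\<^sup>2 + 3 / 16 * \<bar>c\<bar>\<^sup>2 - (1 / 2 * m + \<bar>c\<bar> * (1 / 4))\<^sup>2 = (m - \<bar>c\<bar>)\<^sup>2 / 8"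
      by (simp add: power2_eq_square field_simps)
    moreover have "0 \<le> (m - \<bar>c\<bar>)\<^sup>2 / 8" by simp
    ultimately show ?thesis by (metis diff_ge_0_iff_ge power2_abs)
  qed
  also have "\<dots> \<le> 3 / 8 * ((norm f)\<^sup>2 + (norm g)\<^sup>2) + 3 / 16 * c\<^sup>2"
    using m by (intro add_right_mono mult_left_mono) auto
  finally show ?thesis .
qed

lemma op_A_diff: "op_A f - op_A g = op_A (f - g)"
  and op_B_diff: "op_B f - op_B g = op_B (f - g)"
  by (auto intro!: c00_eqI simp: c00_ops c00_apply_op_A c00_apply_op_B algebra_simps)

text \<open>
  The words of length less than \<open>N\<close>.
\<close>

definition words :: "nat \<Rightarrow> node set" where
  "words N = {w. length w < N}"

lemma finite_words [simp]: "finite (words N)"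
  by (rule finite_subset[OF _ finite_lists_length_le[of "UNIV :: bool set" N]]) (auto simp: words_def)

lemma words_0 [simp]: "words 0 = {}"
  by (simp add: words_def)

lemma sum_words_Suc:
  "(\<Sum>w\<in>words (Suc N). f w) = f [] + (\<Sum>w\<in>words N. f (False # w)) + (\<Sum>w\<in>words N. f (True # w) :: real)"
proof -
  have eq: "words (Suc N) = insert [] ((#) False ` words N \<union> (#) True ` words N)"
  proof (rule set_eqI)
    show "u \<in> words (Suc N) \<longleftrightarrow> u \<in> insert [] ((#) False ` words N \<union> (#) True ` words N)" for u
    proof (cases u)
      case (Cons b v)
      then show ?thesis by (cases b) (auto simp: words_def)
    qed (simp add: words_def)
  qed
  have "(\<Sum>w\<in>words (Suc N). f w) = f [] + (sum f ((#) False ` words N) + sum f ((#) True ` words N))"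
    unfolding eq by (subst sum.insert) (auto intro!: sum.union_disjoint)
  then show ?thesis by (simp add: sum.reindex)
qed

text \<open>
  The difference of two integrated silhouettes is controlled by the differences, over all nodes
  \<open>w\<close>, of the increments of \<^const>\<open>eta\<close> in the two subtrees below \<open>w\<close>.
\<close>

definition gap :: "node set \<Rightarrow> node set \<Rightarrow> node \<Rightarrow> real" where
  "gap T T' w = (eta (subtree T' (w @ [False])) - eta (subtree T (w @ [False])))
    - (eta (subtree T' (w @ [True])) - eta (subtree T (w @ [True])))"

text \<open>
  The recursion at the root and the quadratic estimate are iterated down to the depth of the two
  trees.
\<close>

lemma norm_centered_int_silhouette_diff:
  assumes "binary_tree T" "binary_tree T'" "T \<union> T' \<subseteq> words N"
  shows "(norm (centered_int_silhouette T' - centered_int_silhouette T))\<^sup>2 \<le>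
    3 / 16 * (\<Sum>w\<in>words N. (3 / 8) ^ length w * (gap T T' w)\<^sup>2)"
  using assms
proof (induction N arbitrary: T T')
  case 0
  then show ?case by simp
next
  case (Suc N)
  define G where "G b = centered_int_silhouette (subtree T' [b]) - centered_int_silhouette (subtree T [b])" for b
  have sub: "subtree T [b] \<union> subtree T' [b] \<subseteq> words N" for b
    using Suc.prems(3) by (auto simp: subtree_def words_def)
  have IH: "(norm (G b))\<^sup>2 \<le> 3 / 16 * (\<Sum>w\<in>words N. (3 / 8) ^ length w * (gap T T' (b # w))\<^sup>2)" for b
    using Suc.IH[OF _ _ sub, of b] Suc.prems unfolding G_def gap_def subtree_subtree
    by (auto intro: binary_tree_subtree)
  have eq: "centered_int_silhouette T' - centered_int_silhouette T =
      op_A (G False) + op_B (G True) + gap T T' [] *\<^sub>R phi"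
    unfolding centered_int_silhouette_split[OF Suc.prems(1)] centered_int_silhouette_split[OF Suc.prems(2)]
      G_def op_A_diff[symmetric] op_B_diff[symmetric] gap_def
    by (simp add: algebra_simps)
  have "(norm (centered_int_silhouette T' - centered_int_silhouette T))\<^sup>2
      \<le> 3 / 8 * ((norm (G False))\<^sup>2 + (norm (G True))\<^sup>2) + 3 / 16 * (gap T T' [])\<^sup>2"
    unfolding eq by (rule norm_split_square)
  also have "\<dots> \<le> 3 / 8 * (3 / 16 * (\<Sum>w\<in>words N. (3 / 8) ^ length w * (gap T T' (False # w))\<^sup>2)
      + 3 / 16 * (\<Sum>w\<in>words N. (3 / 8) ^ length w * (gap T T' (True # w))\<^sup>2)) + 3 / 16 * (gap T T' [])\<^sup>2"
    by (intro add_mono mult_left_mono IH) auto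
  also have "\<dots> = 3 / 16 * (\<Sum>w\<in>words (Suc N). (3 / 8) ^ length w * (gap T T' w)\<^sup>2)"
  proof -
    have "(\<Sum>w\<in>words N. (3 / 8) ^ length (b # w) * (gap T T' (b # w))\<^sup>2)
        = 3 / 8 * (\<Sum>w\<in>words N. (3 / 8) ^ length w * (gap T T' (b # w))\<^sup>2)" for b
      by (simp add: sum_distrib_left mult.assoc)
    then show ?thesis unfolding sum_words_Suc by (simp only:) simp
  qed
  finally show ?case .
qed

section \<open>Growth histories of binary trees\<close>

text \<open>The external nodes of a tree: the positions at which a node can be added.\<close>

definition ext :: "node set \<Rightarrow> node set" where
  "ext T = {u. u \<notin> T \<and> (u = [] \<or> butlast u \<in> T)}"

lemma finite_ext: "finite T \<Longrightarrow> finite (ext T)"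
proof (rule finite_subset)
  show "ext T \<subseteq> insert [] ((\<lambda>(u, b). u @ [b]) ` (T \<times> UNIV))"
  proof
    fix u assume "u \<in> ext T"
    then show "u \<in> insert [] ((\<lambda>(u, b). u @ [b]) ` (T \<times> UNIV))"
      by (cases u rule: rev_cases) (auto simp: ext_def)
  qed
qed auto

lemma ext_empty: "ext {} = {[]}"
  by (auto simp: ext_def)

lemma binary_tree_insert_ext: "binary_tree T \<Longrightarrow> u \<in> ext T \<Longrightarrow> binary_tree (insert u T)"
  by (auto simp: binary_tree_def ext_def)

lemma ext_insert:
  assumes "binary_tree T" "u \<in> ext T"
  shows "ext (insert u T) = insert (u @ [False]) (insert (u @ [True]) (ext T - {u}))"
proof -
  have "u @ [b] \<notin> T" for b using assms binary_tree_prefix[of T u "[b]"] by (auto simp: ext_def)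
  moreover have "b = False \<or> b = True" for b by auto
  ultimately show ?thesis
    by (intro set_eqI, rename_tac v, case_tac v rule: rev_cases) (use assms in \<open>auto simp: ext_def\<close>)
qed

lemma sum_ext_insert:
  fixes d :: "node \<Rightarrow> real"
  assumes "binary_tree T" "u \<in> ext T"
  shows "sum d (ext (insert u T)) = sum d (ext T) - d u + d (u @ [False]) + d (u @ [True])"
proof -
  have fin: "finite (ext T)" using assms(1) by (simp add: binary_tree_def finite_ext)
  have T: "u @ [b] \<notin> ext T" for b
    using assms by (auto simp: ext_def)
  show ?thesis
    unfolding ext_insert[OF assms] using fin T assms(2) by (simp add: sum_diff1)
qed

text \<open>A history lists the nodes of a growing tree, the most recent one first.\<close>

primrec histories :: "nat \<Rightarrow> node list set" where
  "histories 0 = {[]}"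
| "histories (Suc n) = (\<lambda>(l, u). u # l) ` (SIGMA l : histories n. ext (set l))"

lemma Cons_in_histories: "u # l \<in> histories (Suc n) \<longleftrightarrow> l \<in> histories n \<and> u \<in> ext (set l)"
  by (auto simp: image_iff)

lemma histories_length: "l \<in> histories n \<Longrightarrow> length l = n"
  by (induction n arbitrary: l) auto

lemma histories_distinct: "l \<in> histories n \<Longrightarrow> distinct l"
  by (induction n arbitrary: l) (auto simp: ext_def)

lemma histories_binary_tree: "l \<in> histories n \<Longrightarrow> binary_tree (set l)"
proof (induction n arbitrary: l)
  case (Suc n)
  then show ?case using binary_tree_insert_ext by fastforce
qed simp

lemma histories_words: "l \<in> histories n \<Longrightarrow> set l \<subseteq> words n"
proof (induction n arbitrary: l)
  case (Suc n)
  then obtain u l' where l: "l = u # l'" "l' \<in> histories n" "u \<in> ext (set l')" by auto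
  then show ?case using Suc.IH[of l'] by (cases u rule: rev_cases) (auto simp: words_def ext_def)
qed simp

lemma histories_drop: "l \<in> histories (n + k) \<Longrightarrow> drop k l \<in> histories n"
  by (induction k arbitrary: l) auto

lemma finite_histories: "finite (histories n)"
  by (induction n) (auto simp: finite_ext)

lemma sum_ext_harmonic:
  fixes d :: "node \<Rightarrow> real"
  assumes "\<And>u. d u = d (u @ [False]) + d (u @ [True])" "l \<in> histories n"
  shows "sum d (ext (set l)) = d []"
  using assms(2)
proof (induction n arbitrary: l)
  case (Suc n)
  then obtain u l' where l: "l = u # l'" "l' \<in> histories n" "u \<in> ext (set l')" by auto
  then show ?case
    using Suc.IH[OF l(2)] assms(1)[of u] sum_ext_insert[of "set l'" u d] histories_binary_tree[OF l(2)] by simp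
qed (simp add: ext_empty)

lemma card_ext: "l \<in> histories n \<Longrightarrow> card (ext (set l)) = Suc n"
proof (induction n arbitrary: l)
  case (Suc n)
  then obtain u l' where l: "l = u # l'" "l' \<in> histories n" "u \<in> ext (set l')" by auto
  have "real (card (ext (set l))) = (\<Sum>u\<in>ext (insert u (set l')). 1)" using l by simp
  also have "\<dots> = real (Suc (Suc n))"
    using l Suc.IH[OF l(2)] by (subst sum_ext_insert) (auto intro: histories_binary_tree)
  finally show ?case by linarith
qed (simp add: ext_empty)

text \<open>The mean of a function over all histories of length \<open>n\<close>; there are \<open>fact n\<close> of them.\<close>

definition mean :: "nat \<Rightarrow> (node list \<Rightarrow> real) \<Rightarrow> real" where
  "mean n g = (\<Sum>l\<in>histories n. g l) / fact n"

lemma mean_0 [simp]: "mean 0 g = g []"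
  by (simp add: mean_def)

lemma sum_histories_Suc:
  "(\<Sum>l\<in>histories (Suc n). g l) = (\<Sum>l\<in>histories n. \<Sum>u\<in>ext (set l). g (u # l))"
proof -
  have "(\<Sum>l\<in>histories (Suc n). g l) = (\<Sum>(l, u)\<in>(SIGMA l : histories n. ext (set l)). g (u # l))"
    by (simp, subst sum.reindex) (auto simp: inj_on_def case_prod_unfold)
  also have "\<dots> = (\<Sum>l\<in>histories n. \<Sum>u\<in>ext (set l). g (u # l))"
    by (subst sum.Sigma) (auto simp: finite_histories finite_ext)
  finally show ?thesis .
qed

text \<open>
  Averaging over histories amounts to adding a node chosen uniformly among the external nodes in
  each step; there are \<open>n + 1\<close> of them after \<open>n\<close> steps.
\<close>

lemma mean_Suc: "mean (Suc n) g = mean n (\<lambda>l. (\<Sum>u\<in>ext (set l). g (u # l)) / real (Suc n))"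
  unfolding mean_def sum_histories_Suc by (simp add: field_simps flip: sum_divide_distrib)

lemma card_histories: "card (histories n) = fact n"
proof (induction n)
  case (Suc n)
  have "real (card (histories (Suc n))) = (\<Sum>l\<in>histories n. \<Sum>u\<in>ext (set l). 1)"
    using sum_histories_Suc[of "\<lambda>_. 1 :: real" n] by (simp del: histories.simps)
  also have "\<dots> = (\<Sum>l\<in>histories n. real (Suc n))" by (intro sum.cong) (auto simp: card_ext)
  also have "\<dots> = real (fact (Suc n))" using Suc by (simp add: algebra_simps)
  finally show ?case by (simp only: of_nat_eq_iff)
qed simp

lemma mean_cong: "(\<And>l. l \<in> histories n \<Longrightarrow> g l = h l) \<Longrightarrow> mean n g = mean n h"
  by (simp add: mean_def)

lemma mean_mono: "(\<And>l. l \<in> histories n \<Longrightarrow> g l \<le> h l) \<Longrightarrow> mean n g \<le> mean n h"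
  by (auto simp: mean_def intro!: divide_right_mono sum_mono)

lemma mean_const [simp]: "mean n (\<lambda>_. c) = c"
  by (simp add: mean_def card_histories)

lemma mean_add: "mean n (\<lambda>l. g l + h l) = mean n g + mean n h"
  by (simp add: mean_def sum.distrib add_divide_distrib)

lemma mean_cmult: "mean n (\<lambda>l. c * g l) = c * mean n g"
  by (simp add: mean_def sum_distrib_left)

lemma mean_divide: "mean n (\<lambda>l. g l / c) = mean n g / c"
  by (simp add: mean_def sum_divide_distrib mult.commute)

lemma mean_sum: "mean n (\<lambda>l. \<Sum>i\<in>I. g i l) = (\<Sum>i\<in>I. mean n (g i))"
  unfolding mean_def by (subst sum.swap) (simp add: sum_divide_distrib)

lemma mean_drop: "mean (n + k) (\<lambda>l. g (drop k l)) = mean n g"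
proof (induction k)
  case (Suc k)
  have "mean (n + Suc k) (\<lambda>l. g (drop (Suc k) l)) = mean (n + k) (\<lambda>l. g (drop k l))"
    unfolding add_Suc_right mean_Suc by (rule mean_cong) (simp add: card_ext)
  then show ?case using Suc by simp
qed simp

section \<open>Centered sums over the nodes\<close>

text \<open>
  If each value of \<open>d\<close> is the sum of the values at the two children, then the sum of \<open>d\<close> over the
  external nodes does not change when the tree grows. Hence the following sums, centered at their
  means, form a martingale if each new node is chosen uniformly among the external nodes.
\<close>

definition csum :: "(node \<Rightarrow> real) \<Rightarrow> node list \<Rightarrow> real" where
  "csum d l = (\<Sum>u\<leftarrow>l. d u) - d [] * harm (length l)"

lemma csum_Cons: "csum d (u # l) = csum d l + (d u - d [] / real (Suc (length l)))"
  by (simp add: csum_def harm_Suc field_simps)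

lemma mean_csum:
  assumes d: "\<And>u. d u = d (u @ [False]) + d (u @ [True])"
  shows "mean n (csum d) = 0"
proof (induction n)
  case (Suc n)
  have "mean (Suc n) (csum d) = mean n (csum d)"
    unfolding mean_Suc
  proof (rule mean_cong)
    fix l assume l: "l \<in> histories n"
    have "(\<Sum>u\<in>ext (set l). csum d (u # l)) =
        real (Suc n) * csum d l + (d [] - real (Suc n) * (d [] / real (Suc n)))"
      using sum_ext_harmonic[OF d l] card_ext[OF l] histories_length[OF l]
      by (simp add: csum_Cons sum.distrib sum_subtractf del: of_nat_Suc)
    then show "(\<Sum>u\<in>ext (set l). csum d (u # l)) / real (Suc n) = csum d l"
      by (simp del: of_nat_Suc)
  qed
  then show ?case using Suc by simp
qed (simp add: csum_def harm_def)

text \<open>The increments are orthogonal, so second moments are sums over the nodes added.\<close>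

lemma mean_csum_diff_square:
  assumes d: "\<And>u. d u = d (u @ [False]) + d (u @ [True])"
  shows "mean (n + k) (\<lambda>l. (csum d l - csum d (drop k l))\<^sup>2) \<le>
    mean (n + k) (\<lambda>l. \<Sum>u\<leftarrow>take k l. (d u)\<^sup>2)"
proof (induction k)
  case (Suc k)
  define m where "m = n + k"
  define a where "a l = csum d l - csum d (drop k l)" for l
  define b where "b l = (\<Sum>u\<leftarrow>take k l. (d u)\<^sup>2)" for l
  have "mean (n + Suc k) (\<lambda>l. (csum d l - csum d (drop (Suc k) l))\<^sup>2) =
      mean m (\<lambda>l. (\<Sum>u\<in>ext (set l). (a l + (d u - d [] / real (Suc (length l))))\<^sup>2) / real (Suc m))"
    unfolding add_Suc_right mean_Suc a_def m_def by (simp add: csum_Cons algebra_simps)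
  also have "\<dots> \<le> mean m (\<lambda>l. (a l)\<^sup>2 + (\<Sum>u\<in>ext (set l). (d u)\<^sup>2) / real (Suc m))"
  proof (rule mean_mono)
    fix l assume l: "l \<in> histories m"
    \<comment> \<open>the mean of the new term; subtracting it can only decrease the second moment\<close>
    define D where "D = d [] / real (Suc m)"
    have len: "length l = m" using l by (rule histories_length)
    have "(\<Sum>u\<in>ext (set l). (a l + (d u - D))\<^sup>2)
        = (\<Sum>u\<in>ext (set l). (a l - D)\<^sup>2 + 2 * (a l - D) * d u + (d u)\<^sup>2)"
      by (intro sum.cong refl) (simp add: power2_eq_square algebra_simps)
    also have "\<dots> = real (Suc m) * (a l - D)\<^sup>2 + 2 * (a l - D) * (real (Suc m) * D) + (\<Sum>u\<in>ext (set l). (d u)\<^sup>2)"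
      using sum_ext_harmonic[OF d l] card_ext[OF l]
      by (simp add: sum.distrib D_def flip: sum_distrib_left)
    also have "\<dots> = real (Suc m) * (a l)\<^sup>2 - real (Suc m) * D\<^sup>2 + (\<Sum>u\<in>ext (set l). (d u)\<^sup>2)"
      by (simp add: power2_eq_square algebra_simps)
    also have "\<dots> \<le> real (Suc m) * (a l)\<^sup>2 + (\<Sum>u\<in>ext (set l). (d u)\<^sup>2)" by simp
    finally have "(\<Sum>u\<in>ext (set l). (a l + (d u - D))\<^sup>2) / real (Suc m)
        \<le> (real (Suc m) * (a l)\<^sup>2 + (\<Sum>u\<in>ext (set l). (d u)\<^sup>2)) / real (Suc m)"
      by (rule divide_right_mono) simp
    also have "\<dots> = (a l)\<^sup>2 + (\<Sum>u\<in>ext (set l). (d u)\<^sup>2) / real (Suc m)"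
      by (simp add: add_divide_distrib del: of_nat_Suc)
    finally show "(\<Sum>u\<in>ext (set l). (a l + (d u - d [] / real (Suc (length l))))\<^sup>2) / real (Suc m)
        \<le> (a l)\<^sup>2 + (\<Sum>u\<in>ext (set l). (d u)\<^sup>2) / real (Suc m)"
      unfolding len D_def .
  qed
  also have "\<dots> \<le> mean m (\<lambda>l. b l + (\<Sum>u\<in>ext (set l). (d u)\<^sup>2) / real (Suc m))"
    using Suc unfolding mean_add a_def b_def m_def by simp
  also have "\<dots> = mean m (\<lambda>l. (\<Sum>u\<in>ext (set l). (d u)\<^sup>2 + b l) / real (Suc m))"
    by (rule mean_cong) (simp add: card_ext sum.distrib add_divide_distrib)
  also have "\<dots> = mean (n + Suc k) (\<lambda>l. \<Sum>u\<leftarrow>take (Suc k) l. (d u)\<^sup>2)"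
    unfolding add_Suc_right mean_Suc b_def m_def by simp
  finally show ?case .
qed simp

text \<open>The contribution of a node \<open>u\<close> to \<^const>\<open>eta\<close> of the subtree at \<open>v\<close>.\<close>

definition weight :: "node \<Rightarrow> node \<Rightarrow> real" where
  "weight v u = (if prefix v u then (1 / 2) ^ (length u - length v) else 0)"

lemma eta_subtree: "binary_tree T \<Longrightarrow> eta (subtree T v) = (\<Sum>u\<in>T. weight v u)"
proof -
  assume T: "binary_tree T"
  have "(\<Sum>u\<in>T. weight v u) = (\<Sum>u\<in>{u \<in> T. prefix v u}. (1 / 2) ^ (length u - length v))"
    using T by (simp add: weight_def sum.inter_filter binary_tree_def)
  also have "{u \<in> T. prefix v u} = (@) v ` subtree T v"
    by (auto simp: subtree_def prefix_def)
  also have "(\<Sum>u\<in>(@) v ` subtree T v. (1 / 2) ^ (length u - length v)) = eta (subtree T v)"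
    using T by (simp add: sum.reindex inj_on_def eta_eq_sum binary_tree_subtree)
  finally show ?thesis by simp
qed

text \<open>
  The contribution of \<open>u\<close> to the difference of the values of \<^const>\<open>eta\<close> for the two subtrees
  below \<open>w\<close>.
\<close>

definition dweight :: "node \<Rightarrow> node \<Rightarrow> real" where
  "dweight w u = weight (w @ [False]) u - weight (w @ [True]) u"

text \<open>
  Only at the parent of \<open>v\<close> does the weight fail to be the sum over the two children. In
  \<open>dweight\<close> the two defects, both at \<open>w\<close>, cancel.
\<close>

lemma weight_children:
  "weight v (u @ [False]) + weight v (u @ [True]) = weight v u + (if v \<noteq> [] \<and> u = butlast v then 1 else 0)"
proof (cases "prefix v u")
  case True
  then have "length v \<le> length u" by (rule prefix_length_le)
  moreover have "v = [] \<or> u \<noteq> butlast v" using calculation by (cases v rule: rev_cases) auto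
  ultimately show ?thesis using True by (auto simp: weight_def Suc_diff_le)
next
  case False
  then show ?thesis by (cases v rule: rev_cases) (auto simp: weight_def)
qed

lemma dweight_harmonic: "dweight w u = dweight w (u @ [False]) + dweight w (u @ [True])"
  using weight_children[of "w @ [False]" u] weight_children[of "w @ [True]" u] by (simp add: dweight_def)

lemma dweight_Nil: "dweight w [] = 0"
  by (simp add: dweight_def weight_def)

lemma dweight_square:
  "(dweight w u)\<^sup>2 \<le> (if strict_prefix w u then 4 * (1 / 4) ^ (length u - length w) else 0)"
proof (cases "strict_prefix w u")
  case True
  then obtain b v where u: "u = w @ b # v" by (auto elim: strict_prefixE')
  show ?thesis using True
    by (cases b) (auto simp: u dweight_def weight_def power2_eq_square simp flip: power_mult_distrib)
next
  case False
  have "\<not> prefix (w @ [b]) u" for b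
    using False by (metis append_prefixD prefix_order.dual_order.not_eq_order_implies_strict
        prefix_length_le length_append_singleton not_less_eq_eq order_refl)
  then show ?thesis using False by (simp add: dweight_def weight_def)
qed

lemma gap_eq_csum:
  assumes "l \<in> histories n" "l' \<in> histories m"
  shows "gap (set l) (set l') w = csum (dweight w) l' - csum (dweight w) l"
proof -
  have "gap (set l) (set l') w = (\<Sum>u\<in>set l'. dweight w u) - (\<Sum>u\<in>set l. dweight w u)"
    using assms by (simp add: gap_def eta_subtree histories_binary_tree dweight_def sum_subtractf)
  then show ?thesis
    using assms by (simp add: csum_def dweight_Nil sum_list_distinct_conv_sum_set histories_distinct)
qed

text \<open>
  Only the proper prefixes \<open>w\<close> of \<open>u\<close> contribute, which leaves a geometric sum.
\<close>

lemma sum_dweight_square: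
  "(\<Sum>w\<in>words N. (3 / 8) ^ length w * (dweight w u)\<^sup>2) \<le> 8 * (3 / 8) ^ length u"
proof -
  have "(\<Sum>w\<in>words N. (3 / 8) ^ length w * (dweight w u)\<^sup>2)
      \<le> (\<Sum>w\<in>words N. if strict_prefix w u then (3 / 8) ^ length w * (4 * (1 / 4) ^ (length u - length w)) else 0)"
    by (intro sum_mono order_trans[OF mult_left_mono[OF dweight_square]]) auto
  also have "\<dots> = (\<Sum>w\<in>{w \<in> words N. strict_prefix w u}. (3 / 8) ^ length w * (4 * (1 / 4) ^ (length u - length w)))"
    by (simp add: sum.inter_filter)
  also have "\<dots> \<le> (\<Sum>w\<in>(\<lambda>j. take j u) ` {..<length u}. (3 / 8) ^ length w * (4 * (1 / 4) ^ (length u - length w)))"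
  proof (rule sum_mono2)
    show "{w \<in> words N. strict_prefix w u} \<subseteq> (\<lambda>j. take j u) ` {..<length u}"
    proof
      fix w assume "w \<in> {w \<in> words N. strict_prefix w u}"
      then have "w = take (length w) u" "length w < length u"
        by (auto simp: strict_prefix_def prefix_def)
      then show "w \<in> (\<lambda>j. take j u) ` {..<length u}" by blast
    qed
  qed auto
  also have "\<dots> = (\<Sum>j<length u. (3 / 8) ^ j * (4 * (1 / 4) ^ (length u - j)))"
  proof (subst sum.reindex)
    show "inj_on (\<lambda>j. take j u) {..<length u}"
      by (rule inj_on_inverseI[of _ length]) simp
  qed (auto intro!: sum.cong)
  also have "\<dots> = 4 * (1 / 4) ^ length u * (\<Sum>j<length u. (3 / 2) ^ j)"
    unfolding sum_distrib_left
  proof (intro sum.cong refl)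
    fix j assume "j \<in> {..<length u}"
    then have "(1 / 4 :: real) ^ length u = (1 / 4) ^ j * (1 / 4) ^ (length u - j)"
      by (simp flip: power_add)
    moreover have "(3 / 8 :: real) ^ j = (1 / 4) ^ j * (3 / 2) ^ j"
      by (simp flip: power_mult_distrib)
    ultimately show "(3 / 8) ^ j * (4 * (1 / 4) ^ (length u - j)) = 4 * (1 / 4) ^ length u * (3 / 2 :: real) ^ j"
      by simp
  qed
  also have "(\<Sum>j<length u. (3 / 2 :: real) ^ j) \<le> 2 * (3 / 2) ^ length u"
    by (subst geometric_sum) auto
  also have "4 * (1 / 4) ^ length u * (2 * (3 / 2) ^ length u) = 8 * (3 / 8 :: real) ^ length u"
    by (simp flip: power_mult_distrib)
  finally show ?thesis by simp
qed

section \<open>Mean square distances between standardized trees\<close>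

text \<open>
  The pair of the centered integrated silhouette and the centered total area under the silhouette.
\<close>

definition standardized :: "node set \<Rightarrow> c00 \<times> real" where
  "standardized T = (centered_int_silhouette T, centered_eta T)"

text \<open>
  The mean of a bounded functional that increases with the tree. Its increments dominate the mean
  square increments of the standardized trees.
\<close>

definition total_weight :: "nat \<Rightarrow> real" where
  "total_weight n = mean n (\<lambda>l. \<Sum>u\<leftarrow>l. (3 / 8) ^ length u)"

lemma centered_eta_eq_csum: "l \<in> histories n \<Longrightarrow> centered_eta (set l) = csum (\<lambda>u. (1 / 2) ^ length u) l"
  by (simp add: centered_eta_def csum_def eta_eq_sum histories_binary_tree histories_distinct
      sum_list_distinct_conv_sum_set distinct_card)

lemma mean_centered_eta: "mean n (\<lambda>l. centered_eta (set l)) = 0"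
proof -
  have "mean n (\<lambda>l. centered_eta (set l)) = mean n (csum (\<lambda>u. (1 / 2) ^ length u))"
    by (rule mean_cong) (rule centered_eta_eq_csum)
  also have "\<dots> = 0" by (rule mean_csum) simp
  finally show ?thesis .
qed

lemma mean_take: "mean (n + k) (\<lambda>l. \<Sum>u\<leftarrow>take k l. (3 / 8) ^ length u) = total_weight (n + k) - total_weight n"
proof -
  have "(\<Sum>u\<leftarrow>l. f u :: real) = (\<Sum>u\<leftarrow>take k l. f u) + (\<Sum>u\<leftarrow>drop k l. f u)" for f and l :: "node list"
    by (metis append_take_drop_id map_append sum_list_append)
  then have "total_weight (n + k) = mean (n + k) (\<lambda>l. \<Sum>u\<leftarrow>take k l. (3 / 8) ^ length u)
      + mean (n + k) (\<lambda>l. \<Sum>u\<leftarrow>drop k l. (3 / 8) ^ length u)"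
    unfolding total_weight_def mean_add[symmetric] by (intro mean_cong) blast
  also have "mean (n + k) (\<lambda>l. \<Sum>u\<leftarrow>drop k l. (3 / 8) ^ length u) = total_weight n"
    unfolding total_weight_def by (rule mean_drop)
  finally show ?thesis by simp
qed

text \<open>
  There are \<open>2 ^ j\<close> words of length \<open>j\<close>, and \<open>2 * (3 / 8) < 1\<close>.
\<close>

lemma sum_words_le: "(\<Sum>w\<in>words N. (3 / 8 :: real) ^ length w) \<le> 4"
proof (induction N)
  case (Suc N)
  have "(\<Sum>w\<in>words (Suc N). (3 / 8 :: real) ^ length w) = 1 + 3 / 4 * (\<Sum>w\<in>words N. (3 / 8) ^ length w)"
    unfolding sum_words_Suc by (simp add: sum_distrib_left)
  then show ?case using Suc by linarith
qed simp

lemma total_weight_le: "total_weight n \<le> 4"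
proof -
  have "total_weight n \<le> mean n (\<lambda>_. 4)"
    unfolding total_weight_def
  proof (rule mean_mono)
    fix l assume l: "l \<in> histories n"
    have "(\<Sum>u\<leftarrow>l. (3 / 8) ^ length u) = (\<Sum>u\<in>set l. (3 / 8 :: real) ^ length u)"
      using l by (simp add: sum_list_distinct_conv_sum_set histories_distinct)
    also have "\<dots> \<le> (\<Sum>u\<in>words n. (3 / 8) ^ length u)"
      using histories_words[OF l] by (intro sum_mono2) auto
    also have "\<dots> \<le> 4" by (rule sum_words_le)
    finally show "(\<Sum>u\<leftarrow>l. (3 / 8) ^ length u :: real) \<le> 4" .
  qed
  then show ?thesis by simp
qed

text \<open>
  The gap below each node is a centered sum with increments \<^term>\<open>dweight w\<close>, so its mean square
  is bounded by the squares of these increments at the nodes added.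
\<close>

lemma mean_standardized_diff_square:
  "mean (n + k) (\<lambda>l. (norm (standardized (set l) - standardized (set (drop k l))))\<^sup>2)
    \<le> 5 / 2 * (total_weight (n + k) - total_weight n)"
proof -
  define m where "m = n + k"
  let ?q = "mean m (\<lambda>l. \<Sum>u\<leftarrow>take k l. (3 / 8) ^ length u)"
  have drop: "drop k l \<in> histories n" if "l \<in> histories m" for l
    using that unfolding m_def by (rule histories_drop)
  have "mean m (\<lambda>l. (norm (centered_int_silhouette (set l) - centered_int_silhouette (set (drop k l))))\<^sup>2)
      \<le> mean m (\<lambda>l. 3 / 16 * (\<Sum>w\<in>words m. (3 / 8) ^ length w * (gap (set (drop k l)) (set l) w)\<^sup>2))"
  proof (rule mean_mono, rule norm_centered_int_silhouette_diff)
    fix l assume l: "l \<in> histories m"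
    show "binary_tree (set (drop k l))" "binary_tree (set l)"
      using l drop[OF l] by (auto intro: histories_binary_tree)
    show "set (drop k l) \<union> set l \<subseteq> words m"
      using histories_words[OF l] set_drop_subset[of k l] by auto
  qed
  also have "\<dots> = 3 / 16 * (\<Sum>w\<in>words m. (3 / 8) ^ length w *
      mean m (\<lambda>l. (csum (dweight w) l - csum (dweight w) (drop k l))\<^sup>2))"
    unfolding mean_cmult mean_sum
    by (intro arg_cong2[where f = "(*)"] sum.cong mean_cong refl) (auto simp: gap_eq_csum[OF drop])
  also have "\<dots> \<le> 3 / 16 * (\<Sum>w\<in>words m. (3 / 8) ^ length w * mean m (\<lambda>l. \<Sum>u\<leftarrow>take k l. (dweight w u)\<^sup>2))"
    unfolding m_def by (intro mult_left_mono sum_mono mean_csum_diff_square dweight_harmonic) auto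
  also have "\<dots> = 3 / 16 * mean m (\<lambda>l. \<Sum>u\<leftarrow>take k l. \<Sum>w\<in>words m. (3 / 8) ^ length w * (dweight w u)\<^sup>2)"
  proof -
    have "(\<Sum>u\<leftarrow>l. \<Sum>w\<in>words m. (3 / 8) ^ length w * (dweight w u)\<^sup>2)
        = (\<Sum>w\<in>words m. (3 / 8) ^ length w * (\<Sum>u\<leftarrow>l. (dweight w u)\<^sup>2))" for l
      by (induction l) (auto simp: sum.distrib distrib_left)
    then show ?thesis by (simp add: mean_sum mean_cmult)
  qed
  also have "\<dots> \<le> 3 / 16 * mean m (\<lambda>l. \<Sum>u\<leftarrow>take k l. 8 * (3 / 8) ^ length u)"
    by (intro mult_left_mono mean_mono sum_list_mono sum_dweight_square) auto
  also have "\<dots> = 3 / 2 * ?q"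
    by (simp add: sum_list_const_mult mean_cmult)
  finally have 1: "mean m (\<lambda>l. (norm (centered_int_silhouette (set l) - centered_int_silhouette (set (drop k l))))\<^sup>2)
      \<le> 3 / 2 * ?q" .
  have "mean m (\<lambda>l. (centered_eta (set l) - centered_eta (set (drop k l)))\<^sup>2)
      = mean m (\<lambda>l. (csum (\<lambda>u. (1 / 2) ^ length u) l - csum (\<lambda>u. (1 / 2) ^ length u) (drop k l))\<^sup>2)"
    by (intro mean_cong) (simp add: centered_eta_eq_csum[OF drop] centered_eta_eq_csum)
  also have "\<dots> \<le> mean m (\<lambda>l. \<Sum>u\<leftarrow>take k l. ((1 / 2) ^ length u)\<^sup>2)"
    unfolding m_def by (rule mean_csum_diff_square) simp
  also have "\<dots> \<le> ?q"
    by (intro mean_mono sum_list_mono) (simp add: power2_eq_square power_mono flip: power_mult_distrib)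
  finally have 2: "mean m (\<lambda>l. (centered_eta (set l) - centered_eta (set (drop k l)))\<^sup>2) \<le> ?q" .
  have "mean m (\<lambda>l. (norm (standardized (set l) - standardized (set (drop k l))))\<^sup>2) =
      mean m (\<lambda>l. (norm (centered_int_silhouette (set l) - centered_int_silhouette (set (drop k l))))\<^sup>2)
      + mean m (\<lambda>l. (centered_eta (set l) - centered_eta (set (drop k l)))\<^sup>2)"
    by (simp add: standardized_def norm_Pair flip: mean_add)
  also have "\<dots> \<le> 3 / 2 * ?q + ?q" by (intro add_mono 1 2)
  also have "\<dots> = 5 / 2 * ?q" by simp
  also have "?q = total_weight (n + k) - total_weight n" unfolding m_def by (rule mean_take)
  finally show ?thesis unfolding m_def .
qed

section \<open>Splitting a random tree at its root\<close>

text \<open>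
  The tree with left subtree \<open>L\<close> and right subtree \<open>R\<close>.
\<close>

definition root_join :: "node set \<Rightarrow> node set \<Rightarrow> node set" where
  "root_join L R = insert [] ((#) False ` L \<union> (#) True ` R)"

lemma root_join_simps [simp]: "[] \<in> root_join L R" "False # u \<in> root_join L R \<longleftrightarrow> u \<in> L" "True # u \<in> root_join L R \<longleftrightarrow> u \<in> R"
  by (auto simp: root_join_def)

lemma ext_join: "ext (root_join L R) = (#) False ` ext L \<union> (#) True ` ext R"
proof (rule set_eqI)
  fix u
  show "u \<in> ext (root_join L R) \<longleftrightarrow> u \<in> (#) False ` ext L \<union> (#) True ` ext R"
  proof (cases u)
    case (Cons b v)
    then show ?thesis by (cases b; cases v) (auto simp: ext_def)
  qed (simp add: ext_def image_iff)
qed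

lemma insert_join:
  "insert (False # u) (root_join L R) = root_join (insert u L) R"
  "insert (True # u) (root_join L R) = root_join L (insert u R)"
  by (auto simp: root_join_def)

lemma sum_ext_join:
  fixes h :: "node set \<Rightarrow> real"
  assumes "finite L" "finite R"
  shows "(\<Sum>u\<in>ext (root_join L R). h (insert u (root_join L R))) =
    (\<Sum>u\<in>ext L. h (root_join (insert u L) R)) + (\<Sum>u\<in>ext R. h (root_join L (insert u R)))"
  unfolding ext_join using assms
  by (subst sum.union_disjoint) (auto simp: finite_ext sum.reindex insert_join)

text \<open>
  In a uniformly growing tree the number of nodes to the left of the root is uniformly distributed,
  as in Polya's urn, and given this number the two subtrees are independent and grow uniformly.
\<close>

lemma mean_join:
  fixes h :: "node set \<Rightarrow> real"
  shows "mean (Suc n) (\<lambda>l. h (set l)) =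
    (\<Sum>i\<le>n. mean i (\<lambda>l. mean (n - i) (\<lambda>r. h (root_join (set l) (set r))))) / real (Suc n)"
proof (induction n arbitrary: h)
  case 0
  show ?case by (simp add: mean_Suc ext_empty root_join_def)
next
  case (Suc n)
  define F where "F i j = mean i (\<lambda>l. mean j (\<lambda>r. h (root_join (set l) (set r))))" for i j
  have left: "mean i (\<lambda>l. mean j (\<lambda>r. \<Sum>u\<in>ext (set l). h (root_join (insert u (set l)) (set r))))
      = real (Suc i) * F (Suc i) j" for i j
    unfolding F_def mean_Suc[of i] mean_sum by (simp add: mean_divide del: of_nat_Suc)
  have right: "mean i (\<lambda>l. mean j (\<lambda>r. \<Sum>u\<in>ext (set r). h (root_join (set l) (insert u (set r)))))
      = real (Suc j) * F i (Suc j)" for i j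
    unfolding F_def mean_Suc[of j] by (simp add: mean_divide del: of_nat_Suc)
  have "mean (Suc (Suc n)) (\<lambda>l. h (set l)) =
      mean (Suc n) (\<lambda>l. (\<Sum>u\<in>ext (set l). h (insert u (set l)))) / real (Suc (Suc n))"
    unfolding mean_Suc[of "Suc n"] mean_divide by simp
  also have "mean (Suc n) (\<lambda>l. (\<Sum>u\<in>ext (set l). h (insert u (set l)))) =
    (\<Sum>i\<le>n. real (Suc i) * F (Suc i) (n - i) + real (Suc (n - i)) * F i (Suc (n - i))) / real (Suc n)"
    unfolding Suc[of "\<lambda>T. \<Sum>u\<in>ext T. h (insert u T)"]
    by (simp only: sum_ext_join finite_set mean_add left right)
  also have "(\<Sum>i\<le>n. real (Suc i) * F (Suc i) (n - i) + real (Suc (n - i)) * F i (Suc (n - i)))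
      = (\<Sum>i\<le>Suc n. real i * F i (Suc n - i)) + (\<Sum>i\<le>Suc n. real (Suc n - i) * F i (Suc n - i))"
  proof -
    have "(\<Sum>i\<le>Suc n. real i * F i (Suc n - i)) = (\<Sum>i\<le>n. real (Suc i) * F (Suc i) (n - i))"
      by (subst sum.atMost_Suc_shift) simp
    moreover have "(\<Sum>i\<le>Suc n. real (Suc n - i) * F i (Suc n - i)) = (\<Sum>i\<le>n. real (Suc (n - i)) * F i (Suc (n - i)))"
      by (auto simp: Suc_diff_le intro!: sum.cong)
    ultimately show ?thesis by (simp add: sum.distrib)
  qed
  also have "\<dots> = (\<Sum>i\<le>Suc n. real (Suc n) * F i (Suc n - i))"
    unfolding sum.distrib[symmetric]
    by (intro sum.cong refl) (auto simp: of_nat_diff algebra_simps)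
  also have "\<dots> / real (Suc n) = (\<Sum>i\<le>Suc n. F i (Suc n - i))"
    unfolding sum_distrib_left[symmetric] by simp
  finally show ?case unfolding F_def .
qed

section \<open>The history of a binary search tree\<close>

text \<open>
  The nodes of the search tree for \<open>x 1, \<dots>, x n\<close> in reverse order of insertion.
\<close>

primrec history :: "(nat \<Rightarrow> real) \<Rightarrow> nat \<Rightarrow> node list" where
  "history x 0 = []"
| "history x (Suc n) = exit_node (bst_labelling x n) (x (Suc n)) # history x n"

text \<open>
  The labelling is a function of the history and the input sequence. For a fixed history this
  function is measurable in the input.
\<close>

primrec relabel :: "node list \<Rightarrow> (nat \<Rightarrow> real) \<Rightarrow> (node \<rightharpoonup> real)" where
  "relabel [] x = Map.empty"
| "relabel (u # l) x = (relabel l x)(u \<mapsto> x (Suc (length l)))"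

lemma length_history [simp]: "length (history x n) = n"
  by (induction n) auto

lemma bst_labelling_eq_relabel: "bst_labelling x n = relabel (history x n) x"
  by (induction n) auto

lemma dom_relabel: "dom (relabel l x) = set l"
  by (induction l) (simp_all del: fun_upd_apply)

lemma set_history: "set (history x n) = dom (bst_labelling x n)"
  by (simp add: bst_labelling_eq_relabel dom_relabel)

lemma history_in_histories: "history x n \<in> histories n"
proof (induction n)
  case (Suc n)
  let ?u = "exit_node (bst_labelling x n) (x (Suc n))"
  have "?u \<in> ext (set (history x n))"
    using exit_node[OF binary_tree_bst, of x n "x (Suc n)"]
    by (cases ?u rule: rev_cases) (auto simp: ext_def set_history)
  then show ?case unfolding history.simps(2) Cons_in_histories using Suc by blast
qed simp

lemma relabel_nth: "distinct l \<Longrightarrow> 1 \<le> i \<Longrightarrow> i \<le> length l \<Longrightarrow> relabel l x (l ! (length l - i)) = Some (x i)"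
proof (induction l)
  case (Cons u l)
  show ?case
  proof (cases "i = Suc (length l)")
    case False
    then have i: "i \<le> length l" using Cons by simp
    then have "(u # l) ! (length (u # l) - i) = l ! (length l - i)" by (simp add: Suc_diff_le)
    moreover have "l ! (length l - i) \<in> set l" using i Cons.prems(2) by (intro nth_mem) auto
    ultimately show ?thesis using Cons i by auto
  qed simp
qed simp

lemma search_path_take: "j \<le> k \<Longrightarrow> take j (search_path L y k) = search_path L y j"
proof (induction k)
  case (Suc k)
  have len: "length (search_path L y k) = k" for k by (induction k) auto
  show ?case
  proof (cases "j = Suc k")
    case False
    then show ?thesis using Suc len[of k] by simp
  qed (use len[of "Suc k"] in \<open>simp del: search_path.simps\<close>)
qed simp

text \<open>The defining property of a search tree.\<close>

lemma bst_labelling_less_iff: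
  assumes "u @ b # w \<in> dom (bst_labelling x n)"
  shows "the (bst_labelling x n u) < the (bst_labelling x n (u @ b # w)) \<longleftrightarrow> b"
  using assms
proof (induction n)
  case (Suc n)
  define L where "L = bst_labelling x n"
  define y where "y = x (Suc n)"
  define v where "v = exit_node L y"
  have bt: "binary_tree (dom L)" unfolding L_def by (rule binary_tree_bst)
  have v: "v \<notin> dom L" unfolding v_def by (rule exit_node(1)[OF bt])
  have eq: "bst_labelling x (Suc n) = L(v \<mapsto> y)" by (simp add: L_def v_def y_def)
  have len: "length (search_path L y k) = k" for k by (induction k) auto
  show ?case
  proof (cases "u @ b # w = v")
    case True
    define k where "k = (LEAST k. search_path L y k \<notin> dom L)"
    have vk: "v = search_path L y k" by (simp add: v_def exit_node_def k_def)
    have k: "length v = k" by (simp add: vk len)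
    have lt: "Suc (length u) \<le> k" using k by (simp flip: True)
    \<comment> \<open>the new node is reached through \<open>u\<close>, where the search turns in direction \<open>b\<close>\<close>
    have "search_path L y (Suc (length u)) = take (Suc (length u)) v"
      unfolding vk using lt by (rule search_path_take[symmetric])
    also have "\<dots> = u @ [b]" by (simp flip: True)
    finally have path: "search_path L y (length u) @ [the (L (search_path L y (length u))) < y] = u @ [b]" by (simp only: search_path.simps)
    then have u: "search_path L y (length u) = u" by simp
    have "(the (L u) < y) = b" using path unfolding u by simp
    moreover have "u \<noteq> v" using True by auto
    ultimately show ?thesis unfolding eq True by simp
  next
    case False
    then have dom: "u @ b # w \<in> dom L" using Suc.prems unfolding eq by (simp del: fun_upd_apply)
    then have "u \<noteq> v" using v binary_tree_prefix[OF bt] by blast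
    then show ?thesis using False Suc.IH dom unfolding eq by (simp add: L_def)
  qed
qed simp

text \<open>Hence, up to ties, the history determines the relative order of the input sequence.\<close>

lemma history_eq_imp_le:
  assumes hist: "history x n = history y n"
    and ij: "i \<in> {1..n}" "j \<in> {1..n}" and less: "x i < x j"
  shows "y i \<le> y j"
proof -
  define l where "l = history x n"
  have l: "distinct l" "length l = n" "binary_tree (set l)"
    unfolding l_def using history_in_histories by (auto intro: histories_distinct histories_binary_tree)
  define u v where "u = l ! (n - i)" and "v = l ! (n - j)"
  have uv: "u \<in> set l" "v \<in> set l" unfolding u_def v_def using ij l by (auto intro!: nth_mem)
  define K L where "K = bst_labelling x n" and "L = bst_labelling y n"
  have KL: "K = relabel l x" "L = relabel l y"
    unfolding K_def L_def l_def by (simp_all add: bst_labelling_eq_relabel hist)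
  have lab: "the (K u) = x i" "the (K v) = x j" "the (L u) = y i" "the (L v) = y j"
    unfolding KL u_def v_def using relabel_nth[of l] l ij by auto
  have dom: "dom K = set l" "dom L = set l" by (simp_all add: KL dom_relabel)
  have K: "the (K p) < the (K (p @ b # w)) \<longleftrightarrow> b" and L: "the (L p) < the (L (p @ b # w)) \<longleftrightarrow> b"
    if "p @ b # w \<in> set l" for p b w
    using that bst_labelling_less_iff[of p b w x n] bst_labelling_less_iff[of p b w y n] dom
    unfolding K_def L_def by auto
  have "u \<noteq> v" using less lab by auto
  \<comment> \<open>in the last case the two nodes are separated at \<open>p\<close>\<close>
  then consider b w where "v = u @ b # w" | b w where "u = v @ b # w"
    | p b w c z where "b \<noteq> c" "u = p @ b # w" "v = p @ c # z"
  proof (cases "prefix u v \<or> prefix v u")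
    case True
    then obtain z where "v = u @ z \<or> u = v @ z" by (auto simp: prefix_def)
    then show ?thesis using \<open>u \<noteq> v\<close> that(1,2) by (cases z) auto
  next
    case False
    then have "parallel u v" by auto
    then show ?thesis using parallel_decomp that(3) by blast
  qed
  then show ?thesis
  proof cases
    case 1
    then show ?thesis using K[of u b w] L[of u b w] uv lab less by simp
  next
    case 2
    then show ?thesis using K[of v b w] L[of v b w] uv lab less by (simp add: linorder_not_less[symmetric])
  next
    case (3 p b w c z)
    have "the (K p) < x i \<longleftrightarrow> b" "the (K p) < x j \<longleftrightarrow> c" "the (L p) < y i \<longleftrightarrow> b" "the (L p) < y j \<longleftrightarrow> c"
      using K[of p b w] K[of p c z] L[of p b w] L[of p c z] uv lab 3 by auto
    then show ?thesis using less 3(1) by (cases b; cases c) auto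
  qed
qed

text \<open>A linear order on a finite set is realized by at most one rearrangement.\<close>

lemma order_pattern_unique:
  fixes x y :: "'i \<Rightarrow> real"
  assumes I: "finite I" and x: "inj_on x I" and perm: "\<sigma> permutes I" "\<tau> permutes I"
    and \<sigma>: "\<And>i j. i \<in> I \<Longrightarrow> j \<in> I \<Longrightarrow> x i < x j \<Longrightarrow> y (\<sigma> i) < y (\<sigma> j)"
    and \<tau>: "\<And>i j. i \<in> I \<Longrightarrow> j \<in> I \<Longrightarrow> x i < x j \<Longrightarrow> y (\<tau> i) < y (\<tau> j)"
  shows "\<sigma> = \<tau>"
proof
  fix i
  \<comment> \<open>both rearrangements preserve ranks, and the rank determines the element\<close>
  have rank: "card {a \<in> I. y a < y (\<pi> i)} = card {j \<in> I. x j < x i}"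
    if \<pi>: "\<pi> permutes I" and mono: "\<And>i j. i \<in> I \<Longrightarrow> j \<in> I \<Longrightarrow> x i < x j \<Longrightarrow> y (\<pi> i) < y (\<pi> j)"
      and i: "i \<in> I" for \<pi>
  proof -
    have iff: "y (\<pi> j) < y (\<pi> i) \<longleftrightarrow> x j < x i" if "j \<in> I" for j
      using mono[OF that i] mono[OF i that] inj_onD[OF x _ that i] by (metis less_asym' less_irrefl linorder_neqE)
    have "{a \<in> I. y a < y (\<pi> i)} = \<pi> ` {j \<in> I. x j < x i}"
    proof (rule set_eqI)
      fix a
      show "a \<in> {a \<in> I. y a < y (\<pi> i)} \<longleftrightarrow> a \<in> \<pi> ` {j \<in> I. x j < x i}"
      proof (cases "a \<in> I")
        case True
        then obtain j where "j \<in> I" "a = \<pi> j" using permutes_image[OF \<pi>] by blast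
        then show ?thesis using iff[of j] permutes_inj[OF \<pi>] True by (auto dest: injD)
      next
        case False
        then show ?thesis using permutes_image[OF \<pi>] by blast
      qed
    qed
    then show ?thesis using \<pi> by (simp add: card_image permutes_inj_on)
  qed
  show "\<sigma> i = \<tau> i"
  proof (cases "i \<in> I")
    case True
    have less: "card {a \<in> I. y a < y b} < card {a \<in> I. y a < y c}" if "y b < y c" "b \<in> I" for b c
      using that I by (intro psubset_card_mono) auto
    have mem: "\<sigma> i \<in> I" "\<tau> i \<in> I" using True perm by (simp_all add: permutes_in_image)
    have "card {a \<in> I. y a < y (\<sigma> i)} = card {j \<in> I. x j < x i}"
      by (rule rank[OF perm(1) _ True]) (rule \<sigma>)
    moreover have "card {a \<in> I. y a < y (\<tau> i)} = card {j \<in> I. x j < x i}"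
      by (rule rank[OF perm(2) _ True]) (rule \<tau>)
    ultimately have "y (\<sigma> i) = y (\<tau> i)"
      using less[OF _ mem(1), of "\<tau> i"] less[OF _ mem(2), of "\<sigma> i"]
      by (cases "y (\<sigma> i)" "y (\<tau> i)" rule: linorder_cases) auto
    moreover obtain a where a: "a \<in> I" "\<tau> i = \<sigma> a" using mem(2) permutes_image[OF perm(1)] by blast
    ultimately have "y (\<sigma> i) = y (\<sigma> a)" by simp
    then have "x i = x a"
      using \<sigma>[OF True a(1)] \<sigma>[OF a(1) True] by (cases "x i" "x a" rule: linorder_cases) auto
    then show ?thesis using inj_onD[OF x _ True a(1)] a(2) by simp
  next
    case False
    then show ?thesis using perm by (simp add: permutes_def)
  qed
qed

section \<open>Uniform input makes all histories equally likely\<close>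

abbreviation unif :: "real measure" where
  "unif \<equiv> uniform_measure lborel {0..1}"

text \<open>
  The input of the search tree: independent random variables with the uniform distribution, indexed
  from 1.
\<close>

locale uniform_input = prob_space M for M :: "'a measure" +
  fixes \<xi> :: "nat \<Rightarrow> 'a \<Rightarrow> real"
  assumes indep: "indep_vars (\<lambda>_. borel) \<xi> {1..}"
    and distr_\<xi>: "n \<ge> 1 \<Longrightarrow> distr M borel (\<xi> n) = unif"
begin

definition random_history :: "nat \<Rightarrow> 'a \<Rightarrow> node list" where
  "random_history n \<omega> = history (\<lambda>i. \<xi> i \<omega>) n"

lemma measurable_\<xi> [measurable]: "\<xi> (Suc n) \<in> borel_measurable M"
  using indep by (auto simp: indep_vars_def)

lemma measurable_\<xi>': "n \<ge> 1 \<Longrightarrow> \<xi> n \<in> borel_measurable M"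
  using indep by (auto simp: indep_vars_def)

lemma measurable_relabel:
  "(\<lambda>\<omega>. the (relabel l (\<lambda>i. \<xi> i \<omega>) w)) \<in> borel_measurable M"
proof (induction l)
  case (Cons u l)
  then show ?case by (cases "w = u") auto
qed simp

lemma measurable_exit_node:
  "(\<lambda>\<omega>. exit_node (relabel l (\<lambda>i. \<xi> i \<omega>)) (\<xi> (Suc n) \<omega>)) \<in> measurable M (count_space UNIV)"
proof -
  have path [measurable]: "(\<lambda>\<omega>. search_path (relabel l (\<lambda>i. \<xi> i \<omega>)) (\<xi> (Suc n) \<omega>) k) \<in> measurable M (count_space UNIV)"
    for k
  proof (induction k)
    case (Suc k)
    have "(\<lambda>\<omega>. w @ [the (relabel l (\<lambda>i. \<xi> i \<omega>) w) < \<xi> (Suc n) \<omega>]) \<in> measurable M (count_space UNIV)" for w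
    proof -
      have [measurable]: "Measurable.pred M (\<lambda>\<omega>. the (relabel l (\<lambda>i. \<xi> i \<omega>) w) < \<xi> (Suc n) \<omega>)"
        using measurable_relabel[of l w] by measurable
      show ?thesis by measurable
    qed
    from measurable_compose_countable[OF this Suc] show ?case by simp
  qed simp
  have "(\<lambda>\<omega>. LEAST k. search_path (relabel l (\<lambda>i. \<xi> i \<omega>)) (\<xi> (Suc n) \<omega>) k \<notin> set l) \<in> measurable M (count_space UNIV)"
    by measurable
  from measurable_compose_countable[OF path this] show ?thesis
    unfolding exit_node_def dom_relabel by simp
qed

lemma measurable_random_history [measurable]: "random_history n \<in> measurable M (count_space UNIV)"
proof (induction n)
  case (Suc n)
  have "(\<lambda>\<omega>. exit_node (relabel l (\<lambda>i. \<xi> i \<omega>)) (\<xi> (Suc n) \<omega>) # l) \<in> measurable M (count_space UNIV)" for l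
    by (rule measurable_compose[OF measurable_exit_node]) simp
  from measurable_compose_countable[OF this Suc] show ?case
    by (simp add: random_history_def bst_labelling_eq_relabel[abs_def] cong: measurable_cong)
qed (simp add: random_history_def[abs_def])

lemma AE_\<xi>_neq:
  assumes "i \<ge> 1" "j \<ge> 1" "i \<noteq> j"
  shows "AE \<omega> in M. \<xi> i \<omega> \<noteq> \<xi> j \<omega>"
proof -
  have "indep_var borel (\<xi> i) borel (\<xi> j)"
  proof -
    have "indep_var borel ((\<lambda>f. f i) \<circ> (\<lambda>\<omega>. restrict (\<lambda>i. \<xi> i \<omega>) {i}))
        borel ((\<lambda>f. f j) \<circ> (\<lambda>\<omega>. restrict (\<lambda>i. \<xi> i \<omega>) {j}))"
      using assms by (intro indep_var_compose[OF indep_var_restrict[OF indep]] measurable_component_singleton) auto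
    then show ?thesis by (simp add: comp_def)
  qed
  then have D: "distr M (borel \<Otimes>\<^sub>M borel) (\<lambda>\<omega>. (\<xi> i \<omega>, \<xi> j \<omega>)) = unif \<Otimes>\<^sub>M unif"
    using assms distr_\<xi> by (subst (asm) indep_var_distribution_eq) auto
  interpret U: prob_space unif by (rule prob_space_uniform_measure) auto
  interpret UU: pair_prob_space unif unif ..
  have "AE p in unif \<Otimes>\<^sub>M unif. fst p \<noteq> snd p"
  proof (subst UU.AE_pair_iff[symmetric])
    show "AE x in unif. AE y in unif. x \<noteq> y"
    proof (rule AE_I2, rule AE_uniform_measureI)
      fix x :: real
      show "AE y in lborel. y \<in> {0..1} \<longrightarrow> x \<noteq> y"
        using AE_lborel_singleton[of x] by eventually_elim auto
    qed auto
  qed measurable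
  then have "AE p in distr M (borel \<Otimes>\<^sub>M borel) (\<lambda>\<omega>. (\<xi> i \<omega>, \<xi> j \<omega>)). fst p \<noteq> snd p"
    unfolding D .
  then show ?thesis
    using measurable_\<xi>'[OF assms(1)] measurable_\<xi>'[OF assms(2)]
    by (subst (asm) AE_distr_iff) auto
qed

lemma exchangeable:
  assumes "finite I" "I \<subseteq> {1..}" "\<sigma> permutes I" and B: "B \<in> sets (PiM I (\<lambda>_. borel))"
  shows "prob {\<omega> \<in> space M. (\<lambda>i\<in>I. \<xi> (\<sigma> i) \<omega>) \<in> B} = prob {\<omega> \<in> space M. (\<lambda>i\<in>I. \<xi> i \<omega>) \<in> B}"
proof (cases "I = {}")
  case False
  let ?U = "PiM I (\<lambda>_. unif)"
  have meas: "(\<lambda>\<omega>. \<lambda>i\<in>I. \<xi> i \<omega>) \<in> measurable M (PiM I (\<lambda>_. borel))"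
    using assms(2) by (intro measurable_restrict measurable_\<xi>') auto
  have \<sigma>: "\<sigma> i \<in> I" if "i \<in> I" for i using that assms(3) by (simp add: permutes_in_image)
  have D: "distr M (PiM I (\<lambda>_. borel)) (\<lambda>\<omega>. \<lambda>i\<in>I. \<xi> i \<omega>) = ?U"
    using indep_vars_subset[OF indep assms(2)] False assms(2) measurable_\<xi>'
    by (subst (asm) indep_vars_iff_distr_eq_PiM') (auto intro!: PiM_cong simp: distr_\<xi>)
  have sets: "sets ?U = sets (PiM I (\<lambda>_. borel))" by (intro sets_PiM_cong) auto
  have reindex: "distr ?U ?U (\<lambda>\<omega>. \<lambda>i\<in>I. \<omega> (\<sigma> i)) = ?U"
    by (rule distr_PiM_reindex[of I "\<lambda>_. unif" \<sigma> I])
       (use \<sigma> assms(3) in \<open>auto intro!: prob_space_uniform_measure simp: permutes_inj_on\<close>)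
  have reindex_meas: "(\<lambda>\<omega>. \<lambda>i\<in>I. \<omega> (\<sigma> i)) \<in> measurable ?U ?U"
    using \<sigma> by (intro measurable_restrict measurable_component_singleton)
  have "prob {\<omega> \<in> space M. (\<lambda>i\<in>I. \<xi> i \<omega>) \<in> B} = measure ?U B"
    unfolding D[symmetric] using meas B by (subst measure_distr) (auto intro!: arg_cong[where f = prob])
  also have "\<dots> = measure (distr ?U ?U (\<lambda>\<omega>. \<lambda>i\<in>I. \<omega> (\<sigma> i))) B" by (simp only: reindex)
  also have "\<dots> = measure ?U ((\<lambda>\<omega>. \<lambda>i\<in>I. \<omega> (\<sigma> i)) -` B \<inter> space ?U)"
    using reindex_meas B sets by (subst measure_distr) auto
  also have "\<dots> = prob ((\<lambda>\<omega>. \<lambda>i\<in>I. \<xi> i \<omega>) -` ((\<lambda>\<omega>. \<lambda>i\<in>I. \<omega> (\<sigma> i)) -` B \<inter> space ?U) \<inter> space M)"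
  proof -
    have "(\<lambda>\<omega>. \<lambda>i\<in>I. \<omega> (\<sigma> i)) -` B \<inter> space ?U \<in> sets (PiM I (\<lambda>_. borel))"
      using measurable_sets[OF reindex_meas] B sets by simp
    then show ?thesis using D meas by (metis measure_distr)
  qed
  also have "(\<lambda>\<omega>. \<lambda>i\<in>I. \<xi> i \<omega>) -` ((\<lambda>\<omega>. \<lambda>i\<in>I. \<omega> (\<sigma> i)) -` B \<inter> space ?U) \<inter> space M
      = {\<omega> \<in> space M. (\<lambda>i\<in>I. \<xi> (\<sigma> i) \<omega>) \<in> B}"
    using \<sigma> by (auto simp: space_PiM cong: restrict_cong)
  finally show ?thesis ..
qed (simp add: restrict_def)

text \<open>
  The history \<open>l\<close> determines the order of the input. Since the input is exchangeable, all \<open>fact n\<close>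
  orders have the same probability, and these probabilities add up to at most 1.
\<close>

lemma prob_random_history_le: "prob {\<omega> \<in> space M. random_history n \<omega> = l} \<le> 1 / fact n"
proof -
  define I where "I = {1..n}"
  have I: "finite I" "I \<subseteq> {1..}" by (auto simp: I_def)
  have AE: "AE \<omega> in M. inj_on (\<lambda>i. \<xi> i \<omega>) I"
  proof -
    have "AE \<omega> in M. \<forall>i\<in>I. \<forall>j\<in>I. i \<noteq> j \<longrightarrow> \<xi> i \<omega> \<noteq> \<xi> j \<omega>"
      using I AE_\<xi>_neq by (intro AE_finite_allI) (auto simp: subset_eq)
    then show ?thesis by eventually_elim (auto simp: inj_on_def)
  qed
  show ?thesis
  proof (cases "\<exists>\<omega>\<in>space M. random_history n \<omega> = l \<and> inj_on (\<lambda>i. \<xi> i \<omega>) I")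
    case False
    have "AE \<omega> in M. random_history n \<omega> \<noteq> l"
      using AE AE_space by eventually_elim (use False in auto)
    then have "prob {\<omega> \<in> space M. random_history n \<omega> = l} = 0"
      by (intro prob_eq_0_AE) auto
    then show ?thesis by simp
  next
    case True
    \<comment> \<open>a single realization of the history fixes the order of the input\<close>
    then obtain \<omega>\<^sub>0 where \<omega>\<^sub>0: "random_history n \<omega>\<^sub>0 = l" "inj_on (\<lambda>i. \<xi> i \<omega>\<^sub>0) I" by blast
    define x where "x i = \<xi> i \<omega>\<^sub>0" for i
    define B where "B = {y \<in> space (PiM I (\<lambda>_. borel)). \<forall>i\<in>I. \<forall>j\<in>I. x i < x j \<longrightarrow> y i < (y j :: real)}"
    define E where "E \<sigma> = {\<omega> \<in> space M. (\<lambda>i\<in>I. \<xi> (\<sigma> i) \<omega>) \<in> B}" for \<sigma>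
    have B: "B \<in> sets (PiM I (\<lambda>_. borel))" unfolding B_def using I(1) by measurable
    have EI: "\<omega> \<in> E \<sigma> \<longleftrightarrow> \<omega> \<in> space M \<and> (\<forall>i\<in>I. \<forall>j\<in>I. x i < x j \<longrightarrow> \<xi> (\<sigma> i) \<omega> < \<xi> (\<sigma> j) \<omega>)" for \<omega> \<sigma>
      by (auto simp: E_def B_def space_PiM)
    have E: "E \<sigma> \<in> events" if "\<sigma> permutes I" for \<sigma>
    proof -
      have "(\<lambda>\<omega>. \<lambda>i\<in>I. \<xi> (\<sigma> i) \<omega>) \<in> measurable M (PiM I (\<lambda>_. borel))"
        using I(2) that by (intro measurable_restrict measurable_\<xi>') (auto dest: permutes_in_image)
      from measurable_sets[OF this B] show ?thesis unfolding E_def by (simp add: vimage_def Int_def conj_commute)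
    qed
    have "AE \<omega> in M. random_history n \<omega> = l \<longrightarrow> \<omega> \<in> E id"
      using AE AE_space
    proof eventually_elim
      fix \<omega> assume \<omega>: "inj_on (\<lambda>i. \<xi> i \<omega>) I" "\<omega> \<in> space M"
      show "random_history n \<omega> = l \<longrightarrow> \<omega> \<in> E id"
      proof
        assume l: "random_history n \<omega> = l"
        have "\<xi> i \<omega> < \<xi> j \<omega>" if "i \<in> I" "j \<in> I" "x i < x j" for i j
        proof -
          have "\<xi> i \<omega> \<le> \<xi> j \<omega>"
            using history_eq_imp_le[of x n "\<lambda>i. \<xi> i \<omega>" i j] that l \<omega>\<^sub>0(1)
            by (simp add: I_def random_history_def x_def[abs_def])
          moreover have "\<xi> i \<omega> \<noteq> \<xi> j \<omega>" using inj_onD[OF \<omega>(1) _ that(1,2)] that(3) by auto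
          ultimately show ?thesis by simp
        qed
        then show "\<omega> \<in> E id" using \<omega>(2) by (simp add: EI)
      qed
    qed
    then have "prob {\<omega> \<in> space M. random_history n \<omega> = l} \<le> prob (E id)"
      using E[OF permutes_id] by (intro finite_measure_mono_AE) auto
    also have "fact n * prob (E id) = (\<Sum>\<sigma> | \<sigma> permutes I. prob (E \<sigma>))"
      using exchangeable[OF I _ B] I(1)
      by (simp add: E_def card_permutations[OF refl] I_def)
    also have "\<dots> = prob (\<Union>\<sigma>\<in>{\<sigma>. \<sigma> permutes I}. E \<sigma>)"
    proof (rule finite_measure_finite_Union[symmetric])
      show "disjoint_family_on E {\<sigma>. \<sigma> permutes I}"
        unfolding disjoint_family_on_def
      proof (intro ballI impI)
        fix \<sigma> \<tau> assume st: "\<sigma> \<in> {\<sigma>. \<sigma> permutes I}" "\<tau> \<in> {\<sigma>. \<sigma> permutes I}" "\<sigma> \<noteq> \<tau>"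
        show "E \<sigma> \<inter> E \<tau> = {}"
        proof (rule ccontr)
          assume "E \<sigma> \<inter> E \<tau> \<noteq> {}"
          then obtain \<omega> where "\<omega> \<in> E \<sigma>" "\<omega> \<in> E \<tau>" by blast
          then have "\<sigma> = \<tau>"
            using st I(1) \<omega>\<^sub>0(2)
            by (intro order_pattern_unique[of I x \<sigma> \<tau> "\<lambda>i. \<xi> i \<omega>"]) (auto simp: EI x_def[abs_def])
          then show False using st by blast
        qed
      qed
    qed (use I(1) E in \<open>auto simp: finite_permutations\<close>)
    also have "\<dots> \<le> 1" by (rule prob_le_1)
    finally show ?thesis by (simp add: field_simps)
  qed
qed

text \<open>
  There are \<open>fact n\<close> histories, so equality holds in the bound for each of them.
\<close>

lemma prob_random_history:
  assumes "l \<in> histories n"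
  shows "prob {\<omega> \<in> space M. random_history n \<omega> = l} = 1 / fact n"
proof -
  let ?p = "\<lambda>l. prob {\<omega> \<in> space M. random_history n \<omega> = l}"
  have "(\<Sum>l\<in>histories n. ?p l) = prob (\<Union>l\<in>histories n. {\<omega> \<in> space M. random_history n \<omega> = l})"
    by (intro finite_measure_finite_Union[symmetric]) (auto simp: disjoint_family_on_def finite_histories)
  also have "(\<Union>l\<in>histories n. {\<omega> \<in> space M. random_history n \<omega> = l}) = space M"
    using history_in_histories by (auto simp: random_history_def)
  finally have "(\<Sum>l\<in>histories n. 1 / fact n - ?p l) = 0"
    by (simp add: sum_subtractf card_histories prob_space)
  then have "1 / fact n - ?p l = 0"
    using assms prob_random_history_le[of n] by (subst (asm) sum_nonneg_eq_0_iff) (auto simp: finite_histories)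
  then show ?thesis by simp
qed

lemma expectation_random_history:
  "expectation (\<lambda>\<omega>. g (random_history n \<omega>)) = mean n g"
proof -
  have "expectation (\<lambda>\<omega>. g (random_history n \<omega>)) =
      expectation (\<lambda>\<omega>. \<Sum>l\<in>histories n. g l * indicator {\<omega> \<in> space M. random_history n \<omega> = l} \<omega>)"
  proof (rule Bochner_Integration.integral_cong)
    fix \<omega> assume "\<omega> \<in> space M"
    moreover have "random_history n \<omega> \<in> histories n" by (simp add: random_history_def history_in_histories)
    ultimately show "g (random_history n \<omega>) =
        (\<Sum>l\<in>histories n. g l * indicator {\<omega> \<in> space M. random_history n \<omega> = l} \<omega>)"
      by (subst sum.remove[of _ "random_history n \<omega>"]) (auto simp: finite_histories indicator_def intro!: sum.neutral)
  qed simp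
  also have "\<dots> = (\<Sum>l\<in>histories n. g l * prob {\<omega> \<in> space M. random_history n \<omega> = l})"
    by (subst Bochner_Integration.integral_sum) (auto intro!: integrable_real_indicator simp: less_top[symmetric])
  also have "\<dots> = mean n g"
    by (simp add: prob_random_history mean_def sum_divide_distrib)
  finally show ?thesis .
qed

lemma integrable_random_history: "integrable M (\<lambda>\<omega>. g (random_history n \<omega>) :: real)"
proof (rule integrable_const_bound)
  have "\<bar>g (random_history n \<omega>)\<bar> \<le> (\<Sum>l\<in>histories n. \<bar>g l\<bar>)" for \<omega>
    by (intro member_le_sum) (auto simp: finite_histories random_history_def history_in_histories)
  then show "AE \<omega> in M. norm (g (random_history n \<omega>)) \<le> (\<Sum>l\<in>histories n. \<bar>g l\<bar>)" by simp
qed measurable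

end

section \<open>Convergence in mean square\<close>

lemma borel_measurable_fst:
  fixes X :: "'a \<Rightarrow> 'b :: second_countable_topology \<times> 'c :: second_countable_topology"
  shows "X \<in> borel_measurable M \<Longrightarrow> (\<lambda>\<omega>. fst (X \<omega>)) \<in> borel_measurable M"
  by (rule measurable_compose[OF _ borel_measurable_continuous_onI]) (auto intro: continuous_intros)

lemma borel_measurable_snd:
  fixes X :: "'a \<Rightarrow> 'b :: second_countable_topology \<times> 'c :: second_countable_topology"
  shows "X \<in> borel_measurable M \<Longrightarrow> (\<lambda>\<omega>. snd (X \<omega>)) \<in> borel_measurable M"
  by (rule measurable_compose[OF _ borel_measurable_continuous_onI]) (auto intro: continuous_intros)

lemma (in prob_space) expectation_le_sqrt:
  fixes X :: "'a \<Rightarrow> real"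
  assumes "integrable M X" "integrable M (\<lambda>\<omega>. (X \<omega>)\<^sup>2)"
  shows "expectation X \<le> sqrt (expectation (\<lambda>\<omega>. (X \<omega>)\<^sup>2))"
  using variance_eq[OF assms] variance_positive[of X] by (intro real_le_rsqrt) simp

lemma (in prob_space) integrable_square_imp_integrable:
  fixes X :: "'a \<Rightarrow> real"
  assumes "X \<in> borel_measurable M" "integrable M (\<lambda>\<omega>. (X \<omega>)\<^sup>2)"
  shows "integrable M X"
proof (rule Bochner_Integration.integrable_bound)
  show "integrable M (\<lambda>\<omega>. 1 + (X \<omega>)\<^sup>2)" using assms by simp
  have "\<bar>x\<bar> \<le> 1 + x\<^sup>2" for x :: real
    using sum_squares_ge_zero[of "\<bar>x\<bar> - 1" 0] power2_abs[of x]
    by (simp add: power2_eq_square algebra_simps)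
  then show "AE \<omega> in M. norm (X \<omega>) \<le> norm (1 + (X \<omega>)\<^sup>2)" by (intro AE_I2) (smt (verit) real_norm_def)
qed fact

text \<open>
  A sequence whose mean square increments are dominated by the increments of a convergent real
  sequence converges in mean square.
\<close>

lemma (in prob_space) mean_square_limit:
  fixes Z :: "nat \<Rightarrow> 'a \<Rightarrow> 's :: {banach, second_countable_topology}"
  assumes meas [measurable]: "\<And>n. Z n \<in> borel_measurable M"
    and a: "incseq a" "a \<longlonglongrightarrow> A"
    and int: "\<And>n m. n \<le> m \<Longrightarrow> integrable M (\<lambda>\<omega>. (norm (Z m \<omega> - Z n \<omega>))\<^sup>2)"
    and le: "\<And>n m. n \<le> m \<Longrightarrow> expectation (\<lambda>\<omega>. (norm (Z m \<omega> - Z n \<omega>))\<^sup>2) \<le> a m - a n"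
  obtains Y where "Y \<in> borel_measurable M"
    "\<And>n. integrable M (\<lambda>\<omega>. (norm (Z n \<omega> - Y \<omega>))\<^sup>2)"
    "\<And>n. expectation (\<lambda>\<omega>. (norm (Z n \<omega> - Y \<omega>))\<^sup>2) \<le> A - a n"
proof -
  have aA: "a n \<le> A" for n using a by (rule incseq_le)
  have le': "(\<integral>\<^sup>+\<omega>. ennreal ((norm (Z m \<omega> - Z n \<omega>))\<^sup>2) \<partial>M) \<le> ennreal (A - a n)" if "n \<le> m" for n m
  proof -
    have "(\<integral>\<^sup>+\<omega>. ennreal ((norm (Z m \<omega> - Z n \<omega>))\<^sup>2) \<partial>M) = ennreal (expectation (\<lambda>\<omega>. (norm (Z m \<omega> - Z n \<omega>))\<^sup>2))"
      using int[OF that] by (intro nn_integral_eq_integral) auto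
    also have "\<dots> \<le> ennreal (A - a n)" using le[OF that] aA[of m] by (intro ennreal_leI) simp
    finally show ?thesis .
  qed
  \<comment> \<open>a subsequence with summable increments converges almost surely\<close>
  have "\<exists>r. \<forall>n. A - a (r n) \<le> (1 / 4) ^ n \<and> r n < r (Suc n)"
  proof (rule dependent_nat_choice)
    have ev: "\<forall>\<^sub>F j in sequentially. A - a j \<le> (1 / 4) ^ n" for n
    proof -
      have "\<forall>\<^sub>F j in sequentially. a j > A - (1 / 4) ^ n" using a(2) by (rule order_tendstoD) simp
      then show ?thesis by eventually_elim simp
    qed
    show "\<exists>j. A - a j \<le> (1 / 4) ^ 0" using eventually_happens[OF ev[of 0]] by simp
    show "\<exists>j. A - a j \<le> (1 / 4) ^ Suc n \<and> i < j" for i n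
      using eventually_happens[OF eventually_conj[OF ev[of "Suc n"] eventually_gt_at_top[of i]]] by (simp del: power_Suc)
  qed
  then obtain r where r: "\<And>n. A - a (r n) \<le> (1 / 4) ^ n" "\<And>n. r n < r (Suc n)" by blast
  have mono: "strict_mono r" using r(2) by (simp add: strict_mono_Suc_iff)
  define t where "t k \<omega> = norm (Z (r (Suc k)) \<omega> - Z (r k) \<omega>)" for k \<omega>
  have "(\<integral>\<^sup>+\<omega>. (\<Sum>k. ennreal (2 ^ k * (t k \<omega>)\<^sup>2)) \<partial>M) = (\<Sum>k. \<integral>\<^sup>+\<omega>. ennreal (2 ^ k * (t k \<omega>)\<^sup>2) \<partial>M)"
    unfolding t_def by (rule nn_integral_suminf) measurable
  also have "\<dots> \<le> (\<Sum>k. ennreal ((1 / 2) ^ k))"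
  proof (rule suminf_le)
    fix k
    have "(\<integral>\<^sup>+\<omega>. ennreal (2 ^ k * (t k \<omega>)\<^sup>2) \<partial>M) = ennreal (2 ^ k) * (\<integral>\<^sup>+\<omega>. ennreal ((t k \<omega>)\<^sup>2) \<partial>M)"
      unfolding t_def by (subst nn_integral_cmult[symmetric]) (auto simp: ennreal_mult)
    also have "\<dots> \<le> ennreal (2 ^ k) * ennreal ((1 / 4) ^ k)"
      unfolding t_def using r(1)[of k] less_imp_le[OF r(2)[of k]]
      by (intro mult_left_mono order_trans[OF le'] ennreal_leI) auto
    also have "\<dots> = ennreal ((1 / 2) ^ k)"
      by (simp add: ennreal_mult[symmetric] power_mult_distrib[symmetric])
    finally show "(\<integral>\<^sup>+\<omega>. ennreal (2 ^ k * (t k \<omega>)\<^sup>2) \<partial>M) \<le> ennreal ((1 / 2) ^ k)" .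
  qed auto
  also have "\<dots> = ennreal (\<Sum>k. (1 / 2) ^ k)"
    by (intro suminf_ennreal2) auto
  also have "\<dots> < \<infinity>" by simp
  finally have "AE \<omega> in M. (\<Sum>k. ennreal (2 ^ k * (t k \<omega>)\<^sup>2)) \<noteq> \<infinity>"
    unfolding t_def by (intro nn_integral_noteq_infinite) auto
  then have conv: "AE \<omega> in M. convergent (\<lambda>k. Z (r k) \<omega>)"
  proof eventually_elim
    fix \<omega> assume "(\<Sum>k. ennreal (2 ^ k * (t k \<omega>)\<^sup>2)) \<noteq> \<infinity>"
    then have "summable (\<lambda>k. 2 ^ k * (t k \<omega>)\<^sup>2)" by (intro summable_suminf_not_top) auto
    then have "summable (\<lambda>k. (1 / 2) ^ k + 2 ^ k * (t k \<omega>)\<^sup>2)" by (intro summable_add) auto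
    then have "summable (\<lambda>k. t k \<omega>)"
    proof (rule summable_comparison_test[rotated], intro exI allI impI)
      fix k :: nat
      have "x \<le> c + x\<^sup>2 / c" if "c > 0" "x \<ge> 0" for c x :: real
      proof (cases "x \<le> c")
        case True
        then show ?thesis using that by (intro add_increasing2) auto
      next
        case False
        then have "x * c \<le> x * x" using that by (intro mult_left_mono) auto
        then have "x \<le> x\<^sup>2 / c" using that by (simp add: field_simps power2_eq_square)
        then show ?thesis using that by simp
      qed
      from this[of "(1 / 2) ^ k" "t k \<omega>"] show "norm (t k \<omega>) \<le> (1 / 2) ^ k + 2 ^ k * (t k \<omega>)\<^sup>2"
        by (simp add: t_def field_simps power_divide)
    qed
    then have "summable (\<lambda>k. Z (r (Suc k)) \<omega> - Z (r k) \<omega>)"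
      unfolding t_def by (rule summable_norm_cancel)
    then have "convergent (\<lambda>n. Z (r n) \<omega> - Z (r 0) \<omega>)"
      unfolding summable_iff_convergent sum_lessThan_telescope[of "\<lambda>k. Z (r k) \<omega>"] .
    then have "convergent (\<lambda>n. (Z (r n) \<omega> - Z (r 0) \<omega>) + Z (r 0) \<omega>)"
      by (intro convergent_add convergent_const)
    then show "convergent (\<lambda>k. Z (r k) \<omega>)" by simp
  qed
  define Y where "Y \<omega> = lim (\<lambda>k. Z (r k) \<omega>)" for \<omega>
  have Y [measurable]: "Y \<in> borel_measurable M" unfolding Y_def by measurable
  \<comment> \<open>Fatou's lemma along the subsequence\<close>
  have nn: "(\<integral>\<^sup>+\<omega>. ennreal ((norm (Z n \<omega> - Y \<omega>))\<^sup>2) \<partial>M) \<le> ennreal (A - a n)" for n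
  proof -
    have "(\<integral>\<^sup>+\<omega>. ennreal ((norm (Z n \<omega> - Y \<omega>))\<^sup>2) \<partial>M) =
        (\<integral>\<^sup>+\<omega>. liminf (\<lambda>k. ennreal ((norm (Z (r k) \<omega> - Z n \<omega>))\<^sup>2)) \<partial>M)"
    proof (rule nn_integral_cong_AE)
      show "AE \<omega> in M. ennreal ((norm (Z n \<omega> - Y \<omega>))\<^sup>2) = liminf (\<lambda>k. ennreal ((norm (Z (r k) \<omega> - Z n \<omega>))\<^sup>2))"
        using conv
      proof eventually_elim
        fix \<omega> assume "convergent (\<lambda>k. Z (r k) \<omega>)"
        then have "(\<lambda>k. Z (r k) \<omega>) \<longlonglongrightarrow> Y \<omega>" unfolding Y_def by (simp add: convergent_LIMSEQ_iff)
        then have "(\<lambda>k. ennreal ((norm (Z (r k) \<omega> - Z n \<omega>))\<^sup>2)) \<longlonglongrightarrow> ennreal ((norm (Y \<omega> - Z n \<omega>))\<^sup>2)"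
          by (intro tendsto_intros)
        then have "liminf (\<lambda>k. ennreal ((norm (Z (r k) \<omega> - Z n \<omega>))\<^sup>2)) = ennreal ((norm (Y \<omega> - Z n \<omega>))\<^sup>2)"
          by (rule lim_imp_Liminf[OF sequentially_bot])
        then show "ennreal ((norm (Z n \<omega> - Y \<omega>))\<^sup>2) = liminf (\<lambda>k. ennreal ((norm (Z (r k) \<omega> - Z n \<omega>))\<^sup>2))"
          by (simp only: norm_minus_commute[of "Z n \<omega>" "Y \<omega>"])
      qed
    qed
    also have "\<dots> \<le> liminf (\<lambda>k. \<integral>\<^sup>+\<omega>. ennreal ((norm (Z (r k) \<omega> - Z n \<omega>))\<^sup>2) \<partial>M)"
      by (rule nn_integral_liminf) measurable
    also have "\<dots> \<le> ennreal (A - a n)"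
    proof (rule Liminf_le)
      show "\<forall>\<^sub>F k in sequentially. (\<integral>\<^sup>+\<omega>. ennreal ((norm (Z (r k) \<omega> - Z n \<omega>))\<^sup>2) \<partial>M) \<le> ennreal (A - a n)"
        using eventually_ge_at_top[of n] by eventually_elim (use seq_suble[OF mono] in \<open>blast intro: le' order_trans\<close>)
    qed simp
    finally show ?thesis .
  qed
  have intY: "integrable M (\<lambda>\<omega>. (norm (Z n \<omega> - Y \<omega>))\<^sup>2)" for n
    using nn[of n] by (intro integrableI_nonneg) (auto simp: le_less_trans)
  moreover have "expectation (\<lambda>\<omega>. (norm (Z n \<omega> - Y \<omega>))\<^sup>2) \<le> A - a n" for n
    using nn[of n] aA[of n] by (subst (asm) nn_integral_eq_integral[OF intY]) (auto simp: ennreal_le_iff)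
  ultimately show ?thesis using that Y by blast
qed

text \<open>Convergence in mean implies convergence in distribution.\<close>

lemma (in prob_space) tendsto_expectation_bounded_continuous:
  fixes X :: "nat \<Rightarrow> 'a \<Rightarrow> 's :: {banach, second_countable_topology}" and g :: "'s \<Rightarrow> real"
  assumes [measurable]: "\<And>n. X n \<in> borel_measurable M" "Y \<in> borel_measurable M"
    and int: "\<And>n. integrable M (\<lambda>\<omega>. X n \<omega> - Y \<omega>)"
    and lim: "(\<lambda>n. expectation (\<lambda>\<omega>. norm (X n \<omega> - Y \<omega>))) \<longlonglongrightarrow> 0"
    and g: "continuous_on UNIV g" "bounded (range g)"
  shows "(\<lambda>n. expectation (\<lambda>\<omega>. g (X n \<omega>))) \<longlonglongrightarrow> expectation (\<lambda>\<omega>. g (Y \<omega>))"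
proof (rule ccontr)
  let ?f = "\<lambda>n. expectation (\<lambda>\<omega>. g (X n \<omega>))"
  let ?l = "expectation (\<lambda>\<omega>. g (Y \<omega>))"
  have gm [measurable]: "g \<in> borel_measurable borel" using g(1) by (rule borel_measurable_continuous_onI)
  obtain b where b: "\<And>z. norm (g z) \<le> b" using g(2) by (auto simp: bounded_iff)
  assume "\<not> ?f \<longlonglongrightarrow> ?l"
  then obtain e where e: "e > 0" "\<exists>\<^sub>F n in sequentially. \<not> dist (?f n) ?l < e"
    unfolding tendsto_iff by (auto simp: not_eventually)
  then have inf: "infinite {n. \<not> dist (?f n) ?l < e}"
    unfolding cofinite_eq_sequentially[symmetric] frequently_cofinite by blast
  define s where "s = enumerate {n. \<not> dist (?f n) ?l < e}"
  have s: "strict_mono s" "\<And>n. \<not> dist (?f (s n)) ?l < e"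
    unfolding s_def using strict_mono_enumerate[OF inf] enumerate_in_set[OF inf] by auto
  have "(\<lambda>n. expectation (\<lambda>\<omega>. norm (X (s n) \<omega> - Y \<omega>))) \<longlonglongrightarrow> 0"
    using LIMSEQ_subseq_LIMSEQ[OF lim s(1)] by (simp add: comp_def)
  from tendsto_L1_AE_subseq[OF int this] obtain r :: "nat \<Rightarrow> nat" where r: "strict_mono r"
    "AE \<omega> in M. (\<lambda>n. X (s (r n)) \<omega> - Y \<omega>) \<longlonglongrightarrow> 0" by blast
  have "(\<lambda>n. ?f (s (r n))) \<longlonglongrightarrow> ?l"
  proof (rule integral_dominated_convergence[where w = "\<lambda>_. b"])
    show "AE \<omega> in M. (\<lambda>n. g (X (s (r n)) \<omega>)) \<longlonglongrightarrow> g (Y \<omega>)"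
      using r(2)
    proof eventually_elim
      fix \<omega> assume "(\<lambda>n. X (s (r n)) \<omega> - Y \<omega>) \<longlonglongrightarrow> 0"
      then have "(\<lambda>n. X (s (r n)) \<omega>) \<longlonglongrightarrow> Y \<omega>" by (rule LIM_zero_cancel)
      then show "(\<lambda>n. g (X (s (r n)) \<omega>)) \<longlonglongrightarrow> g (Y \<omega>)"
        by (intro continuous_on_tendsto_compose[OF g(1)]) auto
    qed
  qed (use b in auto)
  then have "\<forall>\<^sub>F n in sequentially. dist (?f (s (r n))) ?l < e" using e(1) by (rule tendstoD)
  then obtain n where "dist (?f (s (r n))) ?l < e" using eventually_happens'[OF sequentially_bot] by blast
  then show False using s(2) by blast
qed

section \<open>The limit of the standardized trees\<close>

lemma standardized_empty: "standardized {} = 0"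
  by (auto simp: standardized_def centered_int_silhouette_def centered_eta_def harm_def zero_prod_def zero_c00_def)

context uniform_input
begin

text \<open>
  The standardized search tree for the first \<open>n\<close> inputs.
\<close>

definition std_tree :: "nat \<Rightarrow> 'a \<Rightarrow> c00 \<times> real" where
  "std_tree n \<omega> = standardized (set (random_history n \<omega>))"

lemma measurable_std_tree [measurable]: "std_tree n \<in> borel_measurable M"
  unfolding std_tree_def by (rule measurable_compose[OF measurable_random_history]) simp

lemma drop_random_history: "drop k (random_history (n + k) \<omega>) = random_history n \<omega>"
  by (induction k) (auto simp: random_history_def)

lemma std_tree_0: "std_tree 0 \<omega> = 0"
  by (simp add: std_tree_def random_history_def standardized_empty)

lemma integrable_std_tree_diff_square: "n \<le> m \<Longrightarrow> integrable M (\<lambda>\<omega>. (norm (std_tree m \<omega> - std_tree n \<omega>))\<^sup>2)"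
  and expectation_std_tree_diff_square:
    "n \<le> m \<Longrightarrow> expectation (\<lambda>\<omega>. (norm (std_tree m \<omega> - std_tree n \<omega>))\<^sup>2) \<le> 5 / 2 * (total_weight m - total_weight n)"
proof -
  assume "n \<le> m"
  then obtain k where m: "m = n + k" by (auto simp: le_iff_add)
  define G where "G l = (norm (standardized (set l) - standardized (set (drop k l))))\<^sup>2" for l
  have eq: "(norm (std_tree m \<omega> - std_tree n \<omega>))\<^sup>2 = G (random_history (n + k) \<omega>)" for \<omega>
    by (simp add: std_tree_def G_def m drop_random_history)
  show "integrable M (\<lambda>\<omega>. (norm (std_tree m \<omega> - std_tree n \<omega>))\<^sup>2)"
    unfolding eq by (rule integrable_random_history)
  show "expectation (\<lambda>\<omega>. (norm (std_tree m \<omega> - std_tree n \<omega>))\<^sup>2) \<le> 5 / 2 * (total_weight m - total_weight n)"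
    unfolding eq expectation_random_history unfolding G_def m by (rule mean_standardized_diff_square)
qed

lemma ex_mean_limit:
  obtains Y where "Y \<in> borel_measurable M" "integrable M (\<lambda>\<omega>. (norm (Y \<omega>))\<^sup>2)"
    "\<And>n. integrable M (\<lambda>\<omega>. std_tree n \<omega> - Y \<omega>)"
    "(\<lambda>n. expectation (\<lambda>\<omega>. norm (std_tree n \<omega> - Y \<omega>))) \<longlonglongrightarrow> 0"
proof -
  define a where "a n = 5 / 2 * total_weight n" for n
  have "incseq a"
  proof (rule incseq_SucI)
    fix n
    have "0 \<le> expectation (\<lambda>\<omega>. (norm (std_tree (Suc n) \<omega> - std_tree n \<omega>))\<^sup>2)" by simp
    also have "\<dots> \<le> 5 / 2 * (total_weight (Suc n) - total_weight n)"
      by (rule expectation_std_tree_diff_square) simp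
    finally show "a n \<le> a (Suc n)" by (simp add: a_def)
  qed
  moreover have bound: "\<forall>n. a n \<le> 10" using total_weight_le by (simp add: a_def)
  ultimately obtain A where A: "a \<longlonglongrightarrow> A" using incseq_convergent[OF _ bound] by blast
  have le: "expectation (\<lambda>\<omega>. (norm (std_tree m \<omega> - std_tree n \<omega>))\<^sup>2) \<le> a m - a n" if "n \<le> m" for n m
    using expectation_std_tree_diff_square[OF that] by (simp add: a_def algebra_simps)
  obtain Y where Y [measurable]: "Y \<in> borel_measurable M"
    and int: "\<And>n. integrable M (\<lambda>\<omega>. (norm (std_tree n \<omega> - Y \<omega>))\<^sup>2)"
    and sq: "\<And>n. expectation (\<lambda>\<omega>. (norm (std_tree n \<omega> - Y \<omega>))\<^sup>2) \<le> A - a n"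
    using mean_square_limit[OF measurable_std_tree \<open>incseq a\<close> A integrable_std_tree_diff_square le] by blast
  have int1: "integrable M (\<lambda>\<omega>. norm (std_tree n \<omega> - Y \<omega>))" for n
    by (rule integrable_square_imp_integrable[OF _ int]) measurable
  have "(\<lambda>n. expectation (\<lambda>\<omega>. norm (std_tree n \<omega> - Y \<omega>))) \<longlonglongrightarrow> 0"
  proof (rule tendsto_sandwich[of "\<lambda>_. 0" _ _ "\<lambda>n. sqrt (A - a n)"])
    have "expectation (\<lambda>\<omega>. norm (std_tree n \<omega> - Y \<omega>)) \<le> sqrt (A - a n)" for n
      by (rule order_trans[OF expectation_le_sqrt[OF int1 int] real_sqrt_le_mono[OF sq]])
    then show "\<forall>\<^sub>F n in sequentially. expectation (\<lambda>\<omega>. norm (std_tree n \<omega> - Y \<omega>)) \<le> sqrt (A - a n)" by simp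
    have "(\<lambda>n. sqrt (A - a n)) \<longlonglongrightarrow> sqrt (A - A)" using A by (intro tendsto_intros)
    then show "(\<lambda>n. sqrt (A - a n)) \<longlonglongrightarrow> 0" by simp
  qed auto
  moreover have "integrable M (\<lambda>\<omega>. (norm (Y \<omega>))\<^sup>2)" using int[of 0] by (simp add: std_tree_0)
  moreover have "integrable M (\<lambda>\<omega>. std_tree n \<omega> - Y \<omega>)" for n
    using int1[of n] by (subst (asm) integrable_norm_iff) auto
  ultimately show ?thesis using that Y by blast
qed

lemma expectation_snd_limit:
  assumes [measurable]: "Y \<in> borel_measurable M" and int: "\<And>n. integrable M (\<lambda>\<omega>. std_tree n \<omega> - Y \<omega>)"
    and lim: "(\<lambda>n. expectation (\<lambda>\<omega>. norm (std_tree n \<omega> - Y \<omega>))) \<longlonglongrightarrow> 0"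
  shows "expectation (\<lambda>\<omega>. snd (Y \<omega>)) = 0"
proof -
  have snd: "(\<lambda>\<omega>. snd (std_tree n \<omega>)) = (\<lambda>\<omega>. centered_eta (set (random_history n \<omega>)))" for n
    by (simp add: std_tree_def standardized_def)
  have intd: "integrable M (\<lambda>\<omega>. snd (std_tree n \<omega> - Y \<omega>))" for n
    by (rule Bochner_Integration.integrable_bound[OF int[of n]])
       (auto intro!: borel_measurable_snd borel_measurable_diff simp: norm_prod_def real_le_rsqrt)
  have intZ: "integrable M (\<lambda>\<omega>. snd (std_tree n \<omega>))" for n
    unfolding snd by (rule integrable_random_history)
  have EZ: "expectation (\<lambda>\<omega>. snd (std_tree n \<omega>)) = 0" for n
    unfolding snd expectation_random_history[of "\<lambda>l. centered_eta (set l)"] by (rule mean_centered_eta)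
  have "\<bar>expectation (\<lambda>\<omega>. snd (Y \<omega>))\<bar> \<le> expectation (\<lambda>\<omega>. norm (std_tree n \<omega> - Y \<omega>))" for n
  proof -
    have "expectation (\<lambda>\<omega>. snd (std_tree n \<omega> - Y \<omega>)) = expectation (\<lambda>\<omega>. snd (std_tree n \<omega>)) - expectation (\<lambda>\<omega>. snd (Y \<omega>))"
      using Bochner_Integration.integrable_diff[OF intZ[of n] intd[of n]] intZ
      by (simp add: Bochner_Integration.integral_diff)
    then have "\<bar>expectation (\<lambda>\<omega>. snd (Y \<omega>))\<bar> = \<bar>expectation (\<lambda>\<omega>. snd (std_tree n \<omega> - Y \<omega>))\<bar>"
      using EZ[of n] by simp
    also have "\<dots> \<le> expectation (\<lambda>\<omega>. \<bar>snd (std_tree n \<omega> - Y \<omega>)\<bar>)" by (rule integral_abs_bound)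
    also have "\<dots> \<le> expectation (\<lambda>\<omega>. norm (std_tree n \<omega> - Y \<omega>))"
    proof (rule integral_mono)
      show "\<bar>snd (std_tree n \<omega> - Y \<omega>)\<bar> \<le> norm (std_tree n \<omega> - Y \<omega>)" for \<omega>
        unfolding norm_prod_def by (intro real_le_rsqrt) auto
    qed (use int[of n] intd[of n] in auto)
    finally show ?thesis .
  qed
  then have "\<bar>expectation (\<lambda>\<omega>. snd (Y \<omega>))\<bar> \<le> 0" by (intro LIMSEQ_le_const[OF lim]) auto
  then show ?thesis by simp
qed

end

lemma centered_laws_iff:
  "\<mu> \<in> centered_laws \<longleftrightarrow> prob_space \<mu> \<and> sets \<mu> = sets borel \<and>
    integrable \<mu> (\<lambda>z. (norm z)\<^sup>2) \<and> (\<integral>z. snd z \<partial>\<mu>) = 0"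
proof -
  have "(\<lambda>(f, x). (norm f)\<^sup>2 + x\<^sup>2) = (\<lambda>z :: c00 \<times> real. (norm z)\<^sup>2)"
    by (auto simp: norm_Pair)
  moreover have "(\<lambda>(f, x). x) = (\<lambda>z :: c00 \<times> real. snd z)" by auto
  ultimately show ?thesis by (simp add: centered_laws_def)
qed

lemma distr_in_centered_laws:
  assumes "prob_space M" and [measurable]: "Y \<in> borel_measurable M"
    and "integrable M (\<lambda>\<omega>. (norm (Y \<omega>))\<^sup>2)" "(\<integral>\<omega>. snd (Y \<omega>) \<partial>M) = 0"
  shows "distr M borel Y \<in> centered_laws"
  unfolding centered_laws_iff using assms
  by (auto intro: prob_space.prob_space_distr simp: integrable_distr_eq integral_distr borel_measurable_snd)

section \<open>Moments of the logarithm of a uniform random variable\<close>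

abbreviation U01 :: "real measure" where
  "U01 \<equiv> uniform_measure lborel {0<..<1}"

lemma U01_density: "U01 = density lborel (\<lambda>x. ennreal (indicator {0<..<1} x))"
  unfolding uniform_measure_def by (intro density_cong) (auto simp: indicator_def)

lemma prob_space_U01: "prob_space U01"
  by (rule prob_space_uniform_measure) auto

lemma AE_U01: "AE u in U01. u \<in> {0<..<1}"
  by (rule AE_uniform_measureI) auto

lemma integral_U01:
  fixes f :: "real \<Rightarrow> real"
  assumes [measurable]: "f \<in> borel_measurable borel"
  shows "integral\<^sup>L U01 f = (\<integral>x. indicator {0<..<1} x * f x \<partial>lborel)"
  unfolding U01_density by (subst integral_density) auto

lemma integrable_U01:
  fixes f :: "real \<Rightarrow> real"
  assumes [measurable]: "f \<in> borel_measurable borel"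
  shows "integrable U01 f \<longleftrightarrow> integrable lborel (\<lambda>x. indicator {0<..<1} x * f x)"
  unfolding U01_density by (subst integrable_density) auto

text \<open>
  The fundamental theorem of calculus on the open unit interval, for a nonnegative integrand.
\<close>

lemma FTC_U01:
  fixes f F :: "real \<Rightarrow> real"
  assumes [measurable]: "f \<in> borel_measurable borel"
    and F: "\<And>x. 0 < x \<Longrightarrow> x < 1 \<Longrightarrow> (F has_real_derivative f x) (at x)"
    and f: "\<And>x. 0 < x \<Longrightarrow> x < 1 \<Longrightarrow> isCont f x" "\<And>x. 0 < x \<Longrightarrow> x < 1 \<Longrightarrow> 0 \<le> f x"
    and lim: "(F \<longlongrightarrow> a) (at_right 0)" "(F \<longlongrightarrow> b) (at_left 1)"
  shows "integrable U01 f" "integral\<^sup>L U01 f = b - a"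
proof -
  have 1: "set_integrable lborel (einterval (ereal 0) (ereal 1)) f" "(LBINT x=ereal 0..ereal 1. f x) = b - a"
    by (rule interval_integral_FTC_nonneg[where F = F]; use F f lim in \<open>simp add: ereal_tendsto_simps\<close>)+
  have "einterval (ereal 0) (ereal 1) = {0<..<1}" by (auto simp: einterval_def)
  then show "integrable U01 f" "integral\<^sup>L U01 f = b - a"
    using 1 by (simp_all add: integral_U01 integrable_U01 set_integrable_def interval_lebesgue_integral_def set_lebesgue_integral_def)
qed

lemma integrable_ln: "integrable U01 ln" and integral_ln: "integral\<^sup>L U01 ln = - 1"
proof -
  have m: "(\<lambda>u :: real. - ln u) \<in> borel_measurable borel" by measurable
  have d: "((\<lambda>x. x - x * ln x) has_real_derivative - ln x) (at x)" if "0 < x" "x < 1" for x :: real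
    using that by (auto intro!: derivative_eq_intros)
  have c: "isCont (\<lambda>u. - ln u) x" if "0 < x" "x < 1" for x :: real
    using that by (auto intro!: continuous_intros)
  have n: "0 \<le> - ln x" if "0 < x" "x < 1" for x :: real using that by simp
  have l: "((\<lambda>x :: real. x - x * ln x) \<longlongrightarrow> 0) (at_right 0)" "((\<lambda>x :: real. x - x * ln x) \<longlongrightarrow> 1) (at_left 1)"
    by real_asymp+
  note * = FTC_U01[OF m d c n l]
  show "integrable U01 ln" using Bochner_Integration.integrable_minus[OF *(1)] by simp
  have "(\<integral>u. - ln u \<partial>U01) = - integral\<^sup>L U01 ln" by (rule Bochner_Integration.integral_minus)
  then show "integral\<^sup>L U01 ln = - 1" using *(2) by linarith
qed

lemma integrable_ln_square: "integrable U01 (\<lambda>u. (ln u)\<^sup>2)"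
  by (rule FTC_U01(1)[where F = "\<lambda>x. x * (ln x)\<^sup>2 - 2 * (x * ln x) + 2 * x" and a = 0 and b = 2],
    measurable, auto intro!: derivative_eq_intros continuous_intros simp: power2_eq_square field_simps, real_asymp, real_asymp)

lemma integrable_ln_minus: "integrable U01 (\<lambda>u. ln (1 - u))"
  and integral_ln_minus: "(\<integral>u. ln (1 - u) \<partial>U01) = - 1"
proof -
  have m: "(\<lambda>u :: real. - ln (1 - u)) \<in> borel_measurable borel" by measurable
  have d: "((\<lambda>x. (1 - x) * ln (1 - x) - (1 - x)) has_real_derivative - ln (1 - x)) (at x)" if "0 < x" "x < 1" for x :: real
    using that by (auto intro!: derivative_eq_intros)
  have c: "isCont (\<lambda>u. - ln (1 - u)) x" if "0 < x" "x < 1" for x :: real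
    using that by (auto intro!: continuous_intros)
  have n: "0 \<le> - ln (1 - x)" if "0 < x" "x < 1" for x :: real using that by simp
  have l: "((\<lambda>x :: real. (1 - x) * ln (1 - x) - (1 - x)) \<longlongrightarrow> - 1) (at_right 0)" "((\<lambda>x :: real. (1 - x) * ln (1 - x) - (1 - x)) \<longlongrightarrow> 0) (at_left 1)"
    by real_asymp+
  note * = FTC_U01[OF m d c n l]
  show "integrable U01 (\<lambda>u. ln (1 - u))" using Bochner_Integration.integrable_minus[OF *(1)] by simp
  have "(\<integral>u. - ln (1 - u) \<partial>U01) = - (\<integral>u. ln (1 - u) \<partial>U01)" by (rule Bochner_Integration.integral_minus)
  then show "(\<integral>u. ln (1 - u) \<partial>U01) = - 1" using *(2) by linarith
qed

lemma integrable_ln_minus_square: "integrable U01 (\<lambda>u. (ln (1 - u))\<^sup>2)"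
proof (rule FTC_U01(1)[where F = "\<lambda>x. - ((1 - x) * (ln (1 - x))\<^sup>2 - 2 * ((1 - x) * ln (1 - x)) + 2 * (1 - x))"
      and a = "- 2" and b = 0])
  fix x :: real assume x: "0 < x" "x < 1"
  then have "((\<lambda>y. y * (ln y)\<^sup>2 - 2 * (y * ln y) + 2 * y) has_real_derivative (ln (1 - x))\<^sup>2) (at (1 - x))"
    by (auto intro!: derivative_eq_intros simp: power2_eq_square)
  moreover have "((\<lambda>x. 1 - x) has_real_derivative - 1) (at x)" by (auto intro!: derivative_eq_intros)
  ultimately show "((\<lambda>x. - ((1 - x) * (ln (1 - x))\<^sup>2 - 2 * ((1 - x) * ln (1 - x)) + 2 * (1 - x)))
      has_real_derivative (ln (1 - x))\<^sup>2) (at x)"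
    using DERIV_minus[OF DERIV_chain2] by fastforce
  show "isCont (\<lambda>x. (ln (1 - x))\<^sup>2) x" using x by (auto intro!: continuous_intros)
qed (measurable, auto, real_asymp, real_asymp)

section \<open>The map underlying the fixed-point operator\<close>

text \<open>
  The two logarithms are parameters, because in the recursion for trees with \<open>n\<close> nodes their place
  is taken by differences of harmonic numbers.
\<close>

definition combine :: "real \<Rightarrow> real \<Rightarrow> c00 \<times> real \<Rightarrow> c00 \<times> real \<Rightarrow> c00 \<times> real" where
  "combine a b z z' = (op_A (fst z) + op_B (fst z') + (snd z - snd z' + (a - b)) *\<^sub>R phi,
    1 + 1 / 2 * (snd z + snd z') + 1 / 2 * (a + b))"

lemma Psi_combine: "Psi \<mu> = distr (\<mu> \<Otimes>\<^sub>M (\<mu> \<Otimes>\<^sub>M U01)) borel (\<lambda>(z, (z', u)). combine (ln u) (ln (1 - u)) z z')"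
  unfolding Psi_def combine_def
  by (intro arg_cong[where f = "distr _ _"]) (auto simp: fun_eq_iff algebra_simps)

lemma combine_0: "combine 0 0 0 0 = (0, 1)"
proof -
  have "op_A 0 = 0" "op_B 0 = 0"
    by (auto intro!: c00_eqI simp: c00_ops c00_apply_op_A c00_apply_op_B)
  then show ?thesis by (simp add: combine_def)
qed

lemma combine_lipschitz:
  "norm (combine a b z z' - combine a' b' w w') \<le> 2 * (norm (z - w) + norm (z' - w') + \<bar>a - a'\<bar> + \<bar>b - b'\<bar>)"
proof -
  define f f' where "f = fst (z - w)" and "f' = fst (z' - w')"
  define x x' where "x = snd (z - w)" and "x' = snd (z' - w')"
  define c where "c = x - x' + (a - a') - (b - b')"
  have eq: "combine a b z z' - combine a' b' w w' =
      (op_A f + op_B f' + c *\<^sub>R phi, 1 / 2 * (x + x' + (a - a') + (b - b')))"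
    unfolding combine_def f_def f'_def x_def x'_def c_def fst_diff snd_diff
      op_A_diff[symmetric] op_B_diff[symmetric]
    by (simp add: algebra_simps add_divide_distrib)
  have le: "norm f \<le> norm (z - w)" "norm f' \<le> norm (z' - w')" "\<bar>x\<bar> \<le> norm (z - w)" "\<bar>x'\<bar> \<le> norm (z' - w')"
    unfolding f_def f'_def x_def x'_def norm_prod_def by (auto intro!: real_le_rsqrt)
  have "norm (combine a b z z' - combine a' b' w w') \<le>
      norm (op_A f + op_B f' + c *\<^sub>R phi) + \<bar>1 / 2 * (x + x' + (a - a') + (b - b'))\<bar>"
    unfolding eq norm_Pair by (metis real_norm_def sqrt_sum_squares_le_sum norm_ge_zero)
  also have "norm (op_A f + op_B f' + c *\<^sub>R phi) \<le> norm (op_A f + op_B f') + \<bar>c\<bar> * norm phi"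
    by (rule order_trans[OF norm_triangle_ineq]) simp
  also have "\<dots> \<le> 1 / 2 * max (norm f) (norm f') + \<bar>c\<bar> * (1 / 4)"
    by (intro add_mono norm_op_A_op_B mult_left_mono norm_phi) auto
  also have "max (norm f) (norm f') \<le> norm f + norm f'" by simp
  finally have "norm (combine a b z z' - combine a' b' w w') \<le>
      1 / 2 * (norm f + norm f') + \<bar>c\<bar> * (1 / 4) + \<bar>1 / 2 * (x + x' + (a - a') + (b - b'))\<bar>" by simp
  moreover have "\<bar>c\<bar> \<le> \<bar>x\<bar> + \<bar>x'\<bar> + \<bar>a - a'\<bar> + \<bar>b - b'\<bar>" unfolding c_def by linarith
  moreover have "\<bar>1 / 2 * (x + x' + (a - a') + (b - b'))\<bar> \<le> 1 / 2 * (\<bar>x\<bar> + \<bar>x'\<bar> + \<bar>a - a'\<bar> + \<bar>b - b'\<bar>)"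
    unfolding abs_mult by (intro mult_mono) auto
  ultimately show ?thesis
    using le norm_ge_zero[of "z - w"] norm_ge_zero[of "z' - w'"] abs_ge_zero[of "a - a'"] abs_ge_zero[of "b - b'"]
    unfolding distrib_left by linarith
qed

lemma measurable_combine [measurable (raw)]:
  assumes [measurable]: "a \<in> borel_measurable N" "b \<in> borel_measurable N"
    "X \<in> borel_measurable N" "Y \<in> borel_measurable N"
  shows "(\<lambda>\<omega>. combine (a \<omega>) (b \<omega>) (X \<omega>) (Y \<omega>)) \<in> borel_measurable N"
proof -
  let ?f = "\<lambda>p :: (real \<times> real) \<times> (c00 \<times> real) \<times> (c00 \<times> real).
    combine (fst (fst p)) (snd (fst p)) (fst (snd p)) (snd (snd p))"
  have "continuous_on UNIV ?f"
    unfolding continuous_on_def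
  proof (intro ballI)
    fix p :: "(real \<times> real) \<times> (c00 \<times> real) \<times> (c00 \<times> real)"
    let ?d = "\<lambda>q. 2 * (norm (fst (snd q) - fst (snd p)) + norm (snd (snd q) - snd (snd p))
      + \<bar>fst (fst q) - fst (fst p)\<bar> + \<bar>snd (fst q) - snd (fst p)\<bar>)"
    have "((\<lambda>q. ?f q - ?f p) \<longlongrightarrow> 0) (at p)"
    proof (rule tendsto_norm_zero_cancel, rule tendsto_sandwich[of "\<lambda>_. 0" _ _ ?d])
      have "(?d \<longlongrightarrow> ?d p) (at p)" by (intro tendsto_intros)
      then show "(?d \<longlongrightarrow> 0) (at p)" by simp
      show "\<forall>\<^sub>F q in at p. norm (?f q - ?f p) \<le> ?d q"
        by (intro always_eventually allI combine_lipschitz)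
    qed auto
    then show "(?f \<longlongrightarrow> ?f p) (at p within UNIV)" by (simp add: LIM_zero_iff)
  qed
  then have "?f \<in> borel_measurable borel" by (rule borel_measurable_continuous_onI)
  from measurable_compose[OF _ this, of "\<lambda>\<omega>. ((a \<omega>, b \<omega>), (X \<omega>, Y \<omega>))" N]
  show ?thesis by (simp add: borel_measurable_Pair)
qed

section \<open>Integrals over product spaces\<close>

lemma integral_pair_product:
  fixes f :: "'a \<Rightarrow> real" and g :: "'b \<Rightarrow> real"
  assumes "prob_space A" "prob_space B" and f: "integrable A f" and g: "integrable B g"
  shows "integrable (A \<Otimes>\<^sub>M B) (\<lambda>p. f (fst p) * g (snd p))"
    and "(\<integral>p. f (fst p) * g (snd p) \<partial>(A \<Otimes>\<^sub>M B)) = (\<integral>x. f x \<partial>A) * (\<integral>y. g y \<partial>B)"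
proof -
  interpret A: prob_space A by fact
  interpret B: prob_space B by fact
  interpret P: pair_prob_space A B ..
  have [measurable]: "f \<in> borel_measurable A" "g \<in> borel_measurable B" using f g by auto
  show int: "integrable (A \<Otimes>\<^sub>M B) (\<lambda>p. f (fst p) * g (snd p))"
    by (rule P.Fubini_integrable) (use f g in \<open>auto simp: abs_mult\<close>)
  show "(\<integral>p. f (fst p) * g (snd p) \<partial>(A \<Otimes>\<^sub>M B)) = (\<integral>x. f x \<partial>A) * (\<integral>y. g y \<partial>B)"
    using P.integral_fst'[OF int] by simp
qed

lemma integral_triple_product:
  fixes f :: "'a \<Rightarrow> real" and g :: "'b \<Rightarrow> real" and h :: "'c \<Rightarrow> real"
  assumes ABC: "prob_space A" "prob_space B" "prob_space C"
    and f: "integrable A f" and g: "integrable B g" and h: "integrable C h"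
  shows "integrable (A \<Otimes>\<^sub>M (B \<Otimes>\<^sub>M C)) (\<lambda>p. f (fst p) * (g (fst (snd p)) * h (snd (snd p))))"
    and "(\<integral>p. f (fst p) * (g (fst (snd p)) * h (snd (snd p))) \<partial>(A \<Otimes>\<^sub>M (B \<Otimes>\<^sub>M C)))
      = (\<integral>x. f x \<partial>A) * ((\<integral>y. g y \<partial>B) * (\<integral>z. h z \<partial>C))"
proof -
  have "prob_space (B \<Otimes>\<^sub>M C)" using ABC by (intro prob_space_pair)
  then show "integrable (A \<Otimes>\<^sub>M (B \<Otimes>\<^sub>M C)) (\<lambda>p. f (fst p) * (g (fst (snd p)) * h (snd (snd p))))"
    "(\<integral>p. f (fst p) * (g (fst (snd p)) * h (snd (snd p))) \<partial>(A \<Otimes>\<^sub>M (B \<Otimes>\<^sub>M C)))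
      = (\<integral>x. f x \<partial>A) * ((\<integral>y. g y \<partial>B) * (\<integral>z. h z \<partial>C))"
    using integral_pair_product[OF ABC(1) _ f integral_pair_product(1)[OF ABC(2,3) g h]]
      integral_pair_product(2)[OF ABC(2,3) g h] by simp_all
qed

lemma integral_triple_coordinates:
  fixes f :: "'a \<Rightarrow> real" and g :: "'b \<Rightarrow> real" and h :: "'c \<Rightarrow> real"
  assumes ABC: "prob_space A" "prob_space B" "prob_space C"
  shows "integrable A f \<Longrightarrow> integrable (A \<Otimes>\<^sub>M (B \<Otimes>\<^sub>M C)) (\<lambda>p. f (fst p))"
    and "integrable B g \<Longrightarrow> integrable (A \<Otimes>\<^sub>M (B \<Otimes>\<^sub>M C)) (\<lambda>p. g (fst (snd p)))"
    and "integrable C h \<Longrightarrow> integrable (A \<Otimes>\<^sub>M (B \<Otimes>\<^sub>M C)) (\<lambda>p. h (snd (snd p)))"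
    and "integrable A f \<Longrightarrow> (\<integral>p. f (fst p) \<partial>(A \<Otimes>\<^sub>M (B \<Otimes>\<^sub>M C))) = (\<integral>x. f x \<partial>A)"
    and "integrable B g \<Longrightarrow> (\<integral>p. g (fst (snd p)) \<partial>(A \<Otimes>\<^sub>M (B \<Otimes>\<^sub>M C))) = (\<integral>y. g y \<partial>B)"
    and "integrable C h \<Longrightarrow> (\<integral>p. h (snd (snd p)) \<partial>(A \<Otimes>\<^sub>M (B \<Otimes>\<^sub>M C))) = (\<integral>z. h z \<partial>C)"
proof -
  interpret A: prob_space A by fact
  interpret B: prob_space B by fact
  interpret C: prob_space C by fact
  note * = integral_triple_product[OF ABC]
  show "integrable A f \<Longrightarrow> integrable (A \<Otimes>\<^sub>M (B \<Otimes>\<^sub>M C)) (\<lambda>p. f (fst p))"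
    and "integrable A f \<Longrightarrow> (\<integral>p. f (fst p) \<partial>(A \<Otimes>\<^sub>M (B \<Otimes>\<^sub>M C))) = (\<integral>x. f x \<partial>A)"
    using *[of f "\<lambda>_. 1" "\<lambda>_. 1"] by (simp_all add: A.prob_space B.prob_space C.prob_space)
  show "integrable B g \<Longrightarrow> integrable (A \<Otimes>\<^sub>M (B \<Otimes>\<^sub>M C)) (\<lambda>p. g (fst (snd p)))"
    and "integrable B g \<Longrightarrow> (\<integral>p. g (fst (snd p)) \<partial>(A \<Otimes>\<^sub>M (B \<Otimes>\<^sub>M C))) = (\<integral>y. g y \<partial>B)"
    using *[of "\<lambda>_. 1" g "\<lambda>_. 1"] by (simp_all add: A.prob_space B.prob_space C.prob_space)
  show "integrable C h \<Longrightarrow> integrable (A \<Otimes>\<^sub>M (B \<Otimes>\<^sub>M C)) (\<lambda>p. h (snd (snd p)))"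
    and "integrable C h \<Longrightarrow> (\<integral>p. h (snd (snd p)) \<partial>(A \<Otimes>\<^sub>M (B \<Otimes>\<^sub>M C))) = (\<integral>z. h z \<partial>C)"
    using *[of "\<lambda>_. 1" "\<lambda>_. 1" h] by (simp_all add: A.prob_space B.prob_space C.prob_space)
qed

lemma centered_laws_moments:
  assumes "\<mu> \<in> centered_laws"
  shows "prob_space \<mu>" "sets \<mu> = sets borel" "integrable \<mu> (\<lambda>z. (norm z)\<^sup>2)" "integrable \<mu> snd" "integral\<^sup>L \<mu> snd = 0"
proof -
  show *: "prob_space \<mu>" and sets: "sets \<mu> = sets borel" and sq: "integrable \<mu> (\<lambda>z. (norm z)\<^sup>2)"
    and "integral\<^sup>L \<mu> snd = 0"
    using assms by (auto simp: centered_laws_iff)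
  have meas: "snd \<in> borel_measurable \<mu>"
    unfolding measurable_cong_sets[OF sets refl] by (rule borel_measurable_snd) simp
  show "integrable \<mu> snd"
  proof (rule prob_space.integrable_square_imp_integrable[OF * meas])
    show "integrable \<mu> (\<lambda>z. (snd z)\<^sup>2)"
      by (rule Bochner_Integration.integrable_bound[OF sq]) (use meas in \<open>auto simp: norm_prod_def\<close>)
  qed
qed

lemma Psi_in_centered_laws:
  assumes \<mu>: "\<mu> \<in> centered_laws"
  shows "Psi \<mu> \<in> centered_laws"
proof -
  note m = centered_laws_moments[OF \<mu>]
  interpret m: prob_space \<mu> by (rule m(1))
  interpret U: prob_space U01 by (rule prob_space_U01)
  define P where "P = \<mu> \<Otimes>\<^sub>M (\<mu> \<Otimes>\<^sub>M U01)"
  interpret P: prob_space P unfolding P_def by (intro prob_space_pair) unfold_locales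
  note c = integral_triple_coordinates[OF m(1) m(1) prob_space_U01, folded P_def]
  define X where "X p = combine (ln (snd (snd p))) (ln (1 - snd (snd p))) (fst p) (fst (snd p))"
    for p :: "(c00 \<times> real) \<times> (c00 \<times> real) \<times> real"
  have setsP: "sets P = sets (borel \<Otimes>\<^sub>M (borel \<Otimes>\<^sub>M borel))"
    unfolding P_def by (intro sets_pair_measure_cong m(2)) auto
  have X: "X \<in> borel_measurable P"
    unfolding X_def measurable_cong_sets[OF setsP refl] by measurable
  have "Psi \<mu> = distr P borel X"
    unfolding Psi_combine P_def X_def by (simp add: case_prod_unfold)
  also have "\<dots> \<in> centered_laws"
  proof (rule distr_in_centered_laws[OF _ X])
    show "prob_space P" by (rule P.prob_space_axioms)
    show "integrable P (\<lambda>p. (norm (X p))\<^sup>2)"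
    proof (rule Bochner_Integration.integrable_bound)
      let ?B = "\<lambda>p. 20 * (1 + (norm (fst p))\<^sup>2 + (norm (fst (snd p)))\<^sup>2
        + (ln (snd (snd p)))\<^sup>2 + (ln (1 - snd (snd p)))\<^sup>2)"
      show "integrable P ?B"
        by (intro integrable_mult_right Bochner_Integration.integrable_add c m(3) integrable_ln_square integrable_ln_minus_square) simp
      have le: "(norm (X p))\<^sup>2 \<le> ?B p" for p
      proof -
        obtain z z' u where p: "p = (z, z', u)" by (cases p) auto
        have "norm (X p) \<le> norm (combine 0 0 0 0) + norm (X p - combine 0 0 0 0)"
          by (metis add_diff_cancel_left' diff_add_cancel norm_triangle_ineq add.commute)
        also have "\<dots> \<le> 1 + 2 * (norm z + norm z' + \<bar>ln u\<bar> + \<bar>ln (1 - u)\<bar>)"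
          using combine_lipschitz[of "ln u" "ln (1 - u)" z z' 0 0 0 0] by (simp add: p X_def combine_0 norm_Pair)
        finally have "(norm (X p))\<^sup>2 \<le> (1 + 2 * (norm z + norm z' + \<bar>ln u\<bar> + \<bar>ln (1 - u)\<bar>))\<^sup>2"
          by (intro power_mono) auto
        also have "\<dots> \<le> 20 * (1 + (norm z)\<^sup>2 + (norm z')\<^sup>2 + \<bar>ln u\<bar>\<^sup>2 + \<bar>ln (1 - u)\<bar>\<^sup>2)"
        proof -
          \<comment> \<open>the Cauchy--Schwarz inequality for five terms\<close>
          have "(1 + 2 * (a + b + c + d))\<^sup>2 \<le> 20 * (1 + a\<^sup>2 + b\<^sup>2 + c\<^sup>2 + d\<^sup>2)" for a b c d :: real
          proof -
            define S where "S = (1 - 2 * a)\<^sup>2 + (1 - 2 * b)\<^sup>2 + (1 - 2 * c)\<^sup>2 + (1 - 2 * d)\<^sup>2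
                + 4 * (a - b)\<^sup>2 + 4 * (a - c)\<^sup>2 + 4 * (a - d)\<^sup>2 + 4 * (b - c)\<^sup>2 + 4 * (b - d)\<^sup>2 + 4 * (c - d)\<^sup>2"
            have "0 \<le> S" unfolding S_def by (intro add_nonneg_nonneg) auto
            have "(1 + 2 * (a + b + c + d))\<^sup>2 = 5 + 20 * (a\<^sup>2 + b\<^sup>2 + c\<^sup>2 + d\<^sup>2)
                - S"
              unfolding S_def by (simp add: power2_eq_square algebra_simps)
            also have "\<dots> \<le> 5 + 20 * (a\<^sup>2 + b\<^sup>2 + c\<^sup>2 + d\<^sup>2)"
              using \<open>0 \<le> S\<close> by simp
            also have "\<dots> \<le> 20 * (1 + a\<^sup>2 + b\<^sup>2 + c\<^sup>2 + d\<^sup>2)" by simp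
            finally show ?thesis .
          qed
          then show ?thesis .
        qed
        finally show ?thesis by (simp add: p)
      qed
      show "AE p in P. norm ((norm (X p))\<^sup>2) \<le> norm (?B p)"
      proof (rule AE_I2)
        fix p
        show "norm ((norm (X p))\<^sup>2) \<le> norm (?B p)"
          using order_trans[OF le abs_ge_self] by (simp only: real_norm_def abs_power2)
      qed
    qed (use X in measurable)
    have "(\<integral>p. snd (X p) \<partial>P) = (\<integral>p. 1 + 1 / 2 * (snd (fst p) + snd (fst (snd p)))
        + 1 / 2 * (ln (snd (snd p)) + ln (1 - snd (snd p))) \<partial>P)"
      by (simp add: X_def combine_def)
    also have "\<dots> = 1 + 1 / 2 * (0 + 0) + 1 / 2 * (- 1 + - 1)"
    proof -
      have i: "integrable P (\<lambda>p. snd (fst p))" "integrable P (\<lambda>p. snd (fst (snd p)))"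
        "integrable P (\<lambda>p. ln (snd (snd p)))" "integrable P (\<lambda>p. ln (1 - snd (snd p)))"
        by (rule c m(4) integrable_ln integrable_ln_minus)+
      have v: "(\<integral>p. snd (fst p) \<partial>P) = 0" "(\<integral>p. snd (fst (snd p)) \<partial>P) = 0"
        "(\<integral>p. ln (snd (snd p)) \<partial>P) = - 1" "(\<integral>p. ln (1 - snd (snd p)) \<partial>P) = - 1"
        using c(4)[OF m(4)] c(5)[OF m(4)] c(6)[OF integrable_ln] c(6)[OF integrable_ln_minus] m(5)
        by (simp_all add: integral_ln integral_ln_minus)
      show ?thesis
        using i v by (simp add: P.prob_space)
    qed
    finally show "(\<integral>p. snd (X p) \<partial>P) = 0" by simp
  qed
  finally show ?thesis .
qed

section \<open>Uniqueness of the fixed point\<close>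

text \<open>A probability measure on a metric space is determined by its integrals of Lipschitz functions.\<close>

lemma measure_eqI_lipschitz:
  fixes \<mu> \<nu> :: "'s :: metric_space measure"
  assumes "prob_space \<mu>" "prob_space \<nu>" and sets: "sets \<mu> = sets borel" "sets \<nu> = sets borel"
    and eq: "\<And>g :: 's \<Rightarrow> real. \<And>L. (\<And>x y. \<bar>g x - g y\<bar> \<le> L * dist x y) \<Longrightarrow> (\<And>x. 0 \<le> g x) \<Longrightarrow> (\<And>x. g x \<le> 1) \<Longrightarrow>
      (\<integral>x. g x \<partial>\<mu>) = (\<integral>x. g x \<partial>\<nu>)"
  shows "\<mu> = \<nu>"
proof (rule measure_eqI_generator_eq[where E = "Collect closed" and \<Omega> = UNIV and A = "\<lambda>_. UNIV"])
  interpret m: prob_space \<mu> by fact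
  interpret n: prob_space \<nu> by fact
  show "Int_stable (Collect (closed :: 's set \<Rightarrow> bool))" by (auto simp: Int_stable_def)
  show "sets \<mu> = sigma_sets UNIV (Collect closed)" "sets \<nu> = sigma_sets UNIV (Collect closed)"
    unfolding sets by (simp_all add: borel_eq_closed)
  show "emeasure \<mu> UNIV \<noteq> \<infinity>" by simp
  fix C :: "'s set" assume C: "C \<in> Collect closed"
  show "emeasure \<mu> C = emeasure \<nu> C"
  proof (cases "C = {}")
    case False
    \<comment> \<open>Lipschitz functions that decrease to the indicator function of \<open>C\<close>\<close>
    define g where "g n x = max 0 (1 - real n * infdist x C)" for n x
    have lim: "(\<lambda>n. \<integral>x. g n x \<partial>M) \<longlonglongrightarrow> measure M C" if "prob_space M" "sets M = sets borel" for M :: "'s measure"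
    proof -
      interpret M: prob_space M by fact
      have "(\<lambda>n. \<integral>x. g n x \<partial>M) \<longlonglongrightarrow> (\<integral>x. indicator C x \<partial>M)"
      proof (rule integral_dominated_convergence[where w = "\<lambda>_. 1"])
        show "g n \<in> borel_measurable M" for n
          unfolding measurable_cong_sets[OF that(2) refl] g_def
          by (intro borel_measurable_continuous_onI continuous_intros)
        show "AE x in M. (\<lambda>n. g n x) \<longlonglongrightarrow> indicator C x"
        proof (rule AE_I2)
          fix x
          show "(\<lambda>n. g n x) \<longlonglongrightarrow> indicator C x"
          proof (cases "x \<in> C")
            case True
            then show ?thesis by (simp add: g_def)
          next
            case out: False
            then have d: "infdist x C > 0" using C False by (simp add: infdist_pos_not_in_closed)
            obtain N where N: "1 < real N * infdist x C" using reals_Archimedean3[OF d] by blast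
            have "\<forall>\<^sub>F n in sequentially. g n x = 0"
              using eventually_ge_at_top[of N]
            proof eventually_elim
              fix n assume "N \<le> n"
              then have "real N * infdist x C \<le> real n * infdist x C" using d by (intro mult_right_mono) auto
              then show "g n x = 0" using N by (simp add: g_def)
            qed
            then show ?thesis using out by (simp add: tendsto_eventually)
          qed
        qed
        show "AE x in M. norm (g n x) \<le> 1" for n
          by (intro AE_I2) (simp add: g_def infdist_nonneg)
        show "(\<lambda>x. indicator C x :: real) \<in> borel_measurable M"
          using C that(2) by (intro borel_measurable_indicator) simp
      qed simp
      moreover have "C \<in> sets M" using C that(2) by simp
      ultimately show ?thesis by simp
    qed
    have "(\<integral>x. g n x \<partial>\<mu>) = (\<integral>x. g n x \<partial>\<nu>)" for n
    proof (rule eq[where L = "real n"])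
      fix x y
      have "\<bar>g n x - g n y\<bar> \<le> \<bar>real n * infdist x C - real n * infdist y C\<bar>" unfolding g_def by linarith
      also have "\<dots> = real n * \<bar>infdist x C - infdist y C\<bar>" by (simp add: abs_mult flip: right_diff_distrib)
      also have "\<dots> \<le> real n * dist x y" by (intro mult_left_mono infdist_triangle_abs) auto
      finally show "\<bar>g n x - g n y\<bar> \<le> real n * dist x y" .
    qed (auto simp: g_def infdist_nonneg)
    then have "measure \<mu> C = measure \<nu> C"
      using LIMSEQ_unique[OF lim[OF assms(1) sets(1)]] lim[OF assms(2) sets(2)] by simp
    then show ?thesis by (simp add: m.emeasure_eq_measure n.emeasure_eq_measure)
  qed simp
qed auto

text \<open>
  The weight \<open>3 / 2\<close> of the second component makes \<^const>\<open>combine\<close> contract with the factor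
  \<open>3 / 4\<close>, up to a term that vanishes in the mean because of independence.
\<close>

definition energy :: "c00 \<times> real \<Rightarrow> real" where
  "energy z = (norm (fst z))\<^sup>2 + 3 / 2 * (snd z)\<^sup>2"

lemma energy_combine_diff:
  "energy (combine a b z z' - combine a b w w') \<le>
    3 / 8 * (energy (z - w) + energy (z' - w')) + 3 / 8 * (snd (z - w) * snd (z' - w'))"
proof -
  define x x' where "x = snd (z - w)" and "x' = snd (z' - w')"
  have "combine a b z z' - combine a b w w' =
      (op_A (fst (z - w)) + op_B (fst (z' - w')) + (x - x') *\<^sub>R phi, 1 / 2 * (x + x'))"
    unfolding combine_def x_def x'_def fst_diff snd_diff op_A_diff[symmetric] op_B_diff[symmetric]
    by (simp add: algebra_simps)
  then have "energy (combine a b z z' - combine a b w w') \<le>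
      (3 / 8 * ((norm (fst (z - w)))\<^sup>2 + (norm (fst (z' - w')))\<^sup>2) + 3 / 16 * (x - x')\<^sup>2) + 3 / 2 * (1 / 2 * (x + x'))\<^sup>2"
    unfolding energy_def using norm_split_square by simp
  also have "\<dots> = 3 / 8 * (energy (z - w) + energy (z' - w')) + 3 / 8 * (x * x')"
    unfolding energy_def x_def[symmetric] x'_def[symmetric] by (simp add: power2_eq_square field_simps)
  finally show ?thesis unfolding x_def x'_def .
qed

text \<open>
  A joint distribution with the given marginals.
\<close>

definition coupling :: "(('s :: topological_space) \<times> 's) measure \<Rightarrow> 's measure \<Rightarrow> 's measure \<Rightarrow> bool" where
  "coupling \<pi> \<mu> \<nu> \<longleftrightarrow> prob_space \<pi> \<and> sets \<pi> = sets borel \<and> distr \<pi> borel fst = \<mu> \<and> distr \<pi> borel snd = \<nu>"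

lemma coupling_independent:
  fixes \<mu> \<nu> :: "('s :: second_countable_topology) measure"
  assumes "prob_space \<mu>" "prob_space \<nu>" "sets \<mu> = sets borel" "sets \<nu> = sets borel"
  shows "coupling (\<mu> \<Otimes>\<^sub>M \<nu>) \<mu> \<nu>"
proof -
  interpret m: prob_space \<mu> by fact
  interpret n: prob_space \<nu> by fact
  interpret P: pair_prob_space \<mu> \<nu> ..
  have "sets (\<mu> \<Otimes>\<^sub>M \<nu>) = sets borel"
    unfolding borel_prod[symmetric] by (rule sets_pair_measure_cong[OF assms(3,4)])
  moreover have "distr (\<mu> \<Otimes>\<^sub>M \<nu>) borel fst = \<mu>"
    using n.distr_pair_fst[of \<mu>] distr_cong[OF refl assms(3), of "\<mu> \<Otimes>\<^sub>M \<nu>" fst fst] by simp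
  moreover have "distr (\<mu> \<Otimes>\<^sub>M \<nu>) borel snd = \<nu>"
  proof (rule measure_eqI)
    fix A assume "A \<in> sets (distr (\<mu> \<Otimes>\<^sub>M \<nu>) borel snd)"
    then have A: "A \<in> sets \<nu>" by (simp add: assms(4))
    have "snd \<in> measurable (\<mu> \<Otimes>\<^sub>M \<nu>) borel"
      unfolding measurable_cong_sets[OF refl assms(4)[symmetric]] by (rule measurable_snd)
    then have "emeasure (distr (\<mu> \<Otimes>\<^sub>M \<nu>) borel snd) A = emeasure (\<mu> \<Otimes>\<^sub>M \<nu>) (snd -` A \<inter> space (\<mu> \<Otimes>\<^sub>M \<nu>))"
      using A assms(4) by (intro emeasure_distr) auto
    also have "snd -` A \<inter> space (\<mu> \<Otimes>\<^sub>M \<nu>) = space \<mu> \<times> A"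
      using sets.sets_into_space[OF A] by (auto simp: space_pair_measure)
    also have "emeasure (\<mu> \<Otimes>\<^sub>M \<nu>) (space \<mu> \<times> A) = emeasure \<nu> A"
      using A by (simp add: n.emeasure_pair_measure_Times m.emeasure_space_1)
    finally show "emeasure (distr (\<mu> \<Otimes>\<^sub>M \<nu>) borel snd) A = emeasure \<nu> A" .
  qed (simp add: assms(4))
  ultimately show ?thesis by (simp add: coupling_def P.prob_space_axioms)
qed

text \<open>
  The operator may be computed from any random element with the given distribution, on a product of
  two copies of its probability space and the unit interval.
\<close>

lemma Psi_distr:
  assumes "prob_space N" and X [measurable]: "X \<in> borel_measurable N"
  shows "Psi (distr N borel X) = distr (N \<Otimes>\<^sub>M (N \<Otimes>\<^sub>M U01)) borel
    (\<lambda>p. combine (ln (snd (snd p))) (ln (1 - snd (snd p))) (X (fst p)) (X (fst (snd p))))"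
proof -
  interpret N: prob_space N by fact
  interpret U: prob_space U01 by (rule prob_space_U01)
  interpret D: prob_space "distr N borel X" by (rule N.prob_space_distr) measurable
  interpret DU: pair_prob_space "distr N borel X" U01 ..
  have id: "distr U01 borel (\<lambda>u. u) = U01" by (rule distr_id2) simp
  have [measurable_cong]: "sets U01 = sets borel" by simp
  have "distr N borel X \<Otimes>\<^sub>M U01 = distr (N \<Otimes>\<^sub>M U01) (borel \<Otimes>\<^sub>M borel) (\<lambda>(y, u). (X y, u))"
    using pair_measure_distr[of X N borel "\<lambda>u. u" U01 borel] U.sigma_finite_measure_axioms unfolding id by simp
  then have "distr N borel X \<Otimes>\<^sub>M (distr N borel X \<Otimes>\<^sub>M U01) =
      distr (N \<Otimes>\<^sub>M (N \<Otimes>\<^sub>M U01)) (borel \<Otimes>\<^sub>M (borel \<Otimes>\<^sub>M borel)) (\<lambda>(x, q). (X x, (\<lambda>(y, u). (X y, u)) q))"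
    using pair_measure_distr[of X N borel "\<lambda>(y, u). (X y, u)" "N \<Otimes>\<^sub>M U01" "borel \<Otimes>\<^sub>M borel"]
      DU.sigma_finite_measure_axioms by simp
  then show ?thesis
    unfolding Psi_combine by (simp add: distr_distr comp_def case_prod_unfold)
qed

lemma borel_measurable_energy [measurable]: "energy \<in> borel_measurable borel"
  unfolding energy_def[abs_def] by (intro borel_measurable_continuous_onI continuous_intros)

lemma norm_square_le_energy: "(norm z)\<^sup>2 \<le> energy z"
  and energy_le_norm_square: "energy z \<le> 3 / 2 * (norm z)\<^sup>2"
  by (auto simp: energy_def norm_prod_def)

lemma energy_nonneg: "0 \<le> energy z"
  by (simp add: energy_def)

lemma coupling_moments:
  assumes \<mu>: "\<mu> \<in> centered_laws" and \<nu>: "\<nu> \<in> centered_laws" and c: "coupling \<pi> \<mu> \<nu>"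
  shows "fst \<in> borel_measurable \<pi>" "snd \<in> borel_measurable \<pi>"
    and "integrable \<pi> (\<lambda>p. energy (fst p - snd p))"
    and "integrable \<pi> (\<lambda>p. snd (fst p - snd p))" "(\<integral>p. snd (fst p - snd p) \<partial>\<pi>) = 0"
proof -
  have sets: "sets \<pi> = sets borel" and d: "distr \<pi> borel fst = \<mu>" "distr \<pi> borel snd = \<nu>"
    using c by (auto simp: coupling_def)
  show f: "fst \<in> borel_measurable \<pi>" and s: "snd \<in> borel_measurable \<pi>"
    unfolding measurable_cong_sets[OF sets refl] by (auto intro: borel_measurable_fst borel_measurable_snd)
  note m = centered_laws_moments[OF \<mu>] and n = centered_laws_moments[OF \<nu>]
  have sq: "integrable \<pi> (\<lambda>p. (norm (fst p))\<^sup>2)" "integrable \<pi> (\<lambda>p. (norm (snd p))\<^sup>2)"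
    using m(3) n(3) integrable_distr[OF f, of "\<lambda>z. (norm z)\<^sup>2"] integrable_distr[OF s, of "\<lambda>z. (norm z)\<^sup>2"]
    unfolding d by auto
  have i: "integrable \<pi> (\<lambda>p. snd (fst p))" "integrable \<pi> (\<lambda>p. snd (snd p))"
    using m(4) n(4) integrable_distr[OF f, of snd] integrable_distr[OF s, of snd] unfolding d by auto
  have sm: "snd \<in> borel_measurable (borel :: (c00 \<times> real) measure)" by (rule borel_measurable_snd) simp
  have "(\<integral>p. snd (fst p) \<partial>\<pi>) = 0" "(\<integral>p. snd (snd p) \<partial>\<pi>) = 0"
    using m(5) n(5) integral_distr[OF f sm] integral_distr[OF s sm] unfolding d by auto
  then show "integrable \<pi> (\<lambda>p. snd (fst p - snd p))" "(\<integral>p. snd (fst p - snd p) \<partial>\<pi>) = 0"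
    using i by simp_all
  show "integrable \<pi> (\<lambda>p. energy (fst p - snd p))"
  proof (rule Bochner_Integration.integrable_bound)
    show "integrable \<pi> (\<lambda>p. 3 * ((norm (fst p))\<^sup>2 + (norm (snd p))\<^sup>2))" using sq by simp
    show "(\<lambda>p. energy (fst p - snd p)) \<in> borel_measurable \<pi>"
      using borel_measurable_diff[OF f s] by measurable
    have "energy (z - w) \<le> 3 * ((norm z)\<^sup>2 + (norm w)\<^sup>2)" for z w
    proof -
      have "(norm (z - w))\<^sup>2 \<le> (norm z + norm w)\<^sup>2" by (intro power_mono norm_triangle_ineq4) simp
      also have "\<dots> \<le> 2 * ((norm z)\<^sup>2 + (norm w)\<^sup>2)"
        using sum_squares_bound[of "norm z" "norm w"] by (simp add: power2_sum)
      finally show ?thesis using energy_le_norm_square[of "z - w"] by simp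
    qed
    then show "AE p in \<pi>. norm (energy (fst p - snd p)) \<le> norm (3 * ((norm (fst p))\<^sup>2 + (norm (snd p))\<^sup>2))"
      by (intro AE_I2) (simp add: energy_nonneg)
  qed
qed

text \<open>
  Both copies of the coupled pair are fed into \<^const>\<open>combine\<close> with the same uniform random
  variable. The new pair has the same marginals, because these are fixed points.
\<close>

lemma coupling_step:
  assumes \<mu>: "\<mu> \<in> centered_laws" "Psi \<mu> = \<mu>" and \<nu>: "\<nu> \<in> centered_laws" "Psi \<nu> = \<nu>"
    and c: "coupling \<pi> \<mu> \<nu>"
  shows "\<exists>\<pi>'. coupling \<pi>' \<mu> \<nu> \<and>
    (\<integral>p. energy (fst p - snd p) \<partial>\<pi>') \<le> 3 / 4 * (\<integral>p. energy (fst p - snd p) \<partial>\<pi>)"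
proof -
  have \<pi>: "prob_space \<pi>" and sets [measurable_cong]: "sets \<pi> = sets borel"
    and d: "distr \<pi> borel fst = \<mu>" "distr \<pi> borel snd = \<nu>"
    using c by (auto simp: coupling_def)
  note mom = coupling_moments[OF \<mu>(1) \<nu>(1) c]
  note [measurable] = mom(1,2)
  interpret \<pi>: prob_space \<pi> by fact
  interpret U: prob_space U01 by (rule prob_space_U01)
  define P where "P = \<pi> \<Otimes>\<^sub>M (\<pi> \<Otimes>\<^sub>M U01)"
  have P: "prob_space P" unfolding P_def by (intro prob_space_pair \<pi> prob_space_U01)
  define X where "X s p = combine (ln (snd (snd p))) (ln (1 - snd (snd p))) (s (fst p)) (s (fst (snd p)))"
    for s :: "(c00 \<times> real) \<times> (c00 \<times> real) \<Rightarrow> c00 \<times> real" and p :: "_ \<times> _ \<times> real"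
  have X [measurable]: "X s \<in> borel_measurable P" if [measurable]: "s \<in> borel_measurable \<pi>" for s
    unfolding X_def P_def by measurable
  have marg: "distr P borel (X fst) = \<mu>" "distr P borel (X snd) = \<nu>"
    using Psi_distr[OF \<pi> mom(1)] Psi_distr[OF \<pi> mom(2)] \<mu>(2) \<nu>(2) unfolding d P_def X_def by simp_all
  define \<pi>' where "\<pi>' = distr P borel (\<lambda>p. (X fst p, X snd p))"
  have XX: "(\<lambda>p. (X fst p, X snd p)) \<in> borel_measurable P"
    using X[OF mom(1)] X[OF mom(2)] by (rule borel_measurable_Pair)
  have fs: "fst \<in> borel_measurable (borel :: ((c00 \<times> real) \<times> (c00 \<times> real)) measure)"
    "snd \<in> borel_measurable (borel :: ((c00 \<times> real) \<times> (c00 \<times> real)) measure)"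
    using borel_measurable_fst[of "\<lambda>z. z"] borel_measurable_snd[of "\<lambda>z. z"] by auto
  have "coupling \<pi>' \<mu> \<nu>"
    unfolding coupling_def \<pi>'_def using XX fs marg prob_space.prob_space_distr[OF P XX]
    by (simp add: distr_distr comp_def)
  moreover have "(\<integral>p. energy (fst p - snd p) \<partial>\<pi>') \<le> 3 / 4 * (\<integral>p. energy (fst p - snd p) \<partial>\<pi>)"
  proof -
    define e where "e p = energy (fst p - snd p)" for p :: "(c00 \<times> real) \<times> (c00 \<times> real)"
    define x where "x p = snd (fst p - snd p)" for p :: "(c00 \<times> real) \<times> (c00 \<times> real)"
    have ix: "integrable \<pi> e" "integrable \<pi> x" "integral\<^sup>L \<pi> x = 0"
      unfolding e_def x_def using mom(3-5) by auto
    let ?B = "\<lambda>p. 3 / 8 * (e (fst p) + e (fst (snd p))) + 3 / 8 * (x (fst p) * (x (fst (snd p)) * 1))"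
    note c = integral_triple_coordinates[OF \<pi> \<pi> prob_space_U01, folded P_def]
    have "integrable U01 (\<lambda>_. 1 :: real)" by simp
    note t = integral_triple_product[OF \<pi> \<pi> prob_space_U01 ix(2) ix(2) this, folded P_def]
    have B: "integrable P ?B"
      by (intro Bochner_Integration.integrable_add integrable_mult_right c ix t)
    have le: "energy (X fst p - X snd p) \<le> ?B p" for p
      using energy_combine_diff unfolding X_def e_def x_def by simp
    have [measurable]: "(\<lambda>p. energy (X fst p - X snd p)) \<in> borel_measurable P"
      using borel_measurable_diff[OF X[OF mom(1)] X[OF mom(2)]] by measurable
    have int: "integrable P (\<lambda>p. energy (X fst p - X snd p))"
    proof (rule Bochner_Integration.integrable_bound[OF B])
      show "AE p in P. norm (energy (X fst p - X snd p)) \<le> norm (?B p)"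
      proof (rule AE_I2)
        fix p
        show "norm (energy (X fst p - X snd p)) \<le> norm (?B p)"
          using order_trans[OF le abs_ge_self] by (simp only: real_norm_def abs_of_nonneg[OF energy_nonneg])
      qed
    qed measurable
    have "(\<integral>p. energy (fst p - snd p) \<partial>\<pi>') = (\<integral>p. energy (X fst p - X snd p) \<partial>P)"
      unfolding \<pi>'_def using XX borel_measurable_diff[OF fs] by (subst integral_distr) auto
    also have "\<dots> \<le> (\<integral>p. ?B p \<partial>P)"
      by (rule integral_mono[OF int B le])
    also have "\<dots> = 3 / 8 * (integral\<^sup>L \<pi> e + integral\<^sup>L \<pi> e) + 3 / 8 * 0"
      using c(1,2)[OF ix(1)] c(4,5)[OF ix(1)] t ix(3) by simp
    finally show ?thesis unfolding e_def by simp
  qed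
  ultimately show ?thesis by blast
qed

lemma fixed_point_unique:
  assumes \<mu>: "\<mu> \<in> centered_laws" "Psi \<mu> = \<mu>" and \<nu>: "\<nu> \<in> centered_laws" "Psi \<nu> = \<nu>"
  shows "\<mu> = \<nu>"
proof (rule measure_eqI_lipschitz)
  note m = centered_laws_moments[OF \<mu>(1)] and n = centered_laws_moments[OF \<nu>(1)]
  show "prob_space \<mu>" "prob_space \<nu>" "sets \<mu> = sets borel" "sets \<nu> = sets borel" by fact+
  define C where "C = (\<integral>p. energy (fst p - snd p) \<partial>(\<mu> \<Otimes>\<^sub>M \<nu>))"
  have ex: "\<exists>\<pi>. coupling \<pi> \<mu> \<nu> \<and> (\<integral>p. energy (fst p - snd p) \<partial>\<pi>) \<le> (3 / 4) ^ k * C" for k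
  proof (induction k)
    case 0
    then show ?case using coupling_independent[OF m(1) n(1) m(2) n(2)] by (auto simp: C_def)
  next
    case (Suc k)
    then obtain \<pi> where "coupling \<pi> \<mu> \<nu>" and le: "(\<integral>p. energy (fst p - snd p) \<partial>\<pi>) \<le> (3 / 4) ^ k * C" by blast
    from coupling_step[OF \<mu> \<nu> this(1)] obtain \<pi>' where c: "coupling \<pi>' \<mu> \<nu>" and
      "(\<integral>p. energy (fst p - snd p) \<partial>\<pi>') \<le> 3 / 4 * (\<integral>p. energy (fst p - snd p) \<partial>\<pi>)" by blast
    note this(2)
    also have "3 / 4 * (\<integral>p. energy (fst p - snd p) \<partial>\<pi>) \<le> 3 / 4 * ((3 / 4) ^ k * C)"
      using le by (intro mult_left_mono) auto
    finally show ?case using c by (intro exI[of _ \<pi>']) simp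
  qed
  fix g :: "c00 \<times> real \<Rightarrow> real" and L
  assume L: "\<And>x y. \<bar>g x - g y\<bar> \<le> L * dist x y" and g01: "\<And>x. 0 \<le> g x" "\<And>x. g x \<le> 1"
  have "continuous_on UNIV g"
  proof (rule lipschitz_on_continuous_on[of "\<bar>L\<bar>"], rule lipschitz_onI)
    show "dist (g x) (g y) \<le> \<bar>L\<bar> * dist x y" for x y
      using L[of x y] mult_right_mono[OF abs_ge_self[of L], of "dist x y"] by (simp add: dist_real_def)
  qed simp
  then have gm [measurable]: "g \<in> borel_measurable borel" by (rule borel_measurable_continuous_onI)
  have bound: "\<bar>(\<integral>x. g x \<partial>\<mu>) - (\<integral>x. g x \<partial>\<nu>)\<bar> \<le> \<bar>L\<bar> * sqrt ((3 / 4) ^ k * C)" for k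
  proof -
    obtain \<pi> where c: "coupling \<pi> \<mu> \<nu>" and le: "(\<integral>p. energy (fst p - snd p) \<partial>\<pi>) \<le> (3 / 4) ^ k * C"
      using ex by blast
    have \<pi>: "prob_space \<pi>" and d: "distr \<pi> borel fst = \<mu>" "distr \<pi> borel snd = \<nu>"
      using c by (auto simp: coupling_def)
    interpret prob_space \<pi> by fact
    note mom = coupling_moments[OF \<mu>(1) \<nu>(1) c]
    note [measurable] = mom(1,2)
    have diff [measurable]: "(\<lambda>p. fst p - snd p) \<in> borel_measurable \<pi>"
      using borel_measurable_diff[OF mom(1,2)] .
    have i: "integrable \<pi> (\<lambda>p. g (fst p))" "integrable \<pi> (\<lambda>p. g (snd p))"
      using g01 by (auto intro!: integrable_const_bound[where B = 1])
    have sq: "integrable \<pi> (\<lambda>p. (norm (fst p - snd p))\<^sup>2)"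
      by (rule Bochner_Integration.integrable_bound[OF mom(3)])
         (auto intro!: AE_I2 order_trans[OF norm_square_le_energy abs_ge_self])
    have n1: "integrable \<pi> (\<lambda>p. norm (fst p - snd p))"
      by (rule integrable_square_imp_integrable[OF _ sq]) measurable
    have "(\<integral>x. g x \<partial>\<mu>) - (\<integral>x. g x \<partial>\<nu>) = (\<integral>p. g (fst p) - g (snd p) \<partial>\<pi>)"
      unfolding d[symmetric] using i by (simp add: integral_distr)
    also have "\<bar>\<dots>\<bar> \<le> (\<integral>p. \<bar>g (fst p) - g (snd p)\<bar> \<partial>\<pi>)" by (rule integral_abs_bound)
    also have "\<dots> \<le> (\<integral>p. \<bar>L\<bar> * norm (fst p - snd p) \<partial>\<pi>)"
    proof (rule integral_mono)
      show "\<bar>g (fst p) - g (snd p)\<bar> \<le> \<bar>L\<bar> * norm (fst p - snd p)" for p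
        using L[of "fst p" "snd p"] mult_right_mono[OF abs_ge_self[of L], of "norm (fst p - snd p)"]
        by (simp add: dist_norm)
    qed (use i n1 in auto)
    also have "\<dots> = \<bar>L\<bar> * (\<integral>p. norm (fst p - snd p) \<partial>\<pi>)" by simp
    also have "\<dots> \<le> \<bar>L\<bar> * sqrt ((3 / 4) ^ k * C)"
    proof (intro mult_left_mono)
      have "(\<integral>p. norm (fst p - snd p) \<partial>\<pi>) \<le> sqrt (\<integral>p. (norm (fst p - snd p))\<^sup>2 \<partial>\<pi>)"
        by (rule expectation_le_sqrt[OF n1 sq])
      also have "\<dots> \<le> sqrt (\<integral>p. energy (fst p - snd p) \<partial>\<pi>)"
        by (intro real_sqrt_le_mono integral_mono sq mom(3) norm_square_le_energy)
      also have "\<dots> \<le> sqrt ((3 / 4) ^ k * C)" using le by (rule real_sqrt_le_mono)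
      finally show "(\<integral>p. norm (fst p - snd p) \<partial>\<pi>) \<le> sqrt ((3 / 4) ^ k * C)" .
    qed simp
    finally show ?thesis .
  qed
  have "(\<lambda>k. \<bar>L\<bar> * sqrt ((3 / 4) ^ k * C)) \<longlonglongrightarrow> \<bar>L\<bar> * sqrt (0 * C)"
    by (intro tendsto_intros LIMSEQ_power_zero) auto
  then have "\<bar>(\<integral>x. g x \<partial>\<mu>) - (\<integral>x. g x \<partial>\<nu>)\<bar> \<le> \<bar>L\<bar> * sqrt (0 * C)"
    by (rule LIMSEQ_le_const) (use bound in blast)
  then show "(\<integral>x. g x \<partial>\<mu>) = (\<integral>x. g x \<partial>\<nu>)" by simp
qed

section \<open>The recursion for standardized trees\<close>

lemma subtree_join: "subtree (root_join L R) [False] = L" "subtree (root_join L R) [True] = R"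
  by (auto simp: subtree_def)

lemma binary_tree_join:
  assumes "binary_tree L" "binary_tree R"
  shows "binary_tree (root_join L R)"
  unfolding binary_tree_def
proof (intro conjI allI impI)
  show "finite (root_join L R)" using assms by (simp add: root_join_def binary_tree_def)
  fix u b assume u: "u @ [b] \<in> root_join L R"
  show "u \<in> root_join L R"
  proof (cases u)
    case (Cons c v)
    then show ?thesis using u assms by (cases c) (auto simp: binary_tree_def)
  qed simp
qed

lemma card_join: "finite L \<Longrightarrow> finite R \<Longrightarrow> card (root_join L R) = Suc (card L + card R)"
proof -
  assume "finite L" "finite R"
  moreover from this have "card (root_join L R) = Suc (card ((#) False ` L \<union> (#) True ` R))"
    unfolding root_join_def by (subst card_insert_disjoint) auto
  ultimately show ?thesis by (subst (asm) card_Un_disjoint) (auto simp: card_image)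
qed

text \<open>
  The exact counterpart, for given sizes of the subtrees, of the random map in the fixed-point
  operator.
\<close>

lemma standardized_join:
  assumes "binary_tree L" "binary_tree R"
  shows "standardized (root_join L R) =
    combine (harm (card L) - harm (Suc (card L + card R))) (harm (card R) - harm (Suc (card L + card R)))
      (standardized L) (standardized R)"
proof -
  have fin: "finite L" "finite R" using assms by (auto simp: binary_tree_def)
  note bt = binary_tree_join[OF assms]
  have "finite (root_join L R)" using bt by (simp add: binary_tree_def)
  from eta_split[OF this] have eta: "eta (root_join L R) = 1 + 1 / 2 * (eta L + eta R)" by (simp add: subtree_join)
  show ?thesis
    unfolding standardized_def combine_def centered_eta_def card_join[OF fin] eta
      centered_int_silhouette_split[OF bt] subtree_join
    by (simp add: field_simps)
qed

section \<open>The limit law is a fixed point\<close>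

text \<open>
  The toll terms converge: \<open>harm k - ln k\<close> has a limit, which cancels.
\<close>

lemma harm_diff_tendsto_ln:
  fixes k :: "nat \<Rightarrow> nat"
  assumes lim: "(\<lambda>n. real (k n) / real (Suc n)) \<longlonglongrightarrow> v" and v: "v > 0"
  shows "filterlim k at_top sequentially" "(\<lambda>n. harm (k n) - harm (Suc n) :: real) \<longlonglongrightarrow> ln v"
proof -
  have "filterlim (\<lambda>n. real (Suc n)) at_top sequentially"
    using filterlim_compose[OF filterlim_real_sequentially filterlim_Suc] by simp
  then have "filterlim (\<lambda>n. real (k n) / real (Suc n) * real (Suc n)) at_top sequentially"
    by (rule filterlim_tendsto_pos_mult_at_top[OF lim v])
  then have "filterlim (\<lambda>n. real (k n)) at_top sequentially" by simp
  then show k: "filterlim k at_top sequentially" by (simp add: filterlim_sequentially_iff_filterlim_real)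
  have "(\<lambda>n. (harm (k n) - ln (real (k n))) - (harm (Suc n) - ln (real (Suc n))) + ln (real (k n) / real (Suc n)))
      \<longlonglongrightarrow> (euler_mascheroni - euler_mascheroni) + ln v"
    using v by (intro tendsto_add tendsto_diff tendsto_ln lim filterlim_compose[OF euler_mascheroni_LIMSEQ k]
        filterlim_compose[OF euler_mascheroni_LIMSEQ filterlim_Suc]) auto
  moreover have "\<forall>\<^sub>F n in sequentially. (harm (k n) - ln (real (k n))) - (harm (Suc n) - ln (real (Suc n)))
      + ln (real (k n) / real (Suc n)) = harm (k n) - harm (Suc n)"
    using eventually_compose_filterlim[OF eventually_gt_at_top[of 0] k]
    by eventually_elim (simp add: ln_div)
  ultimately show "(\<lambda>n. harm (k n) - harm (Suc n) :: real) \<longlonglongrightarrow> ln v"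
    by (subst (asm) tendsto_cong) auto
qed

text \<open>The index \<open>\<lfloor>N u\<rfloor>\<close> is uniformly distributed on the numbers below \<open>N\<close> if \<open>u\<close> is uniform.\<close>

lemma integral_floor_U01:
  fixes F :: "nat \<Rightarrow> real"
  assumes N: "N > 0"
  shows "(\<integral>u. F (nat \<lfloor>real N * u\<rfloor>) \<partial>U01) = (\<Sum>i<N. F i) / real N"
proof -
  have "(\<integral>u. F (nat \<lfloor>real N * u\<rfloor>) \<partial>U01) = (\<integral>u. indicator {0<..<1} u * F (nat \<lfloor>real N * u\<rfloor>) \<partial>lborel)"
    by (rule integral_U01) measurable
  also have "\<dots> = (\<integral>u. (\<Sum>i<N. F i * indicator {real i / real N..<real (Suc i) / real N} u) \<partial>lborel)"
  proof (rule integral_cong_AE)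
    show "AE u in lborel. indicator {0<..<1} u * F (nat \<lfloor>real N * u\<rfloor>) =
        (\<Sum>i<N. F i * indicator {real i / real N..<real (Suc i) / real N} u)"
      using AE_lborel_singleton[of 0]
    proof eventually_elim
      fix u :: real assume u0: "u \<noteq> 0"
      have iff: "u \<in> {real i / real N..<real (Suc i) / real N} \<longleftrightarrow> u \<ge> 0 \<and> i = nat \<lfloor>real N * u\<rfloor>" for i
      proof -
        have "u \<in> {real i / real N..<real (Suc i) / real N} \<longleftrightarrow> real i \<le> real N * u \<and> real N * u < real i + 1"
          using N by (auto simp: field_simps)
        also have "\<dots> \<longleftrightarrow> \<lfloor>real N * u\<rfloor> = int i" by (auto simp: floor_eq_iff)
        also have "\<dots> \<longleftrightarrow> u \<ge> 0 \<and> i = nat \<lfloor>real N * u\<rfloor>"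
        proof
          assume a: "\<lfloor>real N * u\<rfloor> = int i"
          then have "0 \<le> real N * u" by (metis of_nat_0_le_iff zero_le_floor)
          then show "u \<ge> 0 \<and> i = nat \<lfloor>real N * u\<rfloor>" using a N by (simp add: zero_le_mult_iff)
        qed simp
        finally show ?thesis .
      qed
      have "(\<Sum>i<N. F i * indicator {real i / real N..<real (Suc i) / real N} u) =
          (\<Sum>i<N. if i = nat \<lfloor>real N * u\<rfloor> then (if u \<ge> 0 then F i else 0) else 0)"
        by (intro sum.cong refl) (simp only: indicator_def iff, simp)
      also have "\<dots> = (if nat \<lfloor>real N * u\<rfloor> < N \<and> u \<ge> 0 then F (nat \<lfloor>real N * u\<rfloor>) else 0)"
        by simp
      also have "\<dots> = indicator {0<..<1} u * F (nat \<lfloor>real N * u\<rfloor>)"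
      proof (cases "u > 0")
        case True
        have "nat \<lfloor>real N * u\<rfloor> < N \<longleftrightarrow> real N * u < real N" using N True by (simp add: nat_less_iff floor_less_iff)
        also have "\<dots> \<longleftrightarrow> u < 1" using N by simp
        finally show ?thesis using True by (simp add: indicator_def)
      qed (use u0 in \<open>simp add: indicator_def\<close>)
      finally show "indicator {0<..<1} u * F (nat \<lfloor>real N * u\<rfloor>) =
        (\<Sum>i<N. F i * indicator {real i / real N..<real (Suc i) / real N} u)" ..
    qed
  qed measurable
  also have "\<dots> = (\<Sum>i<N. F i * (real (Suc i) / real N - real i / real N))"
    using N by (subst Bochner_Integration.integral_sum) (auto simp: divide_right_mono)
  also have "\<dots> = (\<Sum>i<N. F i) / real N"
    by (simp add: sum_divide_distrib flip: diff_divide_distrib)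
  finally show ?thesis .
qed

text \<open>
  Fubini's theorem, with the last coordinate integrated last.
\<close>

lemma integral_triple_swap:
  fixes F :: "'a \<times> 'b \<times> 'c \<Rightarrow> real"
  assumes "prob_space A" "prob_space B" "prob_space C"
    and meas [measurable]: "F \<in> borel_measurable (A \<Otimes>\<^sub>M (B \<Otimes>\<^sub>M C))" and bound: "\<And>p. \<bar>F p\<bar> \<le> b"
  shows "(\<integral>p. F p \<partial>(A \<Otimes>\<^sub>M (B \<Otimes>\<^sub>M C))) = (\<integral>z. (\<integral>q. F (fst q, snd q, z) \<partial>(A \<Otimes>\<^sub>M B)) \<partial>C)"
    and "(\<lambda>z. \<integral>q. F (fst q, snd q, z) \<partial>(A \<Otimes>\<^sub>M B)) \<in> borel_measurable C"
proof -
  interpret A: prob_space A by fact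
  interpret B: prob_space B by fact
  interpret C: prob_space C by fact
  interpret AB: pair_prob_space A B ..
  interpret BC: pair_prob_space B C ..
  interpret AC: pair_prob_space A C ..
  interpret ABC: pair_prob_space A "B \<Otimes>\<^sub>M C" ..
  show "(\<lambda>z. \<integral>q. F (fst q, snd q, z) \<partial>(A \<Otimes>\<^sub>M B)) \<in> borel_measurable C"
    by measurable
  have b0: "0 \<le> b" by (rule order_trans[OF abs_ge_zero bound])
  have int: "integrable (A \<Otimes>\<^sub>M (B \<Otimes>\<^sub>M C)) F"
    using bound by (intro ABC.P.integrable_const_bound[where B = b]) auto
  have intx: "integrable (B \<Otimes>\<^sub>M C) (\<lambda>q. F (x, q))" if "x \<in> space A" for x
    using bound that by (intro BC.P.integrable_const_bound[where B = b]) auto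
  have intz: "integrable (A \<Otimes>\<^sub>M B) (\<lambda>q. F (fst q, snd q, z))" if "z \<in> space C" for z
    using bound that by (intro AB.P.integrable_const_bound[where B = b]) auto
  have intxz: "integrable (A \<Otimes>\<^sub>M C) (\<lambda>(x, z). \<integral>y. F (x, y, z) \<partial>B)"
  proof (rule AC.P.integrable_const_bound[where B = b])
    have "\<bar>\<integral>y. F (x, y, z) \<partial>B\<bar> \<le> b" if "x \<in> space A" "z \<in> space C" for x z
    proof -
      have "\<bar>\<integral>y. F (x, y, z) \<partial>B\<bar> \<le> (\<integral>y. \<bar>F (x, y, z)\<bar> \<partial>B)" by (rule integral_abs_bound)
      also have "\<dots> \<le> (\<integral>y. b \<partial>B)"
        using bound that b0 by (intro integral_mono B.integrable_const_bound[where B = b]) auto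
      finally show ?thesis by (simp add: B.prob_space)
    qed
    then show "AE q in A \<Otimes>\<^sub>M C. norm (case q of (x, z) \<Rightarrow> \<integral>y. F (x, y, z) \<partial>B) \<le> b"
      by (intro AE_I2) (auto simp: space_pair_measure)
  qed measurable
  have "(\<integral>p. F p \<partial>(A \<Otimes>\<^sub>M (B \<Otimes>\<^sub>M C))) = (\<integral>x. (\<integral>q. F (x, q) \<partial>(B \<Otimes>\<^sub>M C)) \<partial>A)"
    by (rule ABC.integral_fst'[OF int, symmetric])
  also have "\<dots> = (\<integral>x. (\<integral>z. (\<integral>y. F (x, y, z) \<partial>B) \<partial>C) \<partial>A)"
  proof (rule Bochner_Integration.integral_cong[OF refl])
    fix x assume "x \<in> space A"
    then show "(\<integral>q. F (x, q) \<partial>(B \<Otimes>\<^sub>M C)) = (\<integral>z. (\<integral>y. F (x, y, z) \<partial>B) \<partial>C)"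
      using BC.integral_snd[of "\<lambda>y z. F (x, y, z)"] intx by (simp add: case_prod_unfold)
  qed
  also have "\<dots> = (\<integral>z. (\<integral>x. (\<integral>y. F (x, y, z) \<partial>B) \<partial>A) \<partial>C)"
    by (rule AC.Fubini_integral[OF intxz, symmetric])
  also have "\<dots> = (\<integral>z. (\<integral>q. F (fst q, snd q, z) \<partial>(A \<Otimes>\<^sub>M B)) \<partial>C)"
  proof (rule Bochner_Integration.integral_cong[OF refl])
    fix z assume "z \<in> space C"
    then show "(\<integral>x. (\<integral>y. F (x, y, z) \<partial>B) \<partial>A) = (\<integral>q. F (fst q, snd q, z) \<partial>(A \<Otimes>\<^sub>M B))"
      using AB.integral_fst'[OF intz] by simp
  qed
  finally show "(\<integral>p. F p \<partial>(A \<Otimes>\<^sub>M (B \<Otimes>\<^sub>M C))) = (\<integral>z. (\<integral>q. F (fst q, snd q, z) \<partial>(A \<Otimes>\<^sub>M B)) \<partial>C)" .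
qed

context uniform_input
begin

text \<open>
  The mean of \<open>g\<close> for standardized trees with \<open>n + 1\<close> nodes, given that \<open>i\<close> of them are to the
  left of the root. The two subtrees are independent, hence the product space.
\<close>

definition split_mean :: "(c00 \<times> real \<Rightarrow> real) \<Rightarrow> nat \<Rightarrow> nat \<Rightarrow> real" where
  "split_mean g n i = (\<integral>q. g (combine (harm i - harm (Suc n)) (harm (n - i) - harm (Suc n))
    (std_tree i (fst q)) (std_tree (n - i) (snd q))) \<partial>(M \<Otimes>\<^sub>M M))"

text \<open>
  The random split size is realized as a function of a uniform random variable.
\<close>

lemma expectation_std_tree_Suc:
  assumes g [measurable]: "g \<in> borel_measurable borel" and b: "\<And>z. \<bar>g z\<bar> \<le> b"
  shows "expectation (\<lambda>\<omega>. g (std_tree (Suc n) \<omega>)) = (\<integral>u. split_mean g n (nat \<lfloor>real (Suc n) * u\<rfloor>) \<partial>U01)"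
proof -
  interpret MM: pair_prob_space M M ..
  have split: "mean i (\<lambda>l. mean (n - i) (\<lambda>r. g (standardized (root_join (set l) (set r))))) = split_mean g n i"
    if i: "i \<le> n" for i
  proof -
    let ?c = "combine (harm i - harm (Suc n)) (harm (n - i) - harm (Suc n))"
    have "mean i (\<lambda>l. mean (n - i) (\<lambda>r. g (standardized (root_join (set l) (set r))))) =
        mean i (\<lambda>l. mean (n - i) (\<lambda>r. g (?c (standardized (set l)) (standardized (set r)))))"
    proof (intro mean_cong)
      fix l r assume l: "l \<in> histories i" and r: "r \<in> histories (n - i)"
      have "card (set l) = i" "card (set r) = n - i"
        using l r by (simp_all add: distinct_card histories_distinct histories_length)
      then show "g (standardized (root_join (set l) (set r))) = g (?c (standardized (set l)) (standardized (set r)))"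
        using i standardized_join[OF histories_binary_tree[OF l] histories_binary_tree[OF r]] by simp
    qed
    also have "\<dots> = (\<integral>\<omega>. (\<integral>\<omega>'. g (?c (std_tree i \<omega>) (std_tree (n - i) \<omega>')) \<partial>M) \<partial>M)"
      unfolding expectation_random_history[symmetric] std_tree_def ..
    also have "\<dots> = split_mean g n i"
      unfolding split_mean_def
    proof (subst MM.integral_fst'[symmetric])
      show "integrable (M \<Otimes>\<^sub>M M) (\<lambda>q. g (?c (std_tree i (fst q)) (std_tree (n - i) (snd q))))"
        using b by (intro MM.P.integrable_const_bound[where B = b]) auto
    qed simp
    finally show ?thesis .
  qed
  have "expectation (\<lambda>\<omega>. g (std_tree (Suc n) \<omega>)) = mean (Suc n) (\<lambda>l. g (standardized (set l)))"
    unfolding std_tree_def by (rule expectation_random_history)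
  also have "\<dots> = (\<Sum>i\<le>n. split_mean g n i) / real (Suc n)"
    unfolding mean_join[of n "\<lambda>T. g (standardized T)"]
    by (intro arg_cong2[where f = "(/)"] sum.cong refl split) simp
  also have "\<dots> = (\<integral>u. split_mean g n (nat \<lfloor>real (Suc n) * u\<rfloor>) \<partial>U01)"
    by (simp only: integral_floor_U01[of "Suc n"] lessThan_Suc_atMost zero_less_Suc)
  finally show ?thesis .
qed

lemma split_mean_tendsto:
  fixes g :: "c00 \<times> real \<Rightarrow> real"
  assumes Y [measurable]: "Y \<in> borel_measurable M" and int: "\<And>n. integrable M (\<lambda>\<omega>. std_tree n \<omega> - Y \<omega>)"
    and lim: "(\<lambda>n. expectation (\<lambda>\<omega>. norm (std_tree n \<omega> - Y \<omega>))) \<longlonglongrightarrow> 0"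
    and g: "continuous_on UNIV g" "bounded (range g)"
    and u: "0 < u" "u < 1"
  shows "(\<lambda>n. split_mean g n (nat \<lfloor>real (Suc n) * u\<rfloor>)) \<longlonglongrightarrow>
    (\<integral>q. g (combine (ln u) (ln (1 - u)) (Y (fst q)) (Y (snd q))) \<partial>(M \<Otimes>\<^sub>M M))"
proof -
  interpret MM: pair_prob_space M M ..
  define k where "k n = nat \<lfloor>real (Suc n) * u\<rfloor>" for n
  have kn: "k n \<le> n" for n
  proof -
    have "real (Suc n) * u < real (Suc n)" using u by simp
    then have "\<lfloor>real (Suc n) * u\<rfloor> < int (Suc n)" by (simp add: floor_less_iff)
    then show ?thesis by (simp add: k_def)
  qed
  have kr: "real (k n) = of_int \<lfloor>real (Suc n) * u\<rfloor>" for n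
    unfolding k_def using u by simp
  have k1: "(\<lambda>n. real (k n) / real (Suc n)) \<longlonglongrightarrow> u"
    unfolding kr using u by real_asymp
  have k2: "(\<lambda>n. real (n - k n) / real (Suc n)) \<longlonglongrightarrow> 1 - u"
  proof -
    have "(\<lambda>n. real n / real (Suc n) - real (k n) / real (Suc n)) \<longlonglongrightarrow> 1 - u"
      by (intro tendsto_diff k1) real_asymp
    then show ?thesis using kn by (simp add: of_nat_diff diff_divide_distrib)
  qed
  note h1 = harm_diff_tendsto_ln[OF k1 u(1)]
  have "1 - u > 0" using u by simp
  note h2 = harm_diff_tendsto_ln[OF k2 this]
  define a where "a n = (harm (k n) - harm (Suc n) :: real)" for n
  define b where "b n = (harm (n - k n) - harm (Suc n) :: real)" for n
  define X where "X n q = combine (a n) (b n) (std_tree (k n) (fst q)) (std_tree (n - k n) (snd q))" for n and q :: "'a \<times> 'a"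
  define X' where "X' q = combine (ln u) (ln (1 - u)) (Y (fst q)) (Y (snd q))" for q :: "'a \<times> 'a"
  have X [measurable]: "X n \<in> borel_measurable (M \<Otimes>\<^sub>M M)" for n unfolding X_def by measurable
  have X' [measurable]: "X' \<in> borel_measurable (M \<Otimes>\<^sub>M M)" unfolding X'_def by measurable
  have dm [measurable]: "(\<lambda>q. X n q - X' q) \<in> borel_measurable (M \<Otimes>\<^sub>M M)" for n
    by (rule borel_measurable_diff[OF X X'])
  define D where "D n q = 2 * (norm (std_tree (k n) (fst q) - Y (fst q)) + norm (std_tree (n - k n) (snd q) - Y (snd q))
      + \<bar>a n - ln u\<bar> + \<bar>b n - ln (1 - u)\<bar>)" for n and q :: "'a \<times> 'a"
  have le: "norm (X n q - X' q) \<le> D n q" for n q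
    unfolding X_def X'_def D_def by (rule combine_lipschitz)
  have int1: "integrable M (\<lambda>\<omega>. norm (std_tree n \<omega> - Y \<omega>))" for n using int by simp
  have one: "integrable M (\<lambda>_. 1 :: real)" by simp
  note p1 = integral_pair_product[OF prob_space_axioms prob_space_axioms int1 one, simplified prob_space mult_1_right]
  note p2 = integral_pair_product[OF prob_space_axioms prob_space_axioms one int1, simplified prob_space mult_1_left]
  have D: "integrable (M \<Otimes>\<^sub>M M) (D n)" for n
    unfolding D_def using p1(1)[of "k n"] p2(1)[of "n - k n"] by (intro integrable_mult_right Bochner_Integration.integrable_add) (simp_all add: prob_space)
  have ED: "(\<integral>q. D n q \<partial>(M \<Otimes>\<^sub>M M)) = 2 * (expectation (\<lambda>\<omega>. norm (std_tree (k n) \<omega> - Y \<omega>))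
      + expectation (\<lambda>\<omega>. norm (std_tree (n - k n) \<omega> - Y \<omega>)) + \<bar>a n - ln u\<bar> + \<bar>b n - ln (1 - u)\<bar>)" for n
    unfolding D_def using p1[of "k n"] p2[of "n - k n"] by (simp add: prob_space MM.P.prob_space)
  have intX: "integrable (M \<Otimes>\<^sub>M M) (\<lambda>q. X n q - X' q)" for n
  proof (rule Bochner_Integration.integrable_bound[OF D[of n] dm])
    show "AE q in M \<Otimes>\<^sub>M M. norm (X n q - X' q) \<le> norm (D n q)"
      using order_trans[OF le abs_ge_self] by (intro AE_I2) (simp only: real_norm_def)
  qed
  have "(\<lambda>n. \<integral>q. g (X n q) \<partial>(M \<Otimes>\<^sub>M M)) \<longlonglongrightarrow> (\<integral>q. g (X' q) \<partial>(M \<Otimes>\<^sub>M M))"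
  proof (rule MM.P.tendsto_expectation_bounded_continuous[OF X X' intX _ g])
    show "(\<lambda>n. \<integral>q. norm (X n q - X' q) \<partial>(M \<Otimes>\<^sub>M M)) \<longlonglongrightarrow> 0"
    proof (rule tendsto_sandwich[of "\<lambda>_. 0" _ _ "\<lambda>n. \<integral>q. D n q \<partial>(M \<Otimes>\<^sub>M M)"])
      show "\<forall>\<^sub>F n in sequentially. (\<integral>q. norm (X n q - X' q) \<partial>(M \<Otimes>\<^sub>M M)) \<le> (\<integral>q. D n q \<partial>(M \<Otimes>\<^sub>M M))"
        by (intro always_eventually allI integral_mono integrable_norm intX D le)
      have "(\<lambda>n. \<integral>q. D n q \<partial>(M \<Otimes>\<^sub>M M)) \<longlonglongrightarrow> 2 * (0 + 0 + \<bar>ln u - ln u\<bar> + \<bar>ln (1 - u) - ln (1 - u)\<bar>)"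
        unfolding ED using h1(2) h2(2) unfolding a_def[symmetric] b_def[symmetric]
        by (intro tendsto_intros filterlim_compose[OF lim h1(1)] filterlim_compose[OF lim h2(1)])
      then show "(\<lambda>n. \<integral>q. D n q \<partial>(M \<Otimes>\<^sub>M M)) \<longlonglongrightarrow> 0" by simp
    qed auto
  qed
  then show ?thesis unfolding X_def X'_def split_mean_def k_def[symmetric] a_def b_def .
qed

text \<open>
  Both sides of the recursion for the expectation of a bounded Lipschitz function converge, the right
  hand side by dominated convergence in \<open>u\<close>.
\<close>

lemma Psi_limit_law:
  assumes Y [measurable]: "Y \<in> borel_measurable M" and sq: "integrable M (\<lambda>\<omega>. (norm (Y \<omega>))\<^sup>2)"
    and int: "\<And>n. integrable M (\<lambda>\<omega>. std_tree n \<omega> - Y \<omega>)"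
    and lim: "(\<lambda>n. expectation (\<lambda>\<omega>. norm (std_tree n \<omega> - Y \<omega>))) \<longlonglongrightarrow> 0"
  shows "distr M borel Y \<in> centered_laws" "Psi (distr M borel Y) = distr M borel Y"
proof -
  show law: "distr M borel Y \<in> centered_laws"
    by (rule distr_in_centered_laws[OF prob_space_axioms Y sq expectation_snd_limit[OF Y int lim]])
  note Psi_law = Psi_in_centered_laws[OF law]
  show "Psi (distr M borel Y) = distr M borel Y"
  proof (rule measure_eqI_lipschitz)
    show "prob_space (Psi (distr M borel Y))" "sets (Psi (distr M borel Y)) = sets borel"
      "prob_space (distr M borel Y)" "sets (distr M borel Y) = sets borel"
      using centered_laws_moments(1,2)[OF law] centered_laws_moments(1,2)[OF Psi_law] by auto
    fix g :: "c00 \<times> real \<Rightarrow> real" and L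
    assume L: "\<And>x y. \<bar>g x - g y\<bar> \<le> L * dist x y" and g01: "\<And>x. 0 \<le> g x" "\<And>x. g x \<le> 1"
    have cont: "continuous_on UNIV g"
    proof (rule lipschitz_on_continuous_on[of "\<bar>L\<bar>"], rule lipschitz_onI)
      show "dist (g x) (g y) \<le> \<bar>L\<bar> * dist x y" for x y
        using L[of x y] mult_right_mono[OF abs_ge_self[of L], of "dist x y"] by (simp add: dist_real_def)
    qed simp
    then have gm [measurable]: "g \<in> borel_measurable borel" by (rule borel_measurable_continuous_onI)
    have g1: "\<bar>g z\<bar> \<le> 1" for z using g01[of z] by simp
    have bdd: "bounded (range g)" using g1 by (auto intro!: boundedI)
    let ?F = "\<lambda>p. g (combine (ln (snd (snd p))) (ln (1 - snd (snd p))) (Y (fst p)) (Y (fst (snd p))))"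
    let ?c = "\<lambda>u. \<integral>q. ?F (fst q, snd q, u) \<partial>(M \<Otimes>\<^sub>M M)"
    interpret U: prob_space U01 by (rule prob_space_U01)
    interpret MM: pair_prob_space M M ..
    have Fm: "?F \<in> borel_measurable (M \<Otimes>\<^sub>M (M \<Otimes>\<^sub>M U01))" by measurable
    have "(\<integral>z. g z \<partial>Psi (distr M borel Y)) = (\<integral>p. ?F p \<partial>(M \<Otimes>\<^sub>M (M \<Otimes>\<^sub>M U01)))"
      unfolding Psi_distr[OF prob_space_axioms Y] by (rule integral_distr) measurable
    also have "\<dots> = (\<integral>u. ?c u \<partial>U01)"
      by (rule integral_triple_swap(1)[OF prob_space_axioms prob_space_axioms prob_space_U01 Fm g1])
    finally have Psi_g: "(\<integral>z. g z \<partial>Psi (distr M borel Y)) = (\<integral>u. ?c u \<partial>U01)" .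
    have cm: "?c \<in> borel_measurable U01"
      by (rule integral_triple_swap(2)[OF prob_space_axioms prob_space_axioms prob_space_U01 Fm g1])
    have "(\<lambda>n. \<integral>u. split_mean g n (nat \<lfloor>real (Suc n) * u\<rfloor>) \<partial>U01) \<longlonglongrightarrow> (\<integral>u. ?c u \<partial>U01)"
    proof (rule integral_dominated_convergence[where w = "\<lambda>_. 1"])
      show "?c \<in> borel_measurable U01" by (rule cm)
      show "(\<lambda>u. split_mean g n (nat \<lfloor>real (Suc n) * u\<rfloor>)) \<in> borel_measurable U01" for n by measurable
      show "AE u in U01. (\<lambda>n. split_mean g n (nat \<lfloor>real (Suc n) * u\<rfloor>)) \<longlonglongrightarrow> ?c u"
        using AE_U01
      proof eventually_elim
        fix u :: real assume "u \<in> {0<..<1}"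
        then show "(\<lambda>n. split_mean g n (nat \<lfloor>real (Suc n) * u\<rfloor>)) \<longlonglongrightarrow> ?c u"
          using split_mean_tendsto[OF Y int lim cont bdd, of u] by simp
      qed
      have "\<bar>split_mean g n i\<bar> \<le> 1" for n i
      proof -
        let ?G = "\<lambda>q. g (combine (harm i - harm (Suc n)) (harm (n - i) - harm (Suc n)) (std_tree i (fst q)) (std_tree (n - i) (snd q)))"
        have G: "integrable (M \<Otimes>\<^sub>M M) ?G" using g1 by (intro MM.P.integrable_const_bound[where B = 1]) auto
        have "\<bar>split_mean g n i\<bar> \<le> (\<integral>q. \<bar>?G q\<bar> \<partial>(M \<Otimes>\<^sub>M M))"
          unfolding split_mean_def by (rule integral_abs_bound)
        also have "\<dots> \<le> (\<integral>q. 1 \<partial>(M \<Otimes>\<^sub>M M))" using G g1 by (intro integral_mono) auto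
        finally show ?thesis by (simp add: MM.P.prob_space)
      qed
      then show "AE u in U01. norm (split_mean g n (nat \<lfloor>real (Suc n) * u\<rfloor>)) \<le> 1" for n by simp
    qed simp
    then have 1: "(\<lambda>n. expectation (\<lambda>\<omega>. g (std_tree (Suc n) \<omega>))) \<longlonglongrightarrow> (\<integral>z. g z \<partial>Psi (distr M borel Y))"
      unfolding Psi_g expectation_std_tree_Suc[OF gm g1] .
    have "(\<lambda>n. expectation (\<lambda>\<omega>. g (std_tree n \<omega>))) \<longlonglongrightarrow> expectation (\<lambda>\<omega>. g (Y \<omega>))"
      by (rule tendsto_expectation_bounded_continuous[OF measurable_std_tree Y int lim cont bdd])
    from LIMSEQ_Suc[OF this] 1 have "(\<integral>z. g z \<partial>Psi (distr M borel Y)) = expectation (\<lambda>\<omega>. g (Y \<omega>))"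
      by (rule LIMSEQ_unique[symmetric])
    then show "(\<integral>z. g z \<partial>Psi (distr M borel Y)) = (\<integral>z. g z \<partial>distr M borel Y)"
      by (simp add: integral_distr)
  qed
qed

end

section \<open>Convergence of the integrated silhouette\<close>

theorem theorem8:
  fixes M :: "'a measure" and T :: "nat \<Rightarrow> 'a \<Rightarrow> node set"
    and Z :: "nat \<Rightarrow> 'a \<Rightarrow> c00 \<times> real"
  assumes "prob_space M"
    and "bst_sequence M T"
    and Z_def: "Z = (\<lambda>n \<omega>. (centered_int_silhouette (T n \<omega>), centered_eta (T n \<omega>)))"
  shows "(\<forall>n\<ge>1. Z n \<in> borel_measurable M) \<and>
    Psi \<in> centered_laws \<rightarrow> centered_laws \<and>
    (\<exists>(N :: (c00 \<times> real) measure) (Z_inf :: c00 \<times> real \<Rightarrow> c00 \<times> real).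
      prob_space N \<and> Z_inf \<in> borel_measurable N \<and>
      converges_in_distribution M Z N Z_inf \<and>
      distr N borel Z_inf \<in> centered_laws \<and>
      Psi (distr N borel Z_inf) = distr N borel Z_inf \<and>
      (\<forall>\<mu>\<in>centered_laws. Psi \<mu> = \<mu> \<longrightarrow> \<mu> = distr N borel Z_inf))"
proof -
  obtain \<xi> where indep: "prob_space.indep_vars M (\<lambda>_. borel) \<xi> {1..}"
    and unif: "\<forall>n\<ge>1. distr M borel (\<xi> n) = uniform_measure lborel {0..1}"
    and T: "\<forall>n\<ge>1. \<forall>\<omega>\<in>space M. T n \<omega> = dom (bst_labelling (\<lambda>i. \<xi> i \<omega>) n)"
    using assms(2) unfolding bst_sequence_def by blast
  interpret uniform_input M \<xi>
    using assms(1) indep unif by (simp add: uniform_input_def uniform_input_axioms_def)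
  have Z_eq: "Z n \<omega> = std_tree n \<omega>" if "n \<ge> 1" "\<omega> \<in> space M" for n \<omega>
    using T that by (simp add: Z_def std_tree_def standardized_def random_history_def set_history)
  have meas: "Z n \<in> borel_measurable M" if "n \<ge> 1" for n
    using measurable_std_tree[of n] measurable_cong[of M "Z n" "std_tree n" borel] Z_eq[OF that] by blast
  obtain Y where Y [measurable]: "Y \<in> borel_measurable M" and sq: "integrable M (\<lambda>\<omega>. (norm (Y \<omega>))\<^sup>2)"
    and int: "\<And>n. integrable M (\<lambda>\<omega>. std_tree n \<omega> - Y \<omega>)"
    and lim: "(\<lambda>n. expectation (\<lambda>\<omega>. norm (std_tree n \<omega> - Y \<omega>))) \<longlonglongrightarrow> 0"
    using ex_mean_limit by blast
  define N where "N = distr M borel Y"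
  note fixed = Psi_limit_law[OF Y sq int lim, folded N_def]
  have id: "distr N borel (\<lambda>z. z) = N" by (rule distr_id2) (simp add: N_def)
  have "converges_in_distribution M Z N (\<lambda>z. z)"
    unfolding converges_in_distribution_def
  proof (intro allI impI)
    fix g :: "c00 \<times> real \<Rightarrow> real" assume g: "continuous_on UNIV g \<and> bounded (range g)"
    then have gm: "g \<in> borel_measurable borel" by (intro borel_measurable_continuous_onI) simp
    have "(\<lambda>n. expectation (\<lambda>\<omega>. g (std_tree n \<omega>))) \<longlonglongrightarrow> expectation (\<lambda>\<omega>. g (Y \<omega>))"
      using g by (intro tendsto_expectation_bounded_continuous[OF measurable_std_tree Y int lim]) auto
    also have "expectation (\<lambda>\<omega>. g (Y \<omega>)) = (\<integral>z. g z \<partial>N)"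
      unfolding N_def using gm by (simp add: integral_distr)
    finally have "(\<lambda>n. expectation (\<lambda>\<omega>. g (std_tree n \<omega>))) \<longlonglongrightarrow> (\<integral>z. g z \<partial>N)" .
    then show "(\<lambda>n. expectation (\<lambda>\<omega>. g (Z n \<omega>))) \<longlonglongrightarrow> (\<integral>z. g z \<partial>N)"
    proof (rule Lim_transform_eventually)
      show "\<forall>\<^sub>F n in sequentially. expectation (\<lambda>\<omega>. g (std_tree n \<omega>)) = expectation (\<lambda>\<omega>. g (Z n \<omega>))"
        using eventually_ge_at_top[of 1]
        by eventually_elim (auto intro!: Bochner_Integration.integral_cong simp: Z_eq)
    qed
  qed
  moreover have "(\<lambda>z. z) \<in> borel_measurable N" unfolding N_def by simp
  ultimately show ?thesis
    using meas Psi_in_centered_laws fixed fixed_point_unique centered_laws_moments(1)[OF fixed(1)]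
    by (intro conjI exI[of _ N] exI[of _ "\<lambda>z. z"]) (auto simp: id)
qed

end
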